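(* Let $V\subset\mathbf{P}^N(\mathbf{C})$ be a complex projective algebraic variety and let $f:\mathbf{C}\to V$ be a holomorphic curve satisfying $\|f'(z)\|=O(|z|^\sigma)$ as $|z|\to\infty$ for some real $\sigma>-1$. If $$\limsup_{r\to\infty}\frac{T_f(r)}{r^{2\sigma+2}}>0,$$ then $f$ has at least one $\bar{T}$-direction.
   Context: A holomorphic curve $f:\mathbf{C}\to V\subset\mathbf{P}^N(\mathbf{C})$ is a holomorphic map with image in $V$; $\mathbf{f}=(f_0,\ldots,f_N)$ denotes a homogeneous representation (entire functions without common zeros, $f=[f_0:\cdots:f_N]$). The Fubini-Study derivative is given by $$\|f'\|^2=\frac{\sum_{i<j}|f_i'f_j-f_if_j'|^2}{\big(\sum_{j=0}^N|f_j|^2\big)^2},$$ and the Nevanlinna characteristic is $$T_f(r)=\int_0^r\frac{dt}{t}\Big(\frac1\pi\int_{|z|\le t}\|f'\|^2(z)\,dm_z\Big),$$ with $dm$ the area element. For $0\le\theta\le2\pi$ and $0<\epsilon<\pi$ let $\Omega(\theta,\epsilon)=\{z\in\mathbf{C}:\theta-\epsilon<\arg z<\theta+\epsilon\}$. A hypersurface $D$ in $\mathbf{P}^N(\mathbf{C})$ is defined by a nonconstant homogeneous polynomial $Q$, with $\mathrm{Supp}\,D=\{Q=0\}$. For an angular domain $\Omega$ let $n_f(t,\Omega,D)$ be the number of zeros of $Q\circ\mathbf{f}$ in $\{|z|<t\}\cap\Omega$, counted with multiplicity, and (since $0\notin\Omega$) $$N_f(r,\Omega,D)=\int_0^r\frac{n_f(t,\Omega,D)}{t}\,dt,$$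 with $N_f(r,\Omega,D)=+\infty$ if $Q\circ\mathbf{f}\equiv0$. Definition: a ray $J(\theta)=\{z\in\mathbf{C}:\arg z=\theta\}$ is called a $\bar{T}$-direction for $f:\mathbf{C}\to V$ if for every $\epsilon$ with $0<\epsilon<\pi$ and for all hypersurfaces $D_1,\ldots,D_q$ in $\mathbf{P}^N(\mathbf{C})$ ($q\ge1$) such that $\bigcap_{1\le i\le q}\mathrm{Supp}\,D_i\cap V$ consists of finitely many points, one has $$\max_{1\le i\le q}\ \limsup_{r\to\infty}\frac{N_f(r,\Omega(\theta,\epsilon),D_i)}{T_f(r)}>0.$$ *)

theory Defs
  imports
    "HOL-Complex_Analysis.Complex_Analysis"
    "HOL-Library.Poly_Mapping"
    "HOL-Library.Landau_Symbols"
begin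

unbundle no fps_syntax

text \<open>
  The homogeneous coordinates of the complex projective space of dimension \<open>N = CARD('n) - 1\<close> are
  indexed by a finite type \<open>'n\<close>; a point is the set of its homogeneous coordinate vectors.
\<close>

definition proj_point :: "complex ^ 'n \<Rightarrow> (complex ^ 'n) set" where
  "proj_point v = {c *s v | c. c \<noteq> 0}"

type_synonym 'n cpoly = "('n \<Rightarrow>\<^sub>0 nat) \<Rightarrow>\<^sub>0 complex"

definition cpoly_eval :: "'n::finite cpoly \<Rightarrow> complex ^ 'n \<Rightarrow> complex" where
  "cpoly_eval Q v =
     (\<Sum>m\<in>Poly_Mapping.keys Q. Poly_Mapping.lookup Q m * (\<Prod>i\<in>UNIV. (v $ i) ^ Poly_Mapping.lookup m i))"

definition homogeneous :: "nat \<Rightarrow> 'n::finite cpoly \<Rightarrow> bool" where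
  "homogeneous d Q \<longleftrightarrow> (\<forall>m\<in>Poly_Mapping.keys Q. (\<Sum>i\<in>UNIV. Poly_Mapping.lookup m i) = d)"

text \<open>A hypersurface is given by its defining polynomial, so it may have multiple components.\<close>

definition hypersurface :: "'n::finite cpoly \<Rightarrow> bool" where
  "hypersurface Q \<longleftrightarrow> Q \<noteq> 0 \<and> (\<exists>d\<ge>1. homogeneous d Q)"

definition Supp :: "'n::finite cpoly \<Rightarrow> (complex ^ 'n) set set" where
  "Supp Q = {proj_point v | v. v \<noteq> 0 \<and> cpoly_eval Q v = 0}"

text \<open>Varieties are Zariski closed sets; irreducibility is not required.\<close>

definition projective_variety :: "(complex ^ 'n::finite) set set \<Rightarrow> bool" where
  "projective_variety V \<longleftrightarrow>
     (\<exists>S. (\<forall>Q\<in>S. \<exists>d. homogeneous d Q) \<and>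
          V = {proj_point v | v. v \<noteq> 0 \<and> (\<forall>Q\<in>S. cpoly_eval Q v = 0)})"

text \<open>Holomorphy of a map into projective space: local existence of holomorphic lifts.\<close>

definition holomorphic_curve ::
    "(complex ^ 'n::finite) set set \<Rightarrow> (complex \<Rightarrow> (complex ^ 'n) set) \<Rightarrow> bool" where
  "holomorphic_curve V f \<longleftrightarrow>
     (\<forall>z0. \<exists>U G. open U \<and> z0 \<in> U \<and> (\<forall>i. (\<lambda>z. G z $ i) holomorphic_on U) \<and>
            (\<forall>z\<in>U. G z \<noteq> 0 \<and> f z = proj_point (G z))) \<and>
     range f \<subseteq> V"

definition homogeneous_rep ::
    "(complex \<Rightarrow> (complex ^ 'n::finite) set) \<Rightarrow> (complex \<Rightarrow> complex ^ 'n) \<Rightarrow> bool" where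
  "homogeneous_rep f F \<longleftrightarrow>
     (\<forall>i. (\<lambda>z. F z $ i) holomorphic_on UNIV) \<and> (\<forall>z. F z \<noteq> 0) \<and> (\<forall>z. f z = proj_point (F z))"

text \<open>
  The following quantities attached to a curve are computed from a homogeneous representation \<open>F\<close>;
  they do not depend on its choice.
\<close>

definition FS_deriv :: "(complex \<Rightarrow> complex ^ 'n::{finite,linorder}) \<Rightarrow> complex \<Rightarrow> real" where
  "FS_deriv F z = sqrt
     ((\<Sum>(i, j)\<in>{(i, j). i < j}.
          (cmod (deriv (\<lambda>w. F w $ i) z * F z $ j - F z $ i * deriv (\<lambda>w. F w $ j) z))\<^sup>2)
      / (\<Sum>j\<in>UNIV. (cmod (F z $ j))\<^sup>2)\<^sup>2)"

definition nev_char :: "(complex \<Rightarrow> complex ^ 'n::{finite,linorder}) \<Rightarrow> real \<Rightarrow> real" where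
  "nev_char F r =
     (LINT t:{0<..<r}|lborel. (1 / t) * ((1 / pi) * (LINT z:cball 0 t|lborel. (FS_deriv F z)\<^sup>2)))"

text \<open>The argument is multivalued here, so that \<open>\<theta> \<plusminus> \<epsilon>\<close> may leave the range of \<^const>\<open>Arg\<close>.\<close>

definition sector :: "real \<Rightarrow> real \<Rightarrow> complex set" where
  "sector \<theta> \<epsilon> = {rcis \<rho> \<phi> | \<rho> \<phi>. \<rho> > 0 \<and> \<theta> - \<epsilon> < \<phi> \<and> \<phi> < \<theta> + \<epsilon>}"

text \<open>\<^const>\<open>zorder\<close> is the multiplicity of a zero if the function does not vanish identically.\<close>

definition zero_count ::
    "(complex \<Rightarrow> complex ^ 'n::finite) \<Rightarrow> real \<Rightarrow> complex set \<Rightarrow> 'n cpoly \<Rightarrow> nat" where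
  "zero_count F t \<Omega> Q =
     (\<Sum>z\<in>{z \<in> ball 0 t \<inter> \<Omega>. cpoly_eval Q (F z) = 0}. nat (zorder (\<lambda>w. cpoly_eval Q (F w)) z))"

definition nev_count ::
    "(complex \<Rightarrow> complex ^ 'n::finite) \<Rightarrow> real \<Rightarrow> complex set \<Rightarrow> 'n cpoly \<Rightarrow> ereal" where
  "nev_count F r \<Omega> Q =
     (if \<forall>z. cpoly_eval Q (F z) = 0 then \<infinity>
      else ereal (LINT t:{0<..<r}|lborel. real (zero_count F t \<Omega> Q) / t))"

definition Tbar_direction ::
    "(complex ^ 'n::{finite,linorder}) set set \<Rightarrow>
     (complex \<Rightarrow> complex ^ 'n::{finite,linorder}) \<Rightarrow> real \<Rightarrow> bool" where
  "Tbar_direction V F \<theta> \<longleftrightarrow>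
     (\<forall>\<epsilon>. 0 < \<epsilon> \<and> \<epsilon> < pi \<longrightarrow>
       (\<forall>(q::nat) (D :: nat \<Rightarrow> 'n cpoly).
          q \<ge> 1 \<and> (\<forall>i\<in>{1..q}. hypersurface (D i)) \<and> finite ((\<Inter>i\<in>{1..q}. Supp (D i)) \<inter> V) \<longrightarrow>
          (MAX i\<in>{1..q}. Limsup at_top
             (\<lambda>r. nev_count F r (sector \<theta> \<epsilon>) (D i) / ereal (nev_char F r))) > 0))"

end

theory Submission imports Defs begin

text \<open>
  Suppose that no ray is such a direction. Then every ray has a sector and finitely many hypersurfaces meeting
  \<open>V\<close> in a finite set whose counting functions in the sector are \<open>o(T)\<close>, hence \<open>o(r\<^sup>\<beta>)\<close> with \<open>\<beta> = 2 * \<sigma> + 2\<close>,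
  because the bound on \<open>FS_deriv\<close> gives \<open>T = O(r\<^sup>\<beta>)\<close>. By compactness it suffices to show that, after rescaling a
  disc of radius proportional to \<open>r\<close> in such a sector to a fixed disc and dividing by \<open>R = r\<^sup>\<beta>\<close>, the area of the
  curve tends to \<open>0\<close>; this yields \<open>T = o(r\<^sup>\<beta>)\<close>, a contradiction.

  On the fixed disc let \<open>u = ln (norm F) / R\<close>, whose Laplacian is bounded. For each hypersurface \<open>Q\<close> of degree \<open>d\<close>
  subtract \<open>ln (cmod (Q F)) / (d * R)\<close> with the few zeros divided out. The result \<open>Y\<close> has the same Laplacian as \<open>u\<close>
  and is nearly nonnegative, hence satisfies \<open>|grad Y|^2 = O(Y + Y^2)\<close>. Composing \<open>Y\<close> with a logarithmic cutoff and
  integrating against a test function shows that the Laplacian has little mass where \<open>Y\<close> is small. Where all the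
  \<open>Y\<close> are bounded below, \<open>F\<close> is exponentially close to every hypersurface; away from the zeros, which at the scale
  \<open>1 / sqrt R\<close> spoil only a small area, a normal family argument (Montel, Hurwitz) shows that \<open>F\<close> is
  nearly constant at this scale, so that its derivative is small.
\<close>

text \<open>All the functions Y have the same half-Laplacian B, the rescaled Fubini-Study density,
  so the mass found where a single one of them is small is mass of the curve, and the hypersurfaces
  can be treated one at a time. To see this mass, a bounded increasing function \<Psi> of Y is
  integrated against a test function: the half-Laplacian of \<Psi>(Y) is \<Psi>'(Y) B + \<Psi>''(Y)
  |grad Y|^2 / 2, and the second term must stay bounded. As |grad Y|^2 is of order Y near 0,
  |\<Psi>''| may be as large as 1/Y, so \<Psi>' may grow like ln (1/Y). This slow divergence is just
  enough to make the mass on {Y \<le> \<eta>} small. The bound O(sqrt R) on the Fubini-Study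
  derivative singles out the scale 1 / sqrt R: on discs of a small multiple of this size the curve
  stays in one affine chart. The number of zeros, at most \<nu> R, enters twice: it limits the loss
  in the lower bound for Y, and it limits the total area, of order \<nu> R * (1 / R), of the discs
  that are given up. The finite intersection enters because a holomorphic map into finitely many
  points is constant.\<close>

no_notation fps_nth (infixl \<open>$\<close> 75)

section \<open>Wirtinger derivatives\<close>

text \<open>
  Here \<open>p\<close> is twice the Wirtinger derivative of \<open>g\<close> with respect to \<open>z\<close>, and \<open>B\<close> is half the Laplacian of \<open>g\<close>.
\<close>

definition wirtinger_C2 ::
    "complex set \<Rightarrow> (complex \<Rightarrow> real) \<Rightarrow> (complex \<Rightarrow> complex) \<Rightarrow> (complex \<Rightarrow> complex) \<Rightarrow>
     (complex \<Rightarrow> real) \<Rightarrow> bool" where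
  "wirtinger_C2 S g p A B \<longleftrightarrow> open S \<and> continuous_on S A \<and> continuous_on S B \<and>
     (\<forall>z\<in>S. (g has_derivative (\<lambda>h. Re (p z * h))) (at z) \<and>
             (p has_derivative (\<lambda>h. A z * h + of_real (B z) * cnj h)) (at z))"

lemma wirtinger_C2_D:
  assumes "wirtinger_C2 S g p A B"
  shows "open S" "continuous_on S A" "continuous_on S B"
    "\<And>z. z \<in> S \<Longrightarrow> (g has_derivative (\<lambda>h. Re (p z * h))) (at z)"
    "\<And>z. z \<in> S \<Longrightarrow> (p has_derivative (\<lambda>h. A z * h + of_real (B z) * cnj h)) (at z)"
    "continuous_on S g" "continuous_on S p"
proof -
  show *: "open S" "continuous_on S A" "continuous_on S B"
    "\<And>z. z \<in> S \<Longrightarrow> (g has_derivative (\<lambda>h. Re (p z * h))) (at z)"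
    "\<And>z. z \<in> S \<Longrightarrow> (p has_derivative (\<lambda>h. A z * h + of_real (B z) * cnj h)) (at z)"
    using assms by (auto simp: wirtinger_C2_def)
  show "continuous_on S g" "continuous_on S p"
    using *(1) *(4,5) by (auto simp: continuous_on_eq_continuous_at intro: has_derivative_continuous)
qed

lemma wirtinger_C2_subset:
  "wirtinger_C2 S g p A B \<Longrightarrow> open T \<Longrightarrow> T \<subseteq> S \<Longrightarrow> wirtinger_C2 T g p A B"
  by (auto simp: wirtinger_C2_def intro: continuous_on_subset)

lemma wirtinger_C2_scale_add:
  assumes g: "wirtinger_C2 S g p A B" and f: "wirtinger_C2 S f q C D"
  shows "wirtinger_C2 S (\<lambda>z. a * g z + b * f z + c) (\<lambda>z. of_real a * p z + of_real b * q z)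
           (\<lambda>z. of_real a * A z + of_real b * C z) (\<lambda>z. a * B z + b * D z)"
  unfolding wirtinger_C2_def
proof (intro conjI ballI)
  note G = wirtinger_C2_D[OF g] and F = wirtinger_C2_D[OF f]
  show "open S" by (fact G)
  show "continuous_on S (\<lambda>z. of_real a * A z + of_real b * C z)"
       "continuous_on S (\<lambda>z. a * B z + b * D z)"
    by (intro continuous_intros G F)+
  fix z assume z: "z \<in> S"
  show "((\<lambda>z. a * g z + b * f z + c) has_derivative
          (\<lambda>h. Re ((of_real a * p z + of_real b * q z) * h))) (at z)"
    by (rule derivative_eq_intros G(4)[OF z] F(4)[OF z] refl)+ (auto simp: algebra_simps)
  show "((\<lambda>z. of_real a * p z + of_real b * q z) has_derivative
          (\<lambda>h. (of_real a * A z + of_real b * C z) * h + of_real (a * B z + b * D z) * cnj h)) (at z)"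
    by (rule derivative_eq_intros G(5)[OF z] F(5)[OF z] refl)+ (auto simp: algebra_simps)
qed

text \<open>Writing Re (p h) as half of p h plus its conjugate splits the new second order term
  evenly: p^2 / 2 goes to the \<open>A\<close>-part, and |p|^2 / 2, half the squared gradient, to
  the \<open>B\<close>-part.\<close>

lemma wirtinger_C2_compose:
  assumes g: "wirtinger_C2 S g p A B"
    and d1: "\<And>z. z \<in> S \<Longrightarrow> (\<Psi> has_real_derivative \<Psi>1 (g z)) (at (g z))"
    and d2: "\<And>z. z \<in> S \<Longrightarrow> (\<Psi>1 has_real_derivative \<Psi>2 (g z)) (at (g z))"
    and c: "continuous_on S (\<lambda>z. \<Psi>2 (g z))"
  shows "wirtinger_C2 S (\<lambda>z. \<Psi> (g z)) (\<lambda>z. of_real (\<Psi>1 (g z)) * p z)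
    (\<lambda>z. of_real (\<Psi>1 (g z)) * A z + of_real (\<Psi>2 (g z)) * (p z)\<^sup>2 / 2)
    (\<lambda>z. \<Psi>1 (g z) * B z + \<Psi>2 (g z) * (cmod (p z))\<^sup>2 / 2)"
  unfolding wirtinger_C2_def
proof (intro conjI ballI)
  note G = wirtinger_C2_D[OF g]
  show "open S" by (fact G)
  have D1: "((\<lambda>z. \<Psi>1 (g z)) has_derivative (\<lambda>h. Re (p z * h) * \<Psi>2 (g z))) (at z)" if "z \<in> S" for z
    using has_derivative_compose[OF G(4)[OF that] d2[OF that, unfolded has_field_derivative_def]]
    by (simp add: mult.commute)
  have c1: "continuous_on S (\<lambda>z. \<Psi>1 (g z))"
    using G(1) D1 by (auto simp: continuous_on_eq_continuous_at intro: has_derivative_continuous)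
  show "continuous_on S (\<lambda>z. of_real (\<Psi>1 (g z)) * A z + of_real (\<Psi>2 (g z)) * (p z)\<^sup>2 / 2)"
       "continuous_on S (\<lambda>z. \<Psi>1 (g z) * B z + \<Psi>2 (g z) * (cmod (p z))\<^sup>2 / 2)"
    by (intro continuous_intros G c c1; simp)+
  fix z assume z: "z \<in> S"
  show "((\<lambda>z. \<Psi> (g z)) has_derivative (\<lambda>h. Re (of_real (\<Psi>1 (g z)) * p z * h))) (at z)"
    using has_derivative_compose[OF G(4)[OF z] d1[OF z, unfolded has_field_derivative_def]]
    by (simp add: algebra_simps)
  have "((\<lambda>z. complex_of_real (\<Psi>1 (g z)) * p z) has_derivative
      (\<lambda>h. of_real (\<Psi>1 (g z)) * (A z * h + of_real (B z) * cnj h) + of_real (Re (p z * h) * \<Psi>2 (g z)) * p z)) (at z)"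
    by (intro has_derivative_mult has_derivative_of_real D1 G z)
  also have "(\<lambda>h. of_real (\<Psi>1 (g z)) * (A z * h + of_real (B z) * cnj h) + of_real (Re (p z * h) * \<Psi>2 (g z)) * p z)
     = (\<lambda>h. (of_real (\<Psi>1 (g z)) * A z + of_real (\<Psi>2 (g z)) * (p z)\<^sup>2 / 2) * h +
            of_real (\<Psi>1 (g z) * B z + \<Psi>2 (g z) * (cmod (p z))\<^sup>2 / 2) * cnj h)"
  proof
    fix h
    have e: "complex_of_real (Re (p z * h)) = (p z * h + cnj (p z) * cnj h) / 2"
      using complex_add_cnj[of "p z * h"] by simp
    have e2: "complex_of_real ((cmod (p z))\<^sup>2) = p z * cnj (p z)"
      by (rule complex_norm_square)
    show "of_real (\<Psi>1 (g z)) * (A z * h + of_real (B z) * cnj h) + of_real (Re (p z * h) * \<Psi>2 (g z)) * p z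
      = (of_real (\<Psi>1 (g z)) * A z + of_real (\<Psi>2 (g z)) * (p z)\<^sup>2 / 2) * h +
            of_real (\<Psi>1 (g z) * B z + \<Psi>2 (g z) * (cmod (p z))\<^sup>2 / 2) * cnj h"
      unfolding of_real_mult of_real_add of_real_divide e e2 by (simp add: field_simps power2_eq_square)
  qed
  finally show "((\<lambda>z. of_real (\<Psi>1 (g z)) * p z) has_derivative
     (\<lambda>h. (of_real (\<Psi>1 (g z)) * A z + of_real (\<Psi>2 (g z)) * (p z)\<^sup>2 / 2) * h +
            of_real (\<Psi>1 (g z) * B z + \<Psi>2 (g z) * (cmod (p z))\<^sup>2 / 2) * cnj h)) (at z)" .
qed

text \<open>The function is the logarithm of the norm of the vector of all \<open>G j\<close>, and
  the last component is the Gram determinant of this vector and its derivative over the fourth power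
  of the norm. It serves twice: for one function, where the determinant vanishes, and for all
  coordinates of a curve.\<close>

lemma wirtinger_C2_log_sum_squares:
  fixes G :: "'j \<Rightarrow> complex \<Rightarrow> complex" and J :: "'j set"
  defines "s \<equiv> \<lambda>z. \<Sum>j\<in>J. (cmod (G j z))\<^sup>2"
  defines "n \<equiv> \<lambda>z. \<Sum>j\<in>J. cnj (G j z) * deriv (G j) z"
  assumes S: "open S" and hol: "\<And>j. j \<in> J \<Longrightarrow> G j holomorphic_on S"
    and nz: "\<And>z. z \<in> S \<Longrightarrow> s z \<noteq> 0"
  shows "\<exists>A. wirtinger_C2 S (\<lambda>z. ln (s z) / 2) (\<lambda>z. n z / of_real (s z)) A
     (\<lambda>z. ((\<Sum>j\<in>J. (cmod (deriv (G j) z))\<^sup>2) * s z - (cmod (n z))\<^sup>2) / (s z)\<^sup>2)"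
proof -
  define m where "m z = (\<Sum>j\<in>J. cnj (G j z) * deriv (deriv (G j)) z)" for z
  define e where "e z = (\<Sum>j\<in>J. (cmod (deriv (G j) z))\<^sup>2)" for z
  define A where "A z = m z / of_real (s z) - (n z)\<^sup>2 / of_real ((s z)\<^sup>2)" for z
  have hol1: "deriv (G j) holomorphic_on S" and hol2: "deriv (deriv (G j)) holomorphic_on S" if "j \<in> J" for j
    using hol[OF that] S by (auto intro!: holomorphic_deriv)
  have c0: "continuous_on S (G j)" "continuous_on S (deriv (G j))" "continuous_on S (deriv (deriv (G j)))"
    if "j \<in> J" for j
    using hol[OF that] hol1[OF that] hol2[OF that] by (auto intro: holomorphic_on_imp_continuous_on)
  have cs: "continuous_on S s" "continuous_on S n" "continuous_on S m" "continuous_on S e"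
    unfolding s_def n_def m_def e_def by (intro continuous_intros c0; assumption)+
  have pos: "s z > 0" if "z \<in> S" for z
    using nz[OF that] unfolding s_def by (metis (no_types, lifting) order_le_less sum_nonneg zero_le_power2)
  have "wirtinger_C2 S (\<lambda>z. ln (s z) / 2) (\<lambda>z. n z / of_real (s z)) A
     (\<lambda>z. (e z * s z - (cmod (n z))\<^sup>2) / (s z)\<^sup>2)"
    unfolding wirtinger_C2_def
  proof (intro conjI ballI)
    show "open S" by fact
    show "continuous_on S A" "continuous_on S (\<lambda>z. (e z * s z - (cmod (n z))\<^sup>2) / (s z)\<^sup>2)"
      unfolding A_def by (intro continuous_intros cs; use nz in force)+
    fix z assume z: "z \<in> S"
    have d0: "(G j has_derivative (\<lambda>h. deriv (G j) z * h)) (at z)"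
      "(deriv (G j) has_derivative (\<lambda>h. deriv (deriv (G j)) z * h)) (at z)" if "j \<in> J" for j
      using holomorphic_derivI[OF hol[OF that] S z] holomorphic_derivI[OF hol1[OF that] S z]
      by (auto simp: has_field_derivative_def)
    have ds: "(s has_derivative (\<lambda>h. 2 * Re (n z * h))) (at z)"
      unfolding s_def n_def dot_square_norm[symmetric]
      by (rule derivative_eq_intros d0 refl | assumption)+
         (auto simp: fun_eq_iff inner_complex_def sum_distrib_left sum_distrib_right Re_sum
            algebra_simps intro!: sum.cong)
    show "((\<lambda>z. ln (s z) / 2) has_derivative (\<lambda>h. Re (n z / of_real (s z) * h))) (at z)"
      using has_derivative_mult_right[OF has_derivative_ln[OF pos[OF z] ds], of "1/2"] pos[OF z]
      by (simp add: field_simps Re_divide_of_real del: times_complex.simps)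
    have dn: "(n has_derivative (\<lambda>h. m z * h + of_real (e z) * cnj h)) (at z)"
      unfolding n_def m_def e_def
      by (rule derivative_eq_intros d0 refl | assumption)+
         (auto simp: fun_eq_iff sum_distrib_left sum_distrib_right complex_norm_square sum.distrib
            algebra_simps simp del: of_real_power intro!: sum.cong)
    have "((\<lambda>z. n z / of_real (s z)) has_derivative
        (\<lambda>h. ((m z * h + of_real (e z) * cnj h) * of_real (s z) - n z * of_real (2 * Re (n z * h))) /
           (of_real (s z) * of_real (s z)))) (at z)"
      by (rule has_derivative_divide' dn has_derivative_of_real ds)+ (use nz[OF z] in auto)
    also have "(\<lambda>h. ((m z * h + of_real (e z) * cnj h) * of_real (s z) - n z * of_real (2 * Re (n z * h))) /
           (of_real (s z) * of_real (s z))) =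
        (\<lambda>h. A z * h + of_real ((e z * s z - (cmod (n z))\<^sup>2) / (s z)\<^sup>2) * cnj h)"
    proof
      fix h
      have e: "complex_of_real (2 * Re (n z * h)) = n z * h + cnj (n z) * cnj h"
        using complex_add_cnj[of "n z * h"] by simp
      have e2: "complex_of_real ((cmod (n z))\<^sup>2) = n z * cnj (n z)"
        by (rule complex_norm_square)
      show "((m z * h + of_real (e z) * cnj h) * of_real (s z) - n z * of_real (2 * Re (n z * h))) /
           (of_real (s z) * of_real (s z)) = A z * h + of_real ((e z * s z - (cmod (n z))\<^sup>2) / (s z)\<^sup>2) * cnj h"
        unfolding e unfolding A_def of_real_divide of_real_diff of_real_mult e2
        using nz[OF z] by (simp add: field_simps power2_eq_square)
    qed
    finally show "((\<lambda>z. n z / of_real (s z)) has_derivative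
      (\<lambda>h. A z * h + of_real ((e z * s z - (cmod (n z))\<^sup>2) / (s z)\<^sup>2) * cnj h)) (at z)" .
  qed
  then show ?thesis unfolding e_def by blast
qed

text \<open>With a single component, equality holds in the Cauchy-Schwarz inequality, so the Gram
  determinant is 0 and the logarithm is harmonic.\<close>

lemma wirtinger_C2_ln_cmod:
  assumes "open S" "g holomorphic_on S" "\<And>z. z \<in> S \<Longrightarrow> g z \<noteq> 0"
  shows "\<exists>p A. wirtinger_C2 S (\<lambda>z. ln (cmod (g z))) p A (\<lambda>_. 0)"
proof -
  obtain A where "wirtinger_C2 S (\<lambda>z. ln (\<Sum>j\<in>{()}. (cmod (g z))\<^sup>2) / 2)
      (\<lambda>z. (\<Sum>j\<in>{()}. cnj (g z) * deriv g z) / of_real (\<Sum>j\<in>{()}. (cmod (g z))\<^sup>2)) A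
     (\<lambda>z. ((\<Sum>j\<in>{()}. (cmod (deriv g z))\<^sup>2) * (\<Sum>j\<in>{()}. (cmod (g z))\<^sup>2)
        - (cmod (\<Sum>j\<in>{()}. cnj (g z) * deriv g z))\<^sup>2) / (\<Sum>j\<in>{()}. (cmod (g z))\<^sup>2)\<^sup>2)"
    using wirtinger_C2_log_sum_squares[of S "{()}" "\<lambda>_. g"] assms by auto
  moreover have "ln ((cmod (g z))\<^sup>2) / 2 = ln (cmod (g z))" for z
    by (simp add: ln_realpow)
  ultimately show ?thesis
    by (auto simp: norm_mult power_mult_distrib)
qed

section \<open>Circle means and the gradient estimate\<close>

lemma circle_in_cball:
  fixes z :: complex assumes "0 \<le> s" "s \<le> t" shows "z + of_real s * cis x \<in> cball z t"
  using assms by (simp add: dist_norm norm_mult)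

text \<open>
  The two circle integrals of \<open>p\<close> below have radial derivatives that only involve \<open>B\<close>: the terms with \<open>A\<close>
  are eliminated by integrating an angular derivative over the full period.
\<close>

context
  fixes S g p A B z and t M :: real
  assumes C2: "wirtinger_C2 S g p A B" and t: "t > 0" and sub: "cball z t \<subseteq> S"
begin

abbreviation (input) pt :: "real \<Rightarrow> real \<Rightarrow> complex" where
  "pt s x \<equiv> z + of_real s * cis x"

abbreviation (input) circ :: "(real \<Rightarrow> 'b::real_normed_vector) \<Rightarrow> 'b" where
  "circ f \<equiv> integral {0..2*pi} f"

lemma pt_in: "s \<in> {0..t} \<Longrightarrow> pt s x \<in> S"
  using circle_in_cball[of s t z x] sub by auto

lemma cont_pt:
  assumes "continuous_on S f"
  shows "continuous_on ({0..t} \<times> {0..2*pi}) (\<lambda>(s, x). f (pt s x))"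
    "s \<in> {0..t} \<Longrightarrow> continuous_on {0..2*pi} (\<lambda>x. f (pt s x))"
proof -
  show *: "continuous_on ({0..t} \<times> {0..2*pi}) (\<lambda>(s, x). f (pt s x))"
    unfolding case_prod_beta
    by (rule continuous_on_compose2[OF assms]) (auto intro!: continuous_intros pt_in)
  show "continuous_on {0..2*pi} (\<lambda>x. f (pt s x))" if "s \<in> {0..t}"
    by (rule continuous_on_compose2[OF assms]) (use that in \<open>auto intro!: continuous_intros pt_in\<close>)
qed

lemma deriv_cis: "(cis has_vector_derivative \<i> * cis x) (at x within X)"
  unfolding has_vector_derivative_def
  by (rule derivative_eq_intros refl has_derivative_cis | simp add: fun_eq_iff scaleR_conv_of_real)+

lemma pt_radial: "((\<lambda>s. pt s x) has_derivative (\<lambda>h. of_real h * cis x)) (at s within X)"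
  by (rule derivative_eq_intros refl | simp)+

lemma pt_angular: "((\<lambda>x. pt s x) has_derivative (\<lambda>h. of_real h * (of_real s * (\<i> * cis x)))) (at x within X)"
  by (rule derivative_eq_intros refl deriv_cis[unfolded has_vector_derivative_def]
       | simp add: fun_eq_iff scaleR_conv_of_real)+

lemma g_radial:
  assumes "s \<in> {0..t}"
  shows "((\<lambda>s. g (pt s x)) has_vector_derivative Re (p (pt s x) * cis x)) (at s within X)"
  using has_derivative_compose[OF pt_radial wirtinger_C2_D(4)[OF C2 pt_in[OF assms]]]
  by (simp add: has_vector_derivative_def algebra_simps)

lemma g_angular:
  assumes "s \<in> {0..t}"
  shows "((\<lambda>x. g (pt s x)) has_vector_derivative Re (p (pt s x) * (of_real s * (\<i> * cis x)))) (at x within X)"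
  using has_derivative_compose[OF pt_angular wirtinger_C2_D(4)[OF C2 pt_in[OF assms]]]
  by (simp add: has_vector_derivative_def algebra_simps)

lemma p_radial:
  assumes "s \<in> {0..t}"
  shows "((\<lambda>s. p (pt s x)) has_vector_derivative
    (A (pt s x) * cis x + of_real (B (pt s x)) * cis (-x))) (at s within X)"
  using has_derivative_compose[OF pt_radial wirtinger_C2_D(5)[OF C2 pt_in[OF assms]]]
  by (simp add: has_vector_derivative_def scaleR_conv_of_real algebra_simps cis_cnj)

lemma p_angular:
  assumes "s \<in> {0..t}"
  shows "((\<lambda>x. p (pt s x)) has_vector_derivative
    (\<i> * of_real s * (A (pt s x) * cis x - of_real (B (pt s x)) * cis (-x)))) (at x within X)"
  using has_derivative_compose[OF pt_angular wirtinger_C2_D(5)[OF C2 pt_in[OF assms]]]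
  by (simp add: has_vector_derivative_def scaleR_conv_of_real algebra_simps cis_cnj)

lemma period_zero:
  fixes f :: "real \<Rightarrow> 'b::banach"
  assumes "\<And>x. (f has_vector_derivative f' x) (at x within {0..2*pi})" "f 0 = f (2*pi)"
  shows "circ f' = 0"
  using fundamental_theorem_of_calculus[of 0 "2*pi" f f'] assms by (simp add: integral_unique)

lemmas leib = leibniz_rule_vector_derivative[where U = "{0..t}" and a = 0 and b = "2*pi", unfolded cbox_interval]

lemma cont_all: "continuous_on S g" "continuous_on S p" "continuous_on S A" "continuous_on S B"
  using wirtinger_C2_D[OF C2] by auto

lemmas int_cont = integrable_continuous_real

lemma deriv_mean_g:
  assumes s: "s \<in> {0..t}"
  shows "((\<lambda>s. circ (\<lambda>x. g (pt s x))) has_vector_derivative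
     circ (\<lambda>x. Re (p (pt s x) * cis x))) (at s within {0..t})"
proof (rule leib)
  show "continuous_on ({0..t} \<times> {0..2*pi}) (\<lambda>(s, x). Re (p (pt s x) * cis x))"
    using cont_pt(1)[OF cont_all(2)] unfolding case_prod_beta by (intro continuous_intros)
  show "((\<lambda>s. g (pt s x)) has_vector_derivative Re (p (pt s x) * cis x)) (at s within {0..t})"
    if "s \<in> {0..t}" for s x by (rule g_radial[OF that])
qed (use s in \<open>auto intro!: int_cont cont_pt cont_all\<close>)

lemma deriv_mean_p:
  assumes s: "s \<in> {0..t}"
  shows "((\<lambda>s. circ (\<lambda>x. p (pt s x))) has_vector_derivative
     2 * circ (\<lambda>x. of_real (B (pt s x)) * cis (-x))) (at s within {0..t})"
proof -
  have c: "continuous_on {0..2*pi} (\<lambda>x. A (pt s x))" "continuous_on {0..2*pi} (\<lambda>x. B (pt s x))"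
    using cont_pt(2)[OF _ s] cont_all by auto
  have 1: "((\<lambda>s. circ (\<lambda>x. p (pt s x))) has_vector_derivative
     circ (\<lambda>x. A (pt s x) * cis x + of_real (B (pt s x)) * cis (-x))) (at s within {0..t})"
  proof (rule leib)
    show "continuous_on ({0..t} \<times> {0..2*pi}) (\<lambda>(s, x). A (pt s x) * cis x + of_real (B (pt s x)) * cis (-x))"
      using cont_pt(1)[OF cont_all(3)] cont_pt(1)[OF cont_all(4)] unfolding case_prod_beta by (intro continuous_intros)
  qed (use s in \<open>auto intro!: p_radial int_cont cont_pt cont_all\<close>)
  \<comment> \<open>The angular derivative of p integrates to 0 over the circle. Up to the factor
    \<i> s, its two terms are those of the radial derivative with opposite signs, so both have the
    same integral.\<close>
  have "circ (\<lambda>x. A (pt s x) * cis x) = circ (\<lambda>x. of_real (B (pt s x)) * cis (-x))"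
  proof (cases "s = 0")
    case False
    have "circ (\<lambda>x. \<i> * of_real s * (A (pt s x) * cis x - of_real (B (pt s x)) * cis (-x))) = 0"
      by (rule period_zero[OF p_angular[OF s]]) simp
    then have "circ (\<lambda>x. A (pt s x) * cis x - of_real (B (pt s x)) * cis (-x)) = 0"
      using False by simp
    then show ?thesis
      by (subst (asm) integral_diff) (intro int_cont continuous_intros c | simp)+
  next
    \<comment> \<open>At s = 0 the factor s makes the angular identity empty; there A and B are
      constant in x, and both integrals vanish.\<close>
    case True
    have "circ (\<lambda>x. \<i> * cis x) = 0" by (rule period_zero[OF deriv_cis]) simp
    then have 0: "circ (\<lambda>x. cis x) = 0" by simp
    then have "circ (\<lambda>x. cnj (cis x)) = 0" using integral_cnj[of "{0..2*pi}" cis] by simp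
    then have "circ (\<lambda>x. cis (-x)) = 0" by (simp add: cis_cnj)
    with 0 show ?thesis by (simp add: True)
  qed
  then have "circ (\<lambda>x. A (pt s x) * cis x + of_real (B (pt s x)) * cis (-x))
     = 2 * circ (\<lambda>x. of_real (B (pt s x)) * cis (-x))"
    by (subst integral_add) (intro int_cont continuous_intros c | simp)+
  with 1 show ?thesis by simp
qed

text \<open>The real part of the integral is the flux of the gradient of g through the circle of
  radius s, so this is the divergence theorem differentiated in s. The factor 2 appears because B is
  half the Laplacian.\<close>

lemma deriv_flux:
  assumes s: "s \<in> {0..t}"
  shows "((\<lambda>s. circ (\<lambda>x. of_real s * (p (pt s x) * cis x))) has_vector_derivative
     of_real (2 * s * circ (\<lambda>x. B (pt s x)))) (at s within {0..t})"
proof -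
  define L where "L s x = of_real s * ((A (pt s x) * cis x + of_real (B (pt s x)) * cis (-x)) * cis x)
      + p (pt s x) * cis x" for s x
  have c: "continuous_on {0..2*pi} (\<lambda>x. A (pt s x))" "continuous_on {0..2*pi} (\<lambda>x. B (pt s x))"
    "continuous_on {0..2*pi} (\<lambda>x. p (pt s x))"
    using cont_pt(2)[OF _ s] cont_all by auto
  have 1: "((\<lambda>s. circ (\<lambda>x. of_real s * (p (pt s x) * cis x))) has_vector_derivative
     circ (L s)) (at s within {0..t})"
  proof (rule leib)
    show "continuous_on ({0..t} \<times> {0..2*pi}) (\<lambda>(s, x). L s x)"
      using cont_pt(1)[OF cont_all(3)] cont_pt(1)[OF cont_all(4)] cont_pt(1)[OF cont_all(2)]
      unfolding case_prod_beta L_def by (intro continuous_intros)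
    show "((\<lambda>s. of_real s * (p (pt s x) * cis x)) has_vector_derivative L s x) (at s within {0..t})"
      if "s \<in> {0..t}" for s x
      using has_vector_derivative_mult[OF has_vector_derivative_of_real[OF DERIV_ident]
         has_vector_derivative_mult[OF p_radial[OF that] has_vector_derivative_const]]
      unfolding L_def id_def by simp
  qed (use s in \<open>auto intro!: int_cont continuous_intros cont_pt cont_all\<close>)
  have d: "((\<lambda>x. p (pt s x) * cis x) has_vector_derivative
    (p (pt s x) * (\<i> * cis x) + \<i> * of_real s * (A (pt s x) * cis x - of_real (B (pt s x)) * cis (-x)) * cis x))
     (at x within X)" for x X
    by (rule has_vector_derivative_mult p_angular[OF s] deriv_cis)+
  have 2: "circ (\<lambda>x. p (pt s x) * (\<i> * cis x) +
      \<i> * of_real s * (A (pt s x) * cis x - of_real (B (pt s x)) * cis (-x)) * cis x) = 0"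
    by (rule period_zero[OF d]) simp
  have e: "cis (-x) * cis x = 1" for x by (simp add: cis_mult)
  have "L s x = - \<i> * (p (pt s x) * (\<i> * cis x) +
      \<i> * of_real s * (A (pt s x) * cis x - of_real (B (pt s x)) * cis (-x)) * cis x)
      + of_real (2 * s * B (pt s x))" for x
    using e[of x] unfolding L_def of_real_mult of_real_numeral by (simp add: algebra_simps)
  then have "circ (L s) = circ (\<lambda>x. - \<i> * (p (pt s x) * (\<i> * cis x) +
      \<i> * of_real s * (A (pt s x) * cis x - of_real (B (pt s x)) * cis (-x)) * cis x)
      + of_real (2 * s * B (pt s x)))" by presburger
  also have "\<dots> = - \<i> * 0 + circ (\<lambda>x. of_real (2 * s * B (pt s x)))"
    by (subst integral_add) (use 2 in \<open>(intro int_cont continuous_intros c | simp)+\<close>)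
  also have "\<dots> = of_real (circ (\<lambda>x. 2 * s * B (pt s x)))"
    using integral_linear[OF _ bounded_linear_of_real[where 'a = complex], of "\<lambda>x. 2 * s * B (pt s x)" "{0..2*pi}"]
    by (simp add: o_def int_cont continuous_intros c)
  finally show ?thesis using 1 by simp
qed

text \<open>The flux estimate bounds the derivative of the circle integral by 2 pi M s; integration
  from radius 0, where the circle integral is 2 pi g(z), gives the claim. For M = 0 this is one half
  of the mean value property.\<close>

lemma circle_mean_upper:
  assumes M: "\<And>w. w \<in> cball z t \<Longrightarrow> B w \<le> M"
  shows "circ (\<lambda>x. g (pt t x)) \<le> 2 * pi * g z + pi * M * t\<^sup>2"
proof -
  define Q where "Q s = circ (\<lambda>x. of_real s * (p (pt s x) * cis x))" for s
  have sub': "at s within {0..r} \<le> at s within {0..t}" if "r \<le> t" for s r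
    using that by (intro at_le) auto
  have bB: "circ (\<lambda>x. B (pt s x)) \<le> 2 * pi * M" if "s \<in> {0..t}" for s
  proof -
    have "circ (\<lambda>x. B (pt s x)) \<le> circ (\<lambda>x. M)"
      by (rule integral_le) (use that in \<open>auto intro!: int_cont cont_pt cont_all M circle_in_cball\<close>)
    then show ?thesis by simp
  qed
  have Q: "Re (Q r) \<le> 2 * pi * M * r\<^sup>2" if r: "r \<in> {0..t}" for r
  proof -
    have "((\<lambda>s. 2 * s * circ (\<lambda>x. B (pt s x))) has_integral Re (Q r) - Re (Q 0)) {0..r}"
    proof (rule fundamental_theorem_of_calculus)
      fix s assume "s \<in> {0..r}"
      then have "(Q has_vector_derivative of_real (2 * s * circ (\<lambda>x. B (pt s x)))) (at s within {0..t})"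
        unfolding Q_def using r by (intro deriv_flux) auto
      from bounded_linear.has_vector_derivative[OF bounded_linear_Re this]
      show "((\<lambda>s. Re (Q s)) has_vector_derivative 2 * s * circ (\<lambda>x. B (pt s x))) (at s within {0..r})"
        using r by (auto intro: has_vector_derivative_within_subset)
    qed (use r in auto)
    moreover have "((\<lambda>s. 4 * pi * M * s) has_integral 2 * pi * M * r\<^sup>2 - 2 * pi * M * 0\<^sup>2) {0..r}"
      by (rule fundamental_theorem_of_calculus)
         (use r in \<open>auto intro!: derivative_eq_intros simp: has_real_derivative_iff_has_vector_derivative[symmetric]\<close>)
    moreover have "2 * s * circ (\<lambda>x. B (pt s x)) \<le> 4 * pi * M * s" if "s \<in> {0..r}" for s
      using mult_left_mono[OF bB[of s], of "2 * s"] that r by (auto simp: algebra_simps)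
    ultimately have "Re (Q r) - Re (Q 0) \<le> 2 * pi * M * r\<^sup>2 - 2 * pi * M * 0\<^sup>2"
      by (rule has_integral_le) auto
    then show ?thesis by (simp add: Q_def)
  qed
  define a where "a s = circ (\<lambda>x. g (pt s x))" for s
  define a' where "a' s = circ (\<lambda>x. Re (p (pt s x) * cis x))" for s
  have a'0: "s * a' s = Re (Q s)" if "s \<in> {0..t}" for s
  proof -
    have c: "continuous_on {0..2*pi} (\<lambda>x. p (pt s x))" using cont_pt(2)[OF _ that] cont_all by auto
    have "a' s = Re (circ (\<lambda>x. p (pt s x) * cis x))"
      unfolding a'_def by (rule integral_unique has_integral_Re integrable_integral int_cont continuous_intros c)+
    then show ?thesis by (simp add: Q_def)
  qed
  have a'1: "a' s \<le> 2 * pi * M * s" if s: "s \<in> {0<..<t}" for s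
  proof -
    have "s * a' s \<le> s * (2 * pi * M * s)" using a'0[of s] Q[of s] s by (auto simp: power2_eq_square algebra_simps)
    then show ?thesis using s by simp
  qed
  have da: "(a has_vector_derivative a' s) (at s within {0..t})" if "s \<in> {0..t}" for s
    unfolding a_def a'_def by (rule deriv_mean_g[OF that])
  have "(a' has_integral a t - a 0) {0..t}"
    by (rule fundamental_theorem_of_calculus) (use t da in auto)
  \<comment> \<open>The bound on \<open>a'\<close> comes from dividing s a'(s) by s, so
    \<open>a'\<close> is replaced at the end points, which leaves the integral unchanged.\<close>
  then have "((\<lambda>s. if s \<in> {0<..<t} then a' s else 2 * pi * M * s) has_integral a t - a 0) {0..t}"
    using has_integral_spike_interior[of a' "a t - a 0" 0 t] by (auto simp: cbox_interval box_real)
  moreover have "((\<lambda>s. 2 * pi * M * s) has_integral pi * M * t\<^sup>2 - pi * M * 0\<^sup>2) {0..t}"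
    by (rule fundamental_theorem_of_calculus)
         (use t in \<open>auto intro!: derivative_eq_intros simp: has_real_derivative_iff_has_vector_derivative[symmetric]\<close>)
  ultimately have "a t - a 0 \<le> pi * M * t\<^sup>2 - pi * M * 0\<^sup>2"
    by (rule has_integral_le) (use a'1 in auto)
  then show ?thesis by (simp add: a_def)
qed

text \<open>As p = g_x - \<i> g_y, the divergence theorem turns the integral of p over a disc into
  this boundary moment of g, where cis (-x) is the conjugate outward normal. The claim is that
  identity differentiated in s.\<close>

lemma deriv_moment:
  assumes s: "s \<in> {0..t}"
  shows "((\<lambda>s. circ (\<lambda>x. of_real s * (of_real (g (pt s x)) * cis (-x)))) has_vector_derivative
     of_real s * circ (\<lambda>x. p (pt s x))) (at s within {0..t})"
proof -
  define L where "L s x = of_real s * (of_real (Re (p (pt s x) * cis x)) * cis (-x))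
      + of_real (g (pt s x)) * cis (-x)" for s x
  have c: "continuous_on {0..2*pi} (\<lambda>x. g (pt s x))"
    "continuous_on {0..2*pi} (\<lambda>x. p (pt s x))"
    using cont_pt(2)[OF _ s] cont_all by auto
  have 1: "((\<lambda>s. circ (\<lambda>x. of_real s * (of_real (g (pt s x)) * cis (-x)))) has_vector_derivative
     circ (L s)) (at s within {0..t})"
  proof (rule leib)
    show "continuous_on ({0..t} \<times> {0..2*pi}) (\<lambda>(s, x). L s x)"
      using cont_pt(1)[OF cont_all(1)] cont_pt(1)[OF cont_all(2)]
      unfolding case_prod_beta L_def by (intro continuous_intros)
    show "((\<lambda>s. of_real s * (of_real (g (pt s x)) * cis (-x))) has_vector_derivative L s x) (at s within {0..t})"
      if "s \<in> {0..t}" for s x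
      using has_vector_derivative_mult[OF has_vector_derivative_of_real[OF DERIV_ident]
         has_vector_derivative_mult[OF has_vector_derivative_of_real[OF g_radial[OF that, folded has_real_derivative_iff_has_vector_derivative]] has_vector_derivative_const]]
      unfolding L_def id_def by simp
  qed (use s in \<open>auto intro!: int_cont continuous_intros cont_pt cont_all\<close>)
  have dc: "((\<lambda>x. cis (-x)) has_vector_derivative - \<i> * cis (-x)) (at x within X)" for x X
    using bounded_linear.has_vector_derivative[OF bounded_linear_cnj deriv_cis, of x X]
    by (simp add: cis_cnj)
  have d: "((\<lambda>x. of_real (g (pt s x)) * cis (-x)) has_vector_derivative
    (of_real (g (pt s x)) * (- \<i> * cis (-x)) + of_real (Re (p (pt s x) * (of_real s * (\<i> * cis x)))) * cis (-x)))
     (at x within X)" for x X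
    by (rule has_vector_derivative_mult has_vector_derivative_of_real g_angular[OF s, folded has_real_derivative_iff_has_vector_derivative] dc)+
  have 2: "circ (\<lambda>x. of_real (g (pt s x)) * (- \<i> * cis (-x)) +
     of_real (Re (p (pt s x) * (of_real s * (\<i> * cis x)))) * cis (-x)) = 0"
    by (rule period_zero[OF d]) (simp flip: cis_cnj)
  have "L s x = - \<i> * (of_real (g (pt s x)) * (- \<i> * cis (-x)) +
     of_real (Re (p (pt s x) * (of_real s * (\<i> * cis x)))) * cis (-x)) * (-1)
     + of_real s * p (pt s x)" for x
  proof -
    define w where "w = p (pt s x) * cis x"
    have r: "complex_of_real (Re (p (pt s x) * (of_real s * (\<i> * cis x)))) = - of_real s * of_real (Im w)"
      unfolding w_def by (simp add: algebra_simps)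
    have "p (pt s x) = w * cis (-x)" by (simp add: w_def cis_mult mult.assoc)
    also have "w = of_real (Re w) + \<i> * of_real (Im w)" by (rule complex_eq)
    finally have pe: "p (pt s x) = (of_real (Re w) + \<i> * of_real (Im w)) * cis (-x)" .
    show ?thesis
      unfolding L_def r w_def[symmetric] unfolding pe by (simp add: algebra_simps)
  qed
  then have "circ (L s) = circ (\<lambda>x. - \<i> * (of_real (g (pt s x)) * (- \<i> * cis (-x)) +
     of_real (Re (p (pt s x) * (of_real s * (\<i> * cis x)))) * cis (-x)) * (-1)
     + of_real s * p (pt s x))" by presburger
  also have "\<dots> = - \<i> * 0 * (-1) + circ (\<lambda>x. of_real s * p (pt s x))"
    by (subst integral_add) (use 2 in \<open>(intro int_cont continuous_intros c | simp)+\<close>)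
  finally show ?thesis using 1 by simp
qed

text \<open>The average of p over the disc is p(z) up to O(M t), and it is also a boundary moment of
  g. As g is nonnegative, this moment is at most t times the circle integral of g, which
  \<open>circle_mean_upper\<close> bounds through g(z). In the constant 5, 4 comes from the
  averaging and 1 from the circle integral.\<close>

lemma gradient_bound:
  assumes M: "\<And>w. w \<in> cball z t \<Longrightarrow> 0 \<le> B w \<and> B w \<le> M"
    and nonneg: "\<And>w. w \<in> cball z t \<Longrightarrow> 0 \<le> g w"
  shows "cmod (p z) \<le> 2 * g z / t + 5 * M * t"
proof -
  have M0: "M \<ge> 0" using M[of z] t by force
  define K where "K s = circ (\<lambda>x. p (pt s x))" for s
  define K' where "K' s = 2 * circ (\<lambda>x. complex_of_real (B (pt s x)) * cis (-x))" for s
  have K0: "K 0 = 2 * pi * p z" by (simp add: K_def scaleR_conv_of_real)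
  have bK': "norm (K' s) \<le> 4 * pi * M" if s: "s \<in> {0..t}" for s
  proof -
    have c: "continuous_on {0..2*pi} (\<lambda>x. B (pt s x))" using cont_pt(2)[OF _ s] cont_all by auto
    have "norm (circ (\<lambda>x. complex_of_real (B (pt s x)) * cis (-x))) \<le> circ (\<lambda>_. M)"
    proof (rule integral_norm_bound_integral)
      fix x show "norm (complex_of_real (B (pt s x)) * cis (-x)) \<le> M"
        using M[of "pt s x"] circle_in_cball[of s t z x] s by (auto simp: norm_mult)
    qed (auto intro!: int_cont continuous_intros c)
    then show ?thesis by (simp add: K'_def norm_mult mult_ac)
  qed
  have dK: "norm (K s - K 0) \<le> 4 * pi * M * s" if s: "s \<in> {0..t}" for s
  proof -
    have "(K' has_integral K s - K 0) {0..s}"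
    proof (rule fundamental_theorem_of_calculus)
      fix x assume "x \<in> {0..s}"
      then have "(K has_vector_derivative K' x) (at x within {0..t})"
        unfolding K_def K'_def using s by (intro deriv_mean_p) auto
      then show "(K has_vector_derivative K' x) (at x within {0..s})"
        using s by (auto intro: has_vector_derivative_within_subset)
    qed (use s in auto)
    from has_integral_bound[of "4 * pi * M" K' _ 0 s, unfolded cbox_interval, OF _ this]
    show ?thesis using s M0 bK' by auto
  qed
  define N where "N s = circ (\<lambda>x. complex_of_real s * (of_real (g (pt s x)) * cis (-x)))" for s
  define F where "F s = N s - (pi * s\<^sup>2) *\<^sub>R p z" for s
  have "((\<lambda>s. of_real s * (K s - K 0)) has_integral F t - F 0) {0..t}"
  proof (rule fundamental_theorem_of_calculus)
    fix s assume s: "s \<in> {0..t}"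
    have "(N has_vector_derivative of_real s * K s) (at s within {0..t})"
      unfolding N_def K_def by (rule deriv_moment[OF s])
    moreover have "((\<lambda>s. (pi * s\<^sup>2) *\<^sub>R p z) has_vector_derivative (2 * pi * s) *\<^sub>R p z) (at s within {0..t})"
      by (auto intro!: derivative_eq_intros)
    ultimately have "(F has_vector_derivative of_real s * K s - (2 * pi * s) *\<^sub>R p z) (at s within {0..t})"
      unfolding F_def by (rule has_vector_derivative_diff)
    then show "(F has_vector_derivative of_real s * (K s - K 0)) (at s within {0..t})"
      by (simp add: K0 scaleR_conv_of_real algebra_simps)
  qed (use t in auto)
  moreover have "norm (of_real s * (K s - K 0)) \<le> 4 * pi * M * t\<^sup>2" if s: "s \<in> {0..t}" for s
  proof -
    have "norm (of_real s * (K s - K 0)) \<le> s * (4 * pi * M * s)"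
      using s mult_left_mono[OF dK[OF s], of s] by (simp add: norm_mult)
    also have "\<dots> = 4 * pi * M * s\<^sup>2" by (simp add: power2_eq_square)
    also have "\<dots> \<le> 4 * pi * M * t\<^sup>2" using s M0 by (intro mult_left_mono power_mono) auto
    finally show ?thesis .
  qed
  ultimately have "norm (F t - F 0) \<le> 4 * pi * M * t\<^sup>2 * t"
    using has_integral_bound[of "4 * pi * M * t\<^sup>2" "\<lambda>s. of_real s * (K s - K 0)" "F t - F 0" 0 t] t M0
    by (simp add: cbox_interval)
  then have 1: "norm ((pi * t\<^sup>2) *\<^sub>R p z) \<le> norm (N t) + 4 * pi * M * t\<^sup>2 * t"
    unfolding F_def N_def using norm_triangle_ineq2[of "(pi * t\<^sup>2) *\<^sub>R p z" "N t"]
    by (simp add: norm_minus_commute N_def)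
  have tt: "t \<in> {0..t}" using t by simp
  have "norm (N t) \<le> circ (\<lambda>x. t * g (pt t x))"
    unfolding N_def
  proof (rule integral_norm_bound_integral)
    fix x show "norm (of_real t * (complex_of_real (g (pt t x)) * cis (-x))) \<le> t * g (pt t x)"
      using t nonneg[of "pt t x"] circle_in_cball[of t t z x] by (auto simp: norm_mult)
  qed (use tt in \<open>auto intro!: int_cont continuous_intros cont_pt cont_all\<close>)
  also have "\<dots> = t * circ (\<lambda>x. g (pt t x))" by simp
  also have "\<dots> \<le> t * (2 * pi * g z + pi * M * t\<^sup>2)"
    using t M by (intro mult_left_mono circle_mean_upper) auto
  finally have "pi * t\<^sup>2 * cmod (p z) \<le> t * (2 * pi * g z + pi * M * t\<^sup>2) + 4 * pi * M * t\<^sup>2 * t"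
    using 1 by (simp add: abs_mult)
  also have "\<dots> = pi * t\<^sup>2 * (2 * g z / t + 5 * M * t)"
    using t by (simp add: field_simps power2_eq_square)
  finally show ?thesis using t by (simp add: mult_le_cancel_left)
qed

end

section \<open>Green's formula with a test function\<close>

text \<open>The integral is invariant under translations by \<open>v\<close>; differentiating in the length of the translation gives the claim.\<close>

lemma integral_wirtinger_compact_support:
  fixes P A B :: "complex \<Rightarrow> complex"
  assumes d: "\<And>z. (P has_derivative (\<lambda>h. A z * h + B z * cnj h)) (at z)"
    and cA: "continuous_on UNIV A" and cB: "continuous_on UNIV B"
    and supp: "\<And>z. z \<notin> cball 0 K \<Longrightarrow> P z = 0" and K: "K \<ge> 0"
  shows "integral (cbox (Complex (-K-1) (-K-1)) (Complex (K+1) (K+1))) B = 0"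
proof -
  \<comment> \<open>The margin 1 keeps all translates of the support by vectors of length at most 1
    inside the box.\<close>
  let ?a = "Complex (-K-1) (-K-1)" and ?b = "Complex (K+1) (K+1)"
  let ?Q = "cbox ?a ?b" and ?R = "cbox (Complex (-K) (-K)) (Complex K K)"
  have cP: "continuous_on X P" for X
    using d has_derivative_continuous continuous_at_imp_continuous_on by blast
  have out: "P z = 0" if "z \<notin> ?R" for z
  proof (rule supp)
    show "z \<notin> cball 0 K"
    proof
      assume "z \<in> cball 0 K"
      then have "\<bar>Re z\<bar> \<le> K" "\<bar>Im z\<bar> \<le> K"
        using abs_Re_le_cmod[of z] abs_Im_le_cmod[of z] by auto
      then show False using that by (auto simp: in_cbox_complex_iff)
    qed
  qed
  have main: "integral ?Q (\<lambda>z. A z * v + B z * cnj v) = 0" if v: "cmod v \<le> 1" for v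
  proof -
    have "integral ?Q (\<lambda>z. P (z + of_real x * v)) = integral ?R P" if x: "x \<in> {0..1}" for x
    proof -
      let ?w = "of_real x * v"
      have "cmod ?w \<le> 1" using x v by (simp add: norm_mult mult_le_one)
      then have w: "\<bar>Re ?w\<bar> \<le> 1" "\<bar>Im ?w\<bar> \<le> 1"
        using abs_Re_le_cmod[of ?w] abs_Im_le_cmod[of ?w] by linarith+
      have "(P has_integral integral ?R P) ?R"
        by (intro integrable_integral integrable_continuous cP)
      then have "(P has_integral integral ?R P) (cbox (?a + ?w) (?b + ?w))"
        by (rule has_integral_on_superset) (use out w in \<open>auto simp: in_cbox_complex_iff\<close>)
      then have "((P \<circ> ((+) ?w)) has_integral integral ?R P) ?Q"
        by (rule has_integral_shift_cbox_iff[THEN iffD2])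
      then show ?thesis by (simp add: o_def add.commute integral_unique)
    qed
    then have const: "((\<lambda>x. integral ?Q (\<lambda>z. P (z + of_real x * v))) has_vector_derivative 0) (at 0 within {0..1})"
      by (rule has_vector_derivative_transform[of 0 "{0..1}" _ "\<lambda>_. integral ?R P", rotated]) auto
    have "((\<lambda>x. integral ?Q (\<lambda>z. P (z + of_real x * v))) has_vector_derivative
        integral ?Q (\<lambda>z. A (z + of_real 0 * v) * v + B (z + of_real 0 * v) * cnj v)) (at 0 within {0..1})"
    proof (rule leibniz_rule_vector_derivative)
      fix x z
      have "((\<lambda>x. z + of_real x * v) has_derivative (\<lambda>h. of_real h * v)) (at x within {0..1})"
        by (rule derivative_eq_intros refl | simp)+
      from has_derivative_compose[OF this d]
      show "((\<lambda>x. P (z + of_real x * v)) has_vector_derivative A (z + of_real x * v) * v + B (z + of_real x * v) * cnj v)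
         (at x within {0..1})"
        by (simp add: has_vector_derivative_def scaleR_conv_of_real algebra_simps)
      show "continuous_on ({0..1} \<times> ?Q) (\<lambda>(x, z). A (z + of_real x * v) * v + B (z + of_real x * v) * cnj v)"
        unfolding case_prod_beta
        by (intro continuous_intros continuous_on_compose2[OF cA] continuous_on_compose2[OF cB]) auto
      show "(\<lambda>z. P (z + of_real x * v)) integrable_on ?Q"
        by (intro integrable_continuous continuous_on_compose2[OF cP] continuous_intros) auto
    qed auto
    from vector_derivative_unique_within[OF _ this const] show ?thesis
      by (simp add: trivial_limit_within islimpt_Icc)
  qed
  have iA: "A integrable_on ?Q" "B integrable_on ?Q"
    using cA cB by (auto intro!: integrable_continuous intro: continuous_on_subset)
  \<comment> \<open>The directions 1 and \<i> give that the sum and the difference of the two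
    integrals vanish.\<close>
  have "integral ?Q A + integral ?Q B = 0"
    using main[of 1] iA by (simp add: integral_add)
  moreover have "integral ?Q A - integral ?Q B = 0"
    using main[of \<i>] iA by (simp add: integral_diff)
  ultimately show ?thesis by (simp add: algebra_simps)
qed

text \<open>The conjugate Wirtinger derivative of f p - g q is f B - g D plus a purely imaginary
  term. It integrates to 0, and the real part is the claim. Although g is controlled on S alone, f p
  - g q is continuously differentiable on the plane, since f and q vanish outside the ball.\<close>

lemma wirtinger_C2_green:
  assumes g: "wirtinger_C2 S g p A B" and f: "wirtinger_C2 UNIV f q C D"
    and K: "K \<ge> 0" "cball 0 K \<subseteq> S" and supp: "\<And>z. z \<notin> cball 0 K \<Longrightarrow> f z = 0 \<and> q z = 0 \<and> D z = 0"
  shows "integral (cball 0 K) (\<lambda>z. f z * B z) = integral (cball 0 K) (\<lambda>z. g z * D z)"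
proof -
  note G = wirtinger_C2_D[OF g] and F = wirtinger_C2_D[OF f]
  let ?out = "- cball (0::complex) K"
  have oo: "open ?out" by auto
  have un: "UNIV = S \<union> ?out" using K by auto
  define P where "P z = of_real (f z) * p z - of_real (g z) * q z" for z
  define PA where "PA z = (if z \<in> ?out then 0 else of_real (f z) * A z - of_real (g z) * C z)" for z
  define PB where "PB z = of_real (f z * B z - g z * D z) + (cnj (q z) * p z - cnj (p z) * q z) / 2" for z
  have PB0: "PB z = 0" "P z = 0" if "z \<in> ?out" for z
    using supp[of z] that by (auto simp: PB_def P_def)
  have C0: "C z = 0" if "z \<in> ?out" for z
  proof -
    have "(q has_derivative (\<lambda>h. 0)) (at z)"
      by (rule has_derivative_transform_within_open[OF _ oo that, of "\<lambda>_. 0"]) (use supp in auto)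
    from has_derivative_unique[OF this F(5)] have "(0::complex) = C z * 1 + of_real (D z) * cnj 1"
      by (metis UNIV_I)
    then show ?thesis using supp[of z] that by auto
  qed
  have e: "complex_of_real (Re w) = (w + cnj w) / 2" for w using complex_add_cnj[of w] by simp
  have dP: "(P has_derivative (\<lambda>h. PA z * h + PB z * cnj h)) (at z)" for z
  proof (cases "z \<in> ?out")
    case True
    have "(P has_derivative (\<lambda>h. 0)) (at z)"
      by (rule has_derivative_transform_within_open[OF _ oo True, of "\<lambda>_. 0"]) (use PB0 in auto)
    then show ?thesis using PB0[OF True] True by (simp add: PA_def)
  next
    case False
    then have z: "z \<in> S" using un by auto
    have "(P has_derivative (\<lambda>h. (of_real (f z) * (A z * h + of_real (B z) * cnj h) + of_real (Re (q z * h)) * p z)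
       - (of_real (g z) * (C z * h + of_real (D z) * cnj h) + of_real (Re (p z * h)) * q z))) (at z)"
      unfolding P_def
      by (intro has_derivative_diff has_derivative_mult has_derivative_of_real G z F UNIV_I)
    moreover have "(of_real (f z) * (A z * h + of_real (B z) * cnj h) + of_real (Re (q z * h)) * p z)
       - (of_real (g z) * (C z * h + of_real (D z) * cnj h) + of_real (Re (p z * h)) * q z) = PA z * h + PB z * cnj h" for h
      unfolding PA_def PB_def e of_real_diff of_real_mult using False by (simp add: field_simps)
    ultimately show ?thesis by (simp only:)
  qed
  have cf: "continuous_on S f" "continuous_on S q" "continuous_on S C" "continuous_on S D"
    using F by (auto intro: continuous_on_subset)
  have "continuous_on S (\<lambda>z. of_real (f z) * A z - of_real (g z) * C z)" "continuous_on S PB"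
    unfolding PB_def by (intro continuous_intros cf G; simp)+
  moreover have "PA z = of_real (f z) * A z - of_real (g z) * C z" for z
    using supp[of z] C0[of z] by (auto simp: PA_def)
  then have "PA = (\<lambda>z. of_real (f z) * A z - of_real (g z) * C z)" by blast
  moreover have "continuous_on ?out PA" "continuous_on ?out PB"
    using PB0 by (auto simp: PA_def cong: continuous_on_cong_simp)
  ultimately have cont: "continuous_on UNIV PA" "continuous_on UNIV PB"
    unfolding un using continuous_on_open_Un[OF G(1) oo] by auto
  let ?Q = "cbox (Complex (-K-1) (-K-1)) (Complex (K+1) (K+1))"
  have sub: "cball 0 K \<subseteq> ?Q"
  proof
    fix z :: complex assume "z \<in> cball 0 K"
    then have "\<bar>Re z\<bar> \<le> K" "\<bar>Im z\<bar> \<le> K"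
      using abs_Re_le_cmod[of z] abs_Im_le_cmod[of z] by auto
    then show "z \<in> ?Q" by (auto simp: in_cbox_complex_iff)
  qed
  have iPB: "PB integrable_on cball 0 K"
    using set_borel_integral_eq_integral(1)[of "cball 0 K" PB] borel_integrable_compact[of "cball 0 K" PB]
      continuous_on_subset[OF cont(2)] by (auto simp: set_integrable_def)
  have "integral ?Q PB = 0"
    by (rule integral_wirtinger_compact_support[OF dP cont _ K(1)]) (use PB0 in auto)
  moreover have "integral ?Q PB = integral (cball 0 K) PB"
    using PB0 by (intro integral_unique has_integral_on_superset[OF integrable_integral[OF iPB] _ sub]) auto
  ultimately have "integral (cball 0 K) PB = 0" by simp
  moreover note iPB
  ultimately have "integral (cball 0 K) (\<lambda>z. Re (PB z)) = 0"
    using has_integral_Re[of PB] by (metis integrable_integral integral_unique zero_complex.sel(1))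
  moreover have "Re (PB z) = f z * B z - g z * D z" for z by (simp add: PB_def)
  ultimately have "integral (cball 0 K) (\<lambda>z. f z * B z - g z * D z) = 0" by simp
  moreover have int: "h integrable_on cball 0 K" if "continuous_on S h" for h :: "complex \<Rightarrow> real"
    using set_borel_integral_eq_integral(1)[of "cball 0 K" h] borel_integrable_compact[of "cball 0 K" h]
      continuous_on_subset[OF that K(2)] by (auto simp: set_integrable_def)
  have "(\<lambda>z. f z * B z) integrable_on cball 0 K" "(\<lambda>z. g z * D z) integrable_on cball 0 K"
    by (intro int continuous_intros G cf)+
  ultimately show ?thesis by (simp add: integral_diff)
qed

section \<open>The compactly supported test function\<close>

lemma has_real_derivative_max_0_power:
  "((\<lambda>x::real. max 0 x ^ (n + 2)) has_real_derivative real (n + 2) * max 0 x ^ (n + 1)) (at x)"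
proof -
  consider "x > 0" | "x < 0" | "x = 0" by linarith
  then show ?thesis
  proof cases
    case 1
    have "((\<lambda>x::real. x ^ (n + 2)) has_real_derivative real (n + 2) * max 0 x ^ (n + 1)) (at x)"
      using 1 DERIV_pow[of "n + 2" x] by simp
    then show ?thesis
      by (rule has_field_derivative_transform_within_open[of _ _ _ "{0<..}"]) (use 1 in auto)
  next
    case 2
    have "((\<lambda>x::real. 0) has_real_derivative real (n + 2) * max 0 x ^ (n + 1)) (at x)"
      using 2 by (auto intro!: derivative_eq_intros)
    then show ?thesis
      by (rule has_field_derivative_transform_within_open[of _ _ _ "{..<0}"]) (use 2 in auto)
  next
    case 3
    have "((\<lambda>h::real. max 0 h ^ (n + 2) / h) \<longlongrightarrow> 0) (at 0)"
    proof (rule Lim_null_comparison)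
      show "\<forall>\<^sub>F h::real in at 0. norm (max 0 h ^ (n + 2) / h) \<le> \<bar>h\<bar>"
        unfolding eventually_at
      proof (intro exI[of _ 1] conjI ballI impI)
        fix h :: real assume h: "h \<noteq> 0 \<and> dist h 0 < 1"
        show "norm (max 0 h ^ (n + 2) / h) \<le> \<bar>h\<bar>"
          using h mult_right_le_one_le[of h "h ^ n"] power_le_one[of h n] by (auto simp: max_def)
      qed simp
      show "((\<lambda>h::real. \<bar>h\<bar>) \<longlongrightarrow> 0) (at 0)" by (rule tendsto_eq_intros refl | simp)+
    qed
    then show ?thesis using 3 by (simp add: DERIV_def)
  qed
qed

text \<open>The cube is the lowest integer power of the positive part that is twice continuously
  differentiable. The constant 2 makes the function at least 1 on the unit disc, with support in |z|
  \<le> sqrt 2 < 3/2.\<close>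

definition bump :: "complex \<Rightarrow> real" where
  "bump z = max 0 (2 - (cmod z)\<^sup>2) ^ 3"

lemma bump_props:
  "0 \<le> bump z" "bump z \<le> 8" "z \<in> cball 0 1 \<Longrightarrow> 1 \<le> bump z" "z \<notin> cball 0 (3/2) \<Longrightarrow> bump z = 0"
  "continuous_on X bump"
proof -
  show "0 \<le> bump z" by (simp add: bump_def)
  have "bump z \<le> 2 ^ 3" unfolding bump_def by (intro power_mono) auto
  then show "bump z \<le> 8" by simp
  show "1 \<le> bump z" if "z \<in> cball 0 1"
    unfolding bump_def using that power_le_one[of "cmod z" 2] by (intro one_le_power) auto
  show "bump z = 0" if "z \<notin> cball 0 (3/2)"
  proof -
    have "(3/2)\<^sup>2 \<le> (cmod z)\<^sup>2" using that by (intro power_mono) auto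
    then show ?thesis by (simp add: bump_def power2_eq_square)
  qed
  show "continuous_on X bump" unfolding bump_def by (intro continuous_intros)
qed

lemma wirtinger_C2_bump:
  "\<exists>q C D. wirtinger_C2 UNIV bump q C D \<and> (\<forall>z. \<bar>D z\<bar> \<le> 72) \<and>
     (\<forall>z. z \<notin> cball 0 (3/2) \<longrightarrow> q z = 0 \<and> D z = 0)"
proof -
  have "wirtinger_C2 UNIV (\<lambda>z. 2 - (cmod z)\<^sup>2) (\<lambda>z. - 2 * cnj z) (\<lambda>_. 0) (\<lambda>_. - 2)"
    unfolding wirtinger_C2_def dot_square_norm[symmetric]
    by (intro conjI ballI continuous_intros; (rule derivative_eq_intros refl)?)
       (auto simp: fun_eq_iff inner_complex_def algebra_simps intro!: derivative_eq_intros)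
  moreover have "((\<lambda>x. max 0 x ^ 3) has_real_derivative 3 * max 0 x ^ 2) (at x)"
       "((\<lambda>x. 3 * max 0 x ^ 2) has_real_derivative 6 * max 0 x) (at x)" for x :: real
    using has_real_derivative_max_0_power[of 1 x]
      DERIV_cmult[OF has_real_derivative_max_0_power[of 0 x], of 3] by (simp_all add: numeral_3_eq_3 numeral_2_eq_2)
  ultimately have "wirtinger_C2 UNIV bump (\<lambda>z. of_real (3 * max 0 (2 - (cmod z)\<^sup>2) ^ 2) * (- 2 * cnj z))
    (\<lambda>z. of_real (3 * max 0 (2 - (cmod z)\<^sup>2) ^ 2) * 0 + of_real (6 * max 0 (2 - (cmod z)\<^sup>2)) * (- 2 * cnj z)\<^sup>2 / 2)
    (\<lambda>z. (3 * max 0 (2 - (cmod z)\<^sup>2) ^ 2) * (- 2) + (6 * max 0 (2 - (cmod z)\<^sup>2)) * (cmod (- 2 * cnj z))\<^sup>2 / 2)"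
    (is "wirtinger_C2 UNIV bump ?q ?C ?D")
    unfolding bump_def[abs_def] by (intro wirtinger_C2_compose) (auto intro!: continuous_intros)
  moreover have "\<bar>?D z\<bar> \<le> 72" for z
  proof (cases "(cmod z)\<^sup>2 \<le> 2")
    case True
    define x where "x = (cmod z)\<^sup>2"
    have x: "0 \<le> x" "x \<le> 2" using True by (auto simp: x_def)
    have "?D z = - 6 * (2 - x)\<^sup>2 + 12 * ((2 - x) * x)"
      using x by (simp add: norm_mult power_mult_distrib x_def)
    moreover have "(2 - x)\<^sup>2 \<le> 4" using x power_mono[of "2 - x" 2 2] by simp
    moreover have "0 \<le> (2 - x) * x" "(2 - x) * x \<le> 4" using x mult_mono[of "2 - x" 2 x 2] by auto
    \<comment> \<open>Crudely, 72 = 6 * 4 + 12 * 4, for u = (2 - x)^2 and v = (2 - x) x.\<close>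
    moreover have "\<bar>- 6 * u + 12 * v\<bar> \<le> 72" if "u \<le> 4" "0 \<le> u" "0 \<le> v" "v \<le> 4" for u v :: real
      using that by simp
    ultimately show ?thesis by (simp only: zero_le_power2)
  qed auto
  moreover have "?q z = 0 \<and> ?D z = 0" if "z \<notin> cball 0 (3/2)" for z
    using bump_props(4)[OF that] by (auto simp: bump_def max_def split: if_splits)
  ultimately show ?thesis by blast
qed

text \<open>
  For small \<open>e > 0\<close> the function \<open>e * logcut\<close> is uniformly \<open>O(e)\<close> and its second derivative is \<open>O(e / y)\<close>, yet its
  derivative exceeds \<open>1\<close> near \<open>0\<close>.
\<close>

definition logcut :: "real \<Rightarrow> real" where
  "logcut y = y * ln (1 + 1 / y\<^sup>2) + 2 * arctan y"

text \<open>\<open>logcut\<close> is an antiderivative of ln (1 + 1 / y^2), and integration by parts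
  produces the arctan term. This derivative is integrable on the half-line, so \<open>logcut\<close>
  is bounded although its slope tends to infinity at 0.\<close>

lemma logcut_deriv:
  assumes "y > 0"
  shows "(logcut has_real_derivative ln (1 + 1 / y\<^sup>2)) (at y)"
    "((\<lambda>y. ln (1 + 1 / y\<^sup>2)) has_real_derivative - 2 / (y * (y\<^sup>2 + 1))) (at y)"
proof -
  have p: "1 + 1 / y\<^sup>2 > 0" using assms by (simp add: add_pos_pos)
  have n: "y\<^sup>2 + 1 > 0" "y\<^sup>2 > 0" using assms by (auto simp: add_nonneg_pos)
  have "((\<lambda>y. 1 + 1 / y\<^sup>2) has_real_derivative - 2 / y ^ 3) (at y)"
    using assms by (auto intro!: derivative_eq_intros simp: field_simps power2_eq_square power3_eq_cube)
  from DERIV_chain2[OF DERIV_ln[OF p] this]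
  have "((\<lambda>y. ln (1 + 1 / y\<^sup>2)) has_real_derivative inverse (1 + 1 / y\<^sup>2) * (- 2 / y ^ 3)) (at y)" .
  also have "inverse (1 + 1 / y\<^sup>2) * (- 2 / y ^ 3) = - 2 / (y * (y\<^sup>2 + 1))"
  proof -
    have "1 + 1 / y\<^sup>2 = (y\<^sup>2 + 1) / y\<^sup>2" using assms by (simp add: add_divide_distrib)
    then have "inverse (1 + 1 / y\<^sup>2) * (- 2 / y ^ 3) = (y\<^sup>2 / (y\<^sup>2 + 1)) * (- 2 / (y * y\<^sup>2))"
      by (simp add: power2_eq_square power3_eq_cube)
    then show ?thesis using n by simp
  qed
  finally show d: "((\<lambda>y. ln (1 + 1 / y\<^sup>2)) has_real_derivative - 2 / (y * (y\<^sup>2 + 1))) (at y)" .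
  have "(logcut has_real_derivative (1 * ln (1 + 1 / y\<^sup>2) + (- 2 / (y * (y\<^sup>2 + 1))) * y) + 2 * inverse (1 + y\<^sup>2)) (at y)"
    unfolding logcut_def[abs_def]
    by (intro DERIV_add DERIV_mult DERIV_ident d DERIV_cmult DERIV_arctan)
  moreover have "(- 2 / (y * (y\<^sup>2 + 1))) * y = - (2 * inverse (1 + y\<^sup>2))"
    using assms by (simp add: divide_inverse add.commute)
  ultimately show "(logcut has_real_derivative ln (1 + 1 / y\<^sup>2)) (at y)" by simp
qed

lemma logcut_bound:
  assumes "y > 0" shows "\<bar>logcut y\<bar> \<le> 2 + pi"
proof -
  have "ln (1 + 1 / y\<^sup>2) \<le> ln ((1 + 1 / y)\<^sup>2)"
    using assms by (intro ln_mono) (auto simp: power2_sum power_divide add_pos_pos)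
  also have "\<dots> = 2 * ln (1 + 1 / y)" using assms by (simp add: ln_realpow add_pos_pos)
  also have "\<dots> \<le> 2 * (1 / y)" using assms by (intro mult_left_mono ln_add_one_self_le_self) auto
  finally have "y * ln (1 + 1 / y\<^sup>2) \<le> y * (2 * (1 / y))" using assms by (intro mult_left_mono) auto
  then have "y * ln (1 + 1 / y\<^sup>2) \<le> 2" using assms by simp
  moreover have "0 \<le> y * ln (1 + 1 / y\<^sup>2)" using assms by auto
  moreover have "0 \<le> arctan y" "arctan y < pi / 2" using assms arctan_ubound by auto
  ultimately show ?thesis unfolding logcut_def by linarith
qed

lemma set_integrable_continuous_compact:
  fixes f :: "'a::euclidean_space \<Rightarrow> 'b::{banach, second_countable_topology}"
  shows "compact K \<Longrightarrow> continuous_on K f \<Longrightarrow> set_integrable lborel K f"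
  unfolding set_integrable_def by (rule borel_integrable_compact)

lemma set_integral_const_cball:
  "(LINT z:cball a r|lborel. c) = c * measure lborel (cball (a::complex) r)" for c :: real
  by (simp add: set_lebesgue_integral_def)

text \<open>
  The gradient estimate \<open>|p|^2 = O(Y + Y^2)\<close> makes \<open>logcut Y\<close>
  nearly subharmonic, with \<open>B\<close>-part at least \<open>ln (1 + 1 / Y^2) * B - O(1)\<close>.
\<close>

lemma mass_near_zeros:
  assumes Y: "wirtinger_C2 (ball 0 (5/2)) Y p A B"
    and B: "\<And>z. z \<in> ball 0 (5/2) \<Longrightarrow> 0 \<le> B z \<and> B z \<le> M"
    and pos: "\<And>z. z \<in> ball 0 (5/2) \<Longrightarrow> 0 < Y z"
  shows "set_integrable lborel (cball 0 (3/2)) (\<lambda>z. bump z * (ln (1 + 1 / (Y z)\<^sup>2) * B z))" (is ?int)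
    and "(LINT z:cball 0 (3/2)|lborel. bump z * (ln (1 + 1 / (Y z)\<^sup>2) * B z)) \<le>
      (72 * (2 + pi) + 16 * (4 + 3 * M)\<^sup>2) * measure lborel (cball (0::complex) (3/2))" (is "?L \<le> _")
proof -
  let ?K = "cball (0::complex) (3/2)" and ?S = "ball (0::complex) (5/2)"
  have M0: "M \<ge> 0" using B[of 0] by force
  have KS: "?K \<subseteq> ?S" by auto
  define E where "E z = ln (1 + 1 / (Y z)\<^sup>2) * B z + (- 2 / (Y z * ((Y z)\<^sup>2 + 1))) * (cmod (p z))\<^sup>2 / 2" for z
  note G = wirtinger_C2_D[OF Y]
  have cY: "continuous_on ?S (\<lambda>z. - 2 / (Y z * ((Y z)\<^sup>2 + 1)))"
    by (intro continuous_intros G) (metis add_nonneg_pos less_irrefl mult_eq_0_iff pos zero_le_power2 zero_less_one)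
  obtain A' p' where W: "wirtinger_C2 ?S (\<lambda>z. logcut (Y z)) p' A' E"
    using wirtinger_C2_compose[OF Y, of logcut "\<lambda>y. ln (1 + 1 / y\<^sup>2)" "\<lambda>y. - 2 / (y * (y\<^sup>2 + 1))"]
      logcut_deriv pos cY unfolding E_def by blast
  note H = wirtinger_C2_D[OF W]
  obtain q C D where bump: "wirtinger_C2 UNIV bump q C D" and D: "\<And>z. \<bar>D z\<bar> \<le> 72"
    and supp: "\<And>z. z \<notin> ?K \<Longrightarrow> q z = 0 \<and> D z = 0"
    using wirtinger_C2_bump by blast
  have p: "(cmod (p z))\<^sup>2 \<le> (4 + 3 * M)\<^sup>2 * (Y z + (Y z)\<^sup>2)" if z: "z \<in> ?K" for z
  proof -
    have Yz: "Y z > 0" using pos KS z by auto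
    have grad: "cmod (p z) \<le> 2 * Y z / t + 5 * M * t" if t: "0 < t" "t \<le> 1/2" for t
    proof (rule gradient_bound[OF Y t(1)])
      show "cball z t \<subseteq> ?S"
      proof
        fix w assume "w \<in> cball z t"
        then show "w \<in> ?S" using z t norm_triangle_sub[of w z] by (simp add: dist_norm norm_minus_commute)
      qed
      then show "0 \<le> B w \<and> B w \<le> M" "0 \<le> Y w" if "w \<in> cball z t" for w
        using B[of w] pos[of w] that by auto
    qed
    show ?thesis
    \<comment> \<open>Balancing Y / t against M t suggests a radius proportional to sqrt (Y z); for
      Y z > 1 the largest admissible radius 1/2 is taken.\<close>
    proof (cases "Y z \<le> 1")
      case True
      have "cmod (p z) \<le> 2 * Y z / (sqrt (Y z) / 2) + 5 * M * (sqrt (Y z) / 2)"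
        using True Yz by (intro grad) auto
      also have "2 * Y z / (sqrt (Y z) / 2) = 4 * sqrt (Y z)"
        using Yz by (simp add: field_simps flip: real_sqrt_mult)
      also have "4 * sqrt (Y z) + 5 * M * (sqrt (Y z) / 2) \<le> (4 + 3 * M) * sqrt (Y z)"
        using Yz M0 by (simp add: algebra_simps)
      finally have "(cmod (p z))\<^sup>2 \<le> ((4 + 3 * M) * sqrt (Y z))\<^sup>2" by (intro power_mono) auto
      also have "\<dots> = (4 + 3 * M)\<^sup>2 * Y z" using Yz by (simp add: power_mult_distrib)
      also have "\<dots> \<le> (4 + 3 * M)\<^sup>2 * (Y z + (Y z)\<^sup>2)" by (intro mult_left_mono) auto
      finally show ?thesis .
    next
      case False
      have "cmod (p z) \<le> 2 * Y z / (1/2) + 5 * M * (1/2)" by (intro grad) auto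
      also have "\<dots> \<le> 4 * Y z + 3 * M * 1" using M0 by simp
      also have "\<dots> \<le> 4 * Y z + 3 * M * Y z" using M0 False by (intro add_mono mult_left_mono) auto
      finally have "(cmod (p z))\<^sup>2 \<le> ((4 + 3 * M) * Y z)\<^sup>2" by (intro power_mono) (auto simp: algebra_simps)
      also have "\<dots> = (4 + 3 * M)\<^sup>2 * (Y z)\<^sup>2" by (simp add: power_mult_distrib)
      also have "\<dots> \<le> (4 + 3 * M)\<^sup>2 * (Y z + (Y z)\<^sup>2)" using Yz by (intro mult_left_mono) auto
      finally show ?thesis .
    qed
  qed
  have lower: "ln (1 + 1 / (Y z)\<^sup>2) * B z \<le> E z + 2 * (4 + 3 * M)\<^sup>2" if z: "z \<in> ?K" for z
  proof -
    define y where "y = Y z"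
    have y: "y > 0" using pos KS z by (auto simp: y_def)
    have y1: "y * (y\<^sup>2 + 1) > 0" using y by (simp add: add_nonneg_pos)
    \<comment> \<open>The gradient bound cancels the singularity 1 / y of the second derivative of
      \<open>logcut\<close>: what remains is (1 + y) / (y^2 + 1), which is at most 2.\<close>
    have "(cmod (p z))\<^sup>2 / (y * (y\<^sup>2 + 1)) \<le> (4 + 3 * M)\<^sup>2 * (y + y\<^sup>2) / (y * (y\<^sup>2 + 1))"
      using p[OF z] y1 by (intro divide_right_mono) (auto simp: y_def)
    also have "y + y\<^sup>2 = y * (1 + y)" by (simp add: power2_eq_square algebra_simps)
    also have "(4 + 3 * M)\<^sup>2 * (y * (1 + y)) / (y * (y\<^sup>2 + 1)) = (4 + 3 * M)\<^sup>2 * ((1 + y) / (y\<^sup>2 + 1))"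
      using y by simp
    also have "\<dots> \<le> (4 + 3 * M)\<^sup>2 * 2"
    proof (intro mult_left_mono)
      have "0 \<le> (y - 1)\<^sup>2" "0 \<le> y\<^sup>2" by auto
      then have "1 + y \<le> 2 * (y\<^sup>2 + 1)" unfolding power2_diff one_power2 mult_1_right distrib_left by linarith
      then show "(1 + y) / (y\<^sup>2 + 1) \<le> 2" by (simp add: divide_le_eq add_nonneg_pos)
    qed auto
    finally have "(cmod (p z))\<^sup>2 / (y * (y\<^sup>2 + 1)) \<le> (4 + 3 * M)\<^sup>2 * 2" .
    moreover have "- 2 / (y * (y\<^sup>2 + 1)) * (cmod (p z))\<^sup>2 / 2 = - ((cmod (p z))\<^sup>2 / (y * (y\<^sup>2 + 1)))" by simp
    ultimately show ?thesis unfolding E_def y_def by linarith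
  qed
  have c: "continuous_on ?K B" "continuous_on ?K Y" "continuous_on ?K E" "continuous_on ?K bump"
    "continuous_on ?K D" "continuous_on ?K (\<lambda>z. logcut (Y z))"
    using continuous_on_subset[OF G(3) KS] continuous_on_subset[OF G(6) KS]
      continuous_on_subset[OF H(3) KS] continuous_on_subset[OF H(6) KS]
      continuous_on_subset[OF wirtinger_C2_D(3)[OF bump]] bump_props(5) by auto
  have nz: "Y z \<noteq> 0" "1 + 1 / (Y z)\<^sup>2 \<noteq> 0" if "z \<in> ?K" for z
  proof -
    have "Y z > 0" using pos KS that by auto
    then show "Y z \<noteq> 0" "1 + 1 / (Y z)\<^sup>2 \<noteq> 0"
      by (auto simp: add_pos_pos intro!: less_imp_neq[THEN not_sym])
  qed
  show ?int
    by (intro set_integrable_continuous_compact continuous_intros c) (use nz in auto)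
  let ?c = "2 * (4 + 3 * M)\<^sup>2"
  have I: "set_integrable lborel ?K (\<lambda>z. bump z * E z)" "set_integrable lborel ?K (\<lambda>z. 8 * ?c)"
    "set_integrable lborel ?K (\<lambda>z. logcut (Y z) * D z)" "set_integrable lborel ?K (\<lambda>z. 72 * (2 + pi))"
    by (intro set_integrable_continuous_compact continuous_intros c; simp)+
  have "?L \<le> (LINT z:?K|lborel. bump z * E z + 8 * ?c)"
  proof (rule set_integral_mono[OF \<open>?int\<close> set_integral_add(1)[OF I(1,2)]])
    fix z assume z: "z \<in> ?K"
    have "bump z * (ln (1 + 1 / (Y z)\<^sup>2) * B z) \<le> bump z * (E z + ?c)"
      using lower[OF z] bump_props(1) by (intro mult_left_mono) auto
    also have "\<dots> \<le> bump z * E z + 8 * ?c"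
      using bump_props(2)[of z] by (simp add: distrib_left mult_right_mono)
    finally show "bump z * (ln (1 + 1 / (Y z)\<^sup>2) * B z) \<le> bump z * E z + 8 * ?c" .
  qed
  also have "\<dots> = (LINT z:?K|lborel. bump z * E z) + (LINT z:?K|lborel. 8 * ?c)"
    by (rule set_integral_add[OF I(1,2)])
  \<comment> \<open>Green's formula moves the derivatives to the test function and leaves the
    bounded factor \<open>logcut (Y z)\<close>.\<close>
  also have "(LINT z:?K|lborel. bump z * E z) = (LINT z:?K|lborel. logcut (Y z) * D z)"
    unfolding set_borel_integral_eq_integral(2)[OF I(1)] set_borel_integral_eq_integral(2)[OF I(3)]
    by (rule wirtinger_C2_green[OF W bump]) (use KS supp bump_props in auto)
  also have "\<dots> \<le> (LINT z:?K|lborel. 72 * (2 + pi))"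
  proof (rule set_integral_mono[OF I(3,4)])
    fix z assume z: "z \<in> ?K"
    have "logcut (Y z) * D z \<le> \<bar>logcut (Y z)\<bar> * \<bar>D z\<bar>" by (metis abs_ge_self abs_mult)
    also have "\<dots> \<le> (2 + pi) * 72" using z pos KS by (intro mult_mono logcut_bound D) auto
    finally show "logcut (Y z) * D z \<le> 72 * (2 + pi)" by simp
  qed
  finally show "?L \<le> (72 * (2 + pi) + 16 * (4 + 3 * M)\<^sup>2) * measure lborel ?K"
    unfolding set_integral_const_cball by (simp add: algebra_simps)
qed

section \<open>Projective hypersurfaces and normal families\<close>

lemma cpoly_eval_scale:
  assumes "homogeneous d Q"
  shows "cpoly_eval Q (c *s v) = c ^ d * cpoly_eval Q v"
  unfolding cpoly_eval_def sum_distrib_left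
proof (rule sum.cong)
  fix m assume "m \<in> Poly_Mapping.keys Q"
  then have "(\<Sum>i\<in>UNIV. Poly_Mapping.lookup m i) = d" using assms by (auto simp: homogeneous_def)
  then have "(\<Prod>i\<in>UNIV. c ^ Poly_Mapping.lookup m i) = c ^ d" by (simp flip: power_sum)
  then show "Poly_Mapping.lookup Q m * (\<Prod>i\<in>UNIV. ((c *s v) $ i) ^ Poly_Mapping.lookup m i) =
      c ^ d * (Poly_Mapping.lookup Q m * (\<Prod>i\<in>UNIV. (v $ i) ^ Poly_Mapping.lookup m i))"
    by (simp add: power_mult_distrib prod.distrib mult_ac)
qed simp

lemma cpoly_eval_holomorphic:
  fixes F :: "complex \<Rightarrow> complex ^ 'n::finite"
  assumes "\<And>i. (\<lambda>z. F z $ i) holomorphic_on S"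
  shows "(\<lambda>z. cpoly_eval Q (F z)) holomorphic_on S"
  unfolding cpoly_eval_def by (intro holomorphic_intros assms)

lemma cpoly_eval_tendsto:
  fixes F :: "'b \<Rightarrow> complex ^ 'n::finite"
  assumes "\<And>i. ((\<lambda>n. F n $ i) \<longlongrightarrow> v $ i) net"
  shows "((\<lambda>n. cpoly_eval Q (F n)) \<longlongrightarrow> cpoly_eval Q v) net"
  unfolding cpoly_eval_def by (intro tendsto_intros assms)

text \<open>A monomial of degree d is at most norm v ^ d. The added 1 keeps the constant positive,
  since its logarithm is taken later.\<close>

lemma cpoly_eval_bound:
  fixes v :: "complex ^ 'n::finite"
  assumes "homogeneous d Q"
  shows "cmod (cpoly_eval Q v) \<le> (1 + (\<Sum>m\<in>Poly_Mapping.keys Q. cmod (Poly_Mapping.lookup Q m))) * norm v ^ d"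
proof -
  have "cmod (cpoly_eval Q v) \<le> (\<Sum>m\<in>Poly_Mapping.keys Q. cmod (Poly_Mapping.lookup Q m) * norm v ^ d)"
    unfolding cpoly_eval_def
  proof (rule order.trans[OF norm_sum sum_mono])
    fix m assume "m \<in> Poly_Mapping.keys Q"
    then have d: "(\<Sum>i\<in>UNIV. Poly_Mapping.lookup m i) = d" using assms by (auto simp: homogeneous_def)
    have "(\<Prod>i\<in>UNIV. cmod (v $ i) ^ Poly_Mapping.lookup m i) \<le> (\<Prod>i\<in>UNIV. norm v ^ Poly_Mapping.lookup m i)"
      by (intro prod_mono conjI power_mono Finite_Cartesian_Product.norm_nth_le) auto
    also have "\<dots> = norm v ^ d" by (simp flip: power_sum add: d)
    finally show "cmod (Poly_Mapping.lookup Q m * (\<Prod>i\<in>UNIV. (v $ i) ^ Poly_Mapping.lookup m i))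
       \<le> cmod (Poly_Mapping.lookup Q m) * norm v ^ d"
      by (simp add: norm_mult prod_norm[symmetric] norm_power mult_left_mono)
  qed
  then show ?thesis by (simp add: sum_distrib_right[symmetric] distrib_right add_increasing)
qed

lemma proj_point_eqD:
  assumes "proj_point v = proj_point w"
  obtains c where "c \<noteq> 0" "v = c *s w"
proof -
  have "v = 1 *s v" by simp
  then have "v \<in> proj_point v" unfolding proj_point_def by fastforce
  then show ?thesis using that assms unfolding proj_point_def by auto
qed

lemma proj_point_scale: "c \<noteq> 0 \<Longrightarrow> proj_point (c *s v) = proj_point v"
proof -
  assume c: "c \<noteq> 0"
  have "\<exists>b. a *s v = b *s (c *s v) \<and> b \<noteq> 0" if "a \<noteq> 0" for a
    using that c by (intro exI[of _ "a / c"]) (simp add: vector_smult_assoc)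
  then show ?thesis using c unfolding proj_point_def by (fastforce simp: vector_smult_assoc)
qed

lemma proj_point_in_Supp:
  assumes "hypersurface Q" "w \<noteq> 0"
  shows "proj_point w \<in> Supp Q \<longleftrightarrow> cpoly_eval Q w = 0"
proof
  assume "proj_point w \<in> Supp Q"
  then obtain v where v: "proj_point w = proj_point v" "cpoly_eval Q v = 0" by (auto simp: Supp_def)
  obtain d where "homogeneous d Q" using assms by (auto simp: hypersurface_def)
  then show "cpoly_eval Q w = 0" using v by (metis cpoly_eval_scale mult_zero_right proj_point_eqD)
qed (use assms in \<open>auto simp: Supp_def\<close>)

text \<open>By homogeneity the equations hold for the given vectors and not just for some
  representatives of the same points, and then they pass to the limit by continuity.\<close>

lemma projective_variety_closed:
  fixes F :: "'b \<Rightarrow> complex ^ 'n::finite"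
  assumes V: "projective_variety V" and F: "\<And>n. proj_point (F n) \<in> V"
    and lim: "\<And>i. ((\<lambda>n. F n $ i) \<longlongrightarrow> v $ i) net" and net: "net \<noteq> bot" and v: "v \<noteq> 0"
  shows "proj_point v \<in> V"
proof -
  obtain S where S: "\<forall>Q\<in>S. \<exists>d. homogeneous d Q"
    and VS: "V = {proj_point v | v. v \<noteq> 0 \<and> (\<forall>Q\<in>S. cpoly_eval Q v = 0)}"
    using V by (auto simp: projective_variety_def)
  have "cpoly_eval Q v = 0" if Q: "Q \<in> S" for Q
  proof -
    obtain d where d: "homogeneous d Q" using S Q by auto
    have "cpoly_eval Q (F n) = 0" for n
    proof -
      obtain u where "proj_point (F n) = proj_point u" "cpoly_eval Q u = 0"
        using F[of n] VS Q by auto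
      then show ?thesis using d by (metis cpoly_eval_scale mult_zero_right proj_point_eqD)
    qed
    then have "((\<lambda>n. 0) \<longlongrightarrow> cpoly_eval Q v) net"
      using cpoly_eval_tendsto[OF lim, of Q] by simp
    then show ?thesis using net by (metis tendsto_const tendsto_unique)
  qed
  then show ?thesis using VS v by auto
qed

section \<open>Normal families of curves avoiding the hypersurfaces\<close>

lemma Montel_finite_family:
  fixes h :: "nat \<Rightarrow> 'k \<Rightarrow> complex \<Rightarrow> complex"
  assumes J: "finite J" and S: "open S"
    and hol: "\<And>n k. k \<in> J \<Longrightarrow> h n k holomorphic_on S"
    and bd: "\<And>k. k \<in> J \<Longrightarrow> \<exists>B. \<forall>n. \<forall>z\<in>S. cmod (h n k z) \<le> B"
  shows "\<exists>H r. strict_mono (r :: nat \<Rightarrow> nat) \<and> (\<forall>k\<in>J. H k holomorphic_on S \<and>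
     (\<forall>K. compact K \<and> K \<subseteq> S \<longrightarrow> uniform_limit K (\<lambda>n. h (r n) k) (H k) sequentially))"
  using J hol bd
proof (induction J rule: finite_induct)
  case empty
  show ?case by (intro exI[of _ "\<lambda>_ _. 0"] exI[of _ id]) (auto simp: strict_mono_def)
next
  case (insert j J)
  then obtain H r where r: "strict_mono (r :: nat \<Rightarrow> nat)"
    and H: "\<And>k. k \<in> J \<Longrightarrow> H k holomorphic_on S"
      "\<And>k K. k \<in> J \<Longrightarrow> compact K \<Longrightarrow> K \<subseteq> S \<Longrightarrow> uniform_limit K (\<lambda>n. h (r n) k) (H k) sequentially"
    by (metis insertCI)
  obtain B where B: "\<And>n z. z \<in> S \<Longrightarrow> cmod (h n j z) \<le> B" using insert.prems(2)[of j] by auto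
  \<comment> \<open>A further subsequence along \<open>r\<close> handles the new index; the limits
    already found persist along it.\<close>
  obtain g s where g: "g holomorphic_on S" and s: "strict_mono (s :: nat \<Rightarrow> nat)"
    and lim: "\<And>K. compact K \<Longrightarrow> K \<subseteq> S \<Longrightarrow> uniform_limit K ((\<lambda>n. h (r n) j) \<circ> s) g sequentially"
  proof (rule Montel[OF S, of "range (\<lambda>n. h (r n) j)" "\<lambda>n. h (r n) j"])
    show "\<exists>B. \<forall>h\<in>range (\<lambda>n. h (r n) j). \<forall>z\<in>K. cmod (h z) \<le> B" if "K \<subseteq> S" for K
      using B that by (intro exI[of _ B]) auto
  qed (use insert.prems(1) in auto)
  show ?case
  proof (intro exI[of _ "H(j := g)"] exI[of _ "r \<circ> s"] conjI ballI allI impI)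
    show "strict_mono (r \<circ> s)" using r s by (rule strict_mono_o)
    fix k assume k: "k \<in> insert j J"
    show "(H(j := g)) k holomorphic_on S" using k g H by auto
    fix K assume K: "compact K \<and> K \<subseteq> S"
    show "uniform_limit K (\<lambda>n. h ((r \<circ> s) n) k) ((H(j := g)) k) sequentially"
    proof (cases "k = j")
      case True
      then show ?thesis using lim[of K] K by (simp add: o_def)
    next
      case False
      then have "uniform_limit K (\<lambda>n. h (r n) k) (H k) sequentially" using H(2)[of k K] k K by auto
      from filterlim_compose[OF this filterlim_subseq[OF s]] show ?thesis using False by simp
    qed
  qed
qed

text \<open>
  Normal family argument: a limit of maps avoiding the hypersurfaces and approaching all of them at \<open>0\<close> lies
  in all of them by Hurwitz' theorem, so it takes values in a finite set and is constant.
\<close>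

lemma small_derivative_component:
  fixes V :: "(complex ^ 'n::finite) set set" and j0 j :: 'n
  assumes V: "projective_variety V" and I: "finite I"
    and D: "\<And>i. i \<in> I \<Longrightarrow> hypersurface (D i)"
    and fin: "finite ((\<Inter>i\<in>I. Supp (D i)) \<inter> V)" and \<tau>: "\<tau> > 0"
  shows "\<exists>\<theta>>0. \<forall>g. (\<forall>k. (\<lambda>z. g z $ k) holomorphic_on ball 0 1) \<and>
      (\<forall>z\<in>ball 0 1. g z $ j0 = 1 \<and> (\<forall>k. cmod (g z $ k) \<le> b) \<and> proj_point (g z) \<in> V \<and>
         (\<forall>i\<in>I. cpoly_eval (D i) (g z) \<noteq> 0)) \<and>
      (\<forall>i\<in>I. cmod (cpoly_eval (D i) (g 0)) \<le> \<theta>) \<longrightarrow> cmod (deriv (\<lambda>z. g z $ j) 0) \<le> \<tau>"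
    (is "\<exists>\<theta>>0. \<forall>g. ?P \<theta> g \<longrightarrow> ?C g")
proof (rule ccontr)
  let ?U = "ball (0::complex) 1"
  assume "\<not> ?thesis"
  then have "\<forall>n. \<exists>g. ?P (inverse (real (Suc n))) g \<and> \<not> ?C g"
    by (metis inverse_positive_iff_positive of_nat_0_less_iff zero_less_Suc)
  then obtain g where g: "\<And>n. ?P (inverse (real (Suc n))) (g n)" and nC: "\<And>n. \<not> ?C (g n)" by metis
  \<comment> \<open>Coordinates (\<open>Inl\<close>) and values of the polynomials
    (\<open>Inr\<close>) form one finite family: a single subsequence serves both, and the locally
    uniform convergence of the values is what Hurwitz' theorem requires.\<close>
  define h where "h n k z = (case k of Inl k \<Rightarrow> g n z $ k | Inr i \<Rightarrow> cpoly_eval (D i) (g n z))" for n k z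
  let ?J = "Inl ` (UNIV :: 'n set) \<union> Inr ` I"
  have hol: "h n k holomorphic_on ?U" if "k \<in> ?J" for n k
    using that g[of n] by (auto simp: h_def[abs_def] intro!: cpoly_eval_holomorphic)
  have bd: "\<exists>B. \<forall>n. \<forall>z\<in>?U. cmod (h n k z) \<le> B" if k: "k \<in> ?J" for k
  proof (cases k)
    case (Inl l)
    then show ?thesis using g by (auto simp: h_def intro!: exI[of _ b])
  next
    case (Inr i)
    then obtain d where d: "homogeneous d (D i)" using k D[of i] by (auto simp: hypersurface_def)
    let ?C = "1 + (\<Sum>m\<in>Poly_Mapping.keys (D i). cmod (Poly_Mapping.lookup (D i) m))"
    have C0: "0 \<le> ?C" by (intro add_nonneg_nonneg sum_nonneg) auto
    have "cmod (h n k z) \<le> ?C * (\<Sum>k\<in>(UNIV::'n set). b) ^ d" if z: "z \<in> ?U" for n z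
    proof -
      have "norm (g n z) \<le> (\<Sum>k\<in>UNIV. cmod (g n z $ k))" unfolding norm_vec_def by (rule L2_set_le_sum) simp
      also have "\<dots> \<le> (\<Sum>k\<in>(UNIV::'n set). b)" using g[of n] z by (intro sum_mono) auto
      finally have "?C * norm (g n z) ^ d \<le> ?C * (\<Sum>k\<in>(UNIV::'n set). b) ^ d"
        using C0 by (intro mult_left_mono power_mono) auto
      then show ?thesis using cpoly_eval_bound[OF d, of "g n z"] by (simp add: h_def Inr)
    qed
    then show ?thesis by blast
  qed
  have fJ: "finite ?J" using I by auto
  have "\<exists>H r. strict_mono (r :: nat \<Rightarrow> nat) \<and> (\<forall>k\<in>?J. H k holomorphic_on ?U \<and>
     (\<forall>K. compact K \<and> K \<subseteq> ?U \<longrightarrow> uniform_limit K (\<lambda>n. h (r n) k) (H k) sequentially))"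
    by (rule Montel_finite_family[OF fJ open_ball]) (use hol bd in auto)
  then obtain H r where HR: "strict_mono (r :: nat \<Rightarrow> nat) \<and> (\<forall>k\<in>?J. H k holomorphic_on ?U \<and>
     (\<forall>K. compact K \<and> K \<subseteq> ?U \<longrightarrow> uniform_limit K (\<lambda>n. h (r n) k) (H k) sequentially))"
    by (elim exE) (rule that)
  then have r: "strict_mono r" by (rule conjunct1)
  have H: "H k holomorphic_on ?U"
    "compact K \<Longrightarrow> K \<subseteq> ?U \<Longrightarrow> uniform_limit K (\<lambda>n. h (r n) k) (H k) sequentially"
    if "k \<in> ?J" for k K
    using conjunct2[OF HR, THEN bspec, OF that] by simp_all
  have lim: "(\<lambda>n. h (r n) k z) \<longlonglongrightarrow> H k z" if "k \<in> ?J" "z \<in> ?U" for k z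
    using tendsto_uniform_limitI[OF H(2)[OF that(1), of "{z}"], of z] that(2) by auto
  define v where "v z = (\<chi> k. H (Inl k) z)" for z
  have limv: "(\<lambda>n. g (r n) z $ k) \<longlonglongrightarrow> v z $ k" if "z \<in> ?U" for z k
    using lim[of "Inl k" z] that by (simp add: h_def v_def)
  have v1: "v z $ j0 = 1" if z: "z \<in> ?U" for z
  proof -
    have "(\<lambda>n. g (r n) z $ j0) \<longlonglongrightarrow> 1" using g z by simp
    then show ?thesis using limv[OF z] LIMSEQ_unique by blast
  qed
  then have v0: "v z \<noteq> 0" if "z \<in> ?U" for z using that by force
  have HD: "H (Inr i) z = cpoly_eval (D i) (v z)" if "i \<in> I" "z \<in> ?U" for i z
  proof -
    have "(\<lambda>n. h (r n) (Inr i) z) \<longlonglongrightarrow> cpoly_eval (D i) (v z)"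
      unfolding h_def sum.case by (rule cpoly_eval_tendsto) (rule limv[OF that(2)])
    then show ?thesis using LIMSEQ_unique lim[of "Inr i" z] that by blast
  qed
  have "H (Inr i) z = 0" if i: "i \<in> I" and z: "z \<in> ?U" for i z
  proof -
    \<comment> \<open>The values at 0 tend to 0, so the limit has a zero; as a limit of functions
      without zeros it must be constant, hence 0.\<close>
    have "(\<lambda>n. h (r n) (Inr i) 0) \<longlonglongrightarrow> 0"
    proof (rule Lim_null_comparison)
      show "\<forall>\<^sub>F n in sequentially. norm (h (r n) (Inr i) 0) \<le> inverse (real (Suc (r n)))"
        using g i by (intro always_eventually allI) (auto simp: h_def)
      show "(\<lambda>n. inverse (real (Suc (r n)))) \<longlonglongrightarrow> 0"
        using LIMSEQ_subseq_LIMSEQ[OF LIMSEQ_inverse_real_of_nat r] by (simp add: o_def)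
    qed
    then have H0: "H (Inr i) 0 = 0" using LIMSEQ_unique[OF _ lim[of "Inr i" 0]] i by auto
    have "H (Inr i) constant_on ?U"
    proof (rule ccontr)
      assume nc: "\<not> H (Inr i) constant_on ?U"
      have "H (Inr i) 0 \<noteq> 0"
      proof (rule Hurwitz_no_zeros[OF _ _ _ _ _ nc, of "\<lambda>n. h (r n) (Inr i)"])
        show "h (r n) (Inr i) z \<noteq> 0" if "z \<in> ?U" for n z using g[of "r n"] i that by (auto simp: h_def)
      qed (use i in \<open>auto intro!: hol H\<close>)
      with H0 show False by simp
    qed
    then show ?thesis using H0 z by (auto simp: constant_on_def)
  qed
  then have supp: "proj_point (v z) \<in> (\<Inter>i\<in>I. Supp (D i)) \<inter> V" if z: "z \<in> ?U" for z
    using HD z v0[OF z] proj_point_in_Supp[OF D] g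
    by (auto intro!: projective_variety_closed[OF V _ limv[OF z]])
  have "finite ((\<lambda>z. proj_point (v z)) ` ?U)"
    by (rule finite_subset[OF _ fin]) (use supp in auto)
  \<comment> \<open>With coordinate \<open>j0\<close> normalised to 1, a projective point determines
    its vector, so \<open>v\<close> takes finitely many values.\<close>
  moreover have "v z = v w" if eq: "z \<in> ?U" "w \<in> ?U" "proj_point (v z) = proj_point (v w)" for z w
  proof -
    obtain c where "v z = c *s v w" using eq(3) by (rule proj_point_eqD)
    then show ?thesis using v1[OF eq(1)] v1[OF eq(2)] by auto
  qed
  then have "(\<lambda>z. v z $ j) ` ?U = (\<lambda>P. v (SOME w. w \<in> ?U \<and> proj_point (v w) = P) $ j) ` (\<lambda>z. proj_point (v z)) ` ?U"
    unfolding image_image by (intro image_cong refl arg_cong[where f = "\<lambda>u. u $ j"]) (metis (mono_tags, lifting) someI)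
  ultimately have "finite ((\<lambda>z. v z $ j) ` ?U)" by simp
  moreover have Hj: "(\<lambda>z. v z $ j) = H (Inl j)" by (simp add: v_def)
  ultimately have finH: "finite (H (Inl j) ` ?U)" by (simp only:)
  have "H (Inl j) constant_on ?U"
    by (intro finH continuous_finite_range_constant holomorphic_on_imp_continuous_on H) auto
  then obtain c where c: "\<And>z. z \<in> ?U \<Longrightarrow> H (Inl j) z = c" by (auto simp: constant_on_def)
  have "(H (Inl j) has_field_derivative 0) (at 0)"
    by (rule has_field_derivative_transform_within_open[of "\<lambda>_. c" _ _ ?U]) (use c in auto)
  then have d0: "deriv (H (Inl j)) 0 = 0" by (rule DERIV_imp_deriv)
  have "(\<lambda>n. (deriv ^^ 1) (h (r n) (Inl j)) 0) \<longlonglongrightarrow> (deriv ^^ 1) (H (Inl j)) 0"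
  proof (rule higher_deriv_complex_uniform_limit)
    show "uniform_limit (ball 0 (1/2)) (\<lambda>n. h (r n) (Inl j)) (H (Inl j)) sequentially"
      by (rule uniform_limit_on_subset[OF H(2)[of "Inl j" "cball 0 (1/2)"]]) auto
    show "\<forall>\<^sub>F n in sequentially. h (r n) (Inl j) holomorphic_on ball 0 (1/2)"
      by (intro always_eventually allI holomorphic_on_subset[OF hol]) auto
  qed auto
  then have "(\<lambda>n. deriv (\<lambda>z. g (r n) z $ j) 0) \<longlonglongrightarrow> 0"
    using d0 by (simp add: h_def[abs_def])
  then have "\<forall>\<^sub>F n in sequentially. cmod (deriv (\<lambda>z. g (r n) z $ j) 0) < \<tau>"
    using \<tau> by (auto simp: tendsto_iff dist_norm)
  then obtain n where "cmod (deriv (\<lambda>z. g (r n) z $ j) 0) < \<tau>"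
    using eventually_happens'[OF sequentially_bot] by blast
  then show False using nC[of "r n"] by simp
qed

text \<open>Coordinate \<open>j0\<close> normalised to 1 is an affine chart of projective space. One
  \<theta> has to serve all charts, because the dominant coordinate of a curve changes from point to
  point.\<close>

definition derivative_control ::
    "(complex ^ 'n::finite) set set \<Rightarrow> ('i \<Rightarrow> 'n cpoly) \<Rightarrow> 'i set \<Rightarrow> real \<Rightarrow> real \<Rightarrow> real \<Rightarrow> bool" where
  "derivative_control V D I b \<theta> \<tau> \<longleftrightarrow> (\<forall>g j0 j. (\<forall>k. (\<lambda>z. g z $ k) holomorphic_on ball 0 1) \<and>
      (\<forall>z\<in>ball 0 1. g z $ j0 = 1 \<and> (\<forall>k. cmod (g z $ k) \<le> b) \<and> proj_point (g z) \<in> V \<and>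
         (\<forall>i\<in>I. cpoly_eval (D i) (g z) \<noteq> 0)) \<and>
      (\<forall>i\<in>I. cmod (cpoly_eval (D i) (g 0)) \<le> \<theta>) \<longrightarrow> cmod (deriv (\<lambda>z. g z $ j) 0) \<le> \<tau>)"

text \<open>There are finitely many pairs (j0, j), so their thresholds have a positive minimum;
  lowering \<theta> strengthens the smallness condition.\<close>

lemma small_derivative:
  fixes V :: "(complex ^ 'n::finite) set set"
  assumes V: "projective_variety V" and I: "finite I"
    and D: "\<And>i. i \<in> I \<Longrightarrow> hypersurface (D i)"
    and fin: "finite ((\<Inter>i\<in>I. Supp (D i)) \<inter> V)" and \<tau>: "\<tau> > 0"
  shows "\<exists>\<theta>>0. derivative_control V D I b \<theta> \<tau>"
proof -
  define P where "P x \<theta> g \<longleftrightarrow> (\<forall>k. (\<lambda>z. g z $ k) holomorphic_on ball 0 1) \<and>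
      (\<forall>z\<in>ball 0 1. g z $ fst x = 1 \<and> (\<forall>k. cmod (g z $ k) \<le> b) \<and> proj_point (g z) \<in> V \<and>
         (\<forall>i\<in>I. cpoly_eval (D i) (g z) \<noteq> 0)) \<and>
      (\<forall>i\<in>I. cmod (cpoly_eval (D i) (g 0)) \<le> \<theta>)"
    for x :: "'n \<times> 'n" and \<theta> and g :: "complex \<Rightarrow> complex ^ 'n"
  have "\<exists>\<theta>>0. \<forall>g. P x \<theta> g \<longrightarrow> cmod (deriv (\<lambda>z. g z $ snd x) 0) \<le> \<tau>" for x
    unfolding P_def by (rule small_derivative_component[OF V I D fin \<tau>])
  then obtain t where t: "\<And>x. t x > 0" "\<And>x g. P x (t x) g \<Longrightarrow> cmod (deriv (\<lambda>z. g z $ snd x) 0) \<le> \<tau>"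
    by metis
  have pos: "Min (range t) > 0" using t(1) by (subst Min_gr_iff) auto
  have "cmod (deriv (\<lambda>z. g z $ j) 0) \<le> \<tau>" if "P (j0, j) (Min (range t)) g" for g :: "complex \<Rightarrow> complex ^ 'n" and j0 j
  proof -
    have "Min (range t) \<le> t (j0, j)" by (intro Min_le) auto
    then have "P (j0, j) (t (j0, j)) g" using that unfolding P_def by (meson order.trans)
    from t(2)[OF this] show ?thesis by simp
  qed
  then have "derivative_control V D I b (Min (range t)) \<tau>"
    unfolding derivative_control_def P_def fst_conv by blast
  with pos show ?thesis by blast
qed

section \<open>The Fubini--Study derivative\<close>

text \<open>The sum over all ordered pairs counts every minor twice and expands into the products on
  the right. The identity links the minors in \<open>FS_deriv\<close> with the Gram determinant of
  \<open>wirtinger_C2_log_sum_squares\<close>.\<close>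

lemma Lagrange_identity_complex:
  fixes a b :: "'n::{finite,linorder} \<Rightarrow> complex"
  shows "(\<Sum>(i, j)\<in>{(i, j). i < j}. (cmod (a i * b j - b i * a j))\<^sup>2) =
    (\<Sum>i\<in>UNIV. (cmod (a i))\<^sup>2) * (\<Sum>i\<in>UNIV. (cmod (b i))\<^sup>2) - (cmod (\<Sum>i\<in>UNIV. cnj (b i) * a i))\<^sup>2"
proof -
  define f where "f i j = (cmod (a i * b j - b i * a j))\<^sup>2" for i j
  have sym: "f i j = f j i" for i j
    unfolding f_def by (metis (no_types, lifting) minus_diff_eq mult.commute norm_minus_cancel)
  let ?L = "{(i :: 'n, j). i < j}" and ?G = "{(i :: 'n, j). j < i}" and ?E = "{(i :: 'n, j). i = j}"
  have "(UNIV :: ('n \<times> 'n) set) = (?L \<union> ?G) \<union> ?E" by (auto simp: neq_iff)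
  then have "(\<Sum>(i, j)\<in>UNIV. f i j) = (\<Sum>(i, j)\<in>(?L \<union> ?G) \<union> ?E. f i j)" by simp
  also have "\<dots> = (\<Sum>(i, j)\<in>?L. f i j) + (\<Sum>(i, j)\<in>?G. f i j) + (\<Sum>(i, j)\<in>?E. f i j)"
    by (subst sum.union_disjoint sum.union_disjoint[of ?L]; (auto simp: finite_subset[OF subset_UNIV])?)+
  also have "(\<Sum>(i, j)\<in>?E. f i j) = 0"
    by (intro sum.neutral) (auto simp: f_def)
  also have "(\<Sum>(i, j)\<in>?G. f i j) = (\<Sum>(i, j)\<in>?L. f i j)"
    by (rule sum.reindex_bij_witness[of _ prod.swap prod.swap]) (auto simp: sym)
  finally have 1: "2 * (\<Sum>(i, j)\<in>?L. f i j) = (\<Sum>i\<in>UNIV. \<Sum>j\<in>UNIV. f i j)"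
    by (simp add: sum.cartesian_product)
  have "complex_of_real (\<Sum>i\<in>UNIV. \<Sum>j\<in>UNIV. f i j) =
     (\<Sum>i\<in>UNIV. \<Sum>j\<in>UNIV. (a i * cnj (a i)) * (b j * cnj (b j)) + (b i * cnj (b i)) * (a j * cnj (a j))
       - (cnj (b i) * a i) * cnj (cnj (b j) * a j) - cnj (cnj (b i) * a i) * (cnj (b j) * a j))"
    unfolding f_def of_real_sum complex_norm_square
    by (intro sum.cong refl) (simp add: algebra_simps)
  also have "\<dots> = 2 * ((\<Sum>i\<in>UNIV. a i * cnj (a i)) * (\<Sum>i\<in>UNIV. b i * cnj (b i)) -
       (\<Sum>i\<in>UNIV. cnj (b i) * a i) * cnj (\<Sum>i\<in>UNIV. cnj (b i) * a i))"
    unfolding sum.distrib sum_subtractf sum_product[symmetric] cnj_sum by (simp add: algebra_simps)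
  also have "\<dots> = of_real (2 * ((\<Sum>i\<in>UNIV. (cmod (a i))\<^sup>2) * (\<Sum>i\<in>UNIV. (cmod (b i))\<^sup>2) - (cmod (\<Sum>i\<in>UNIV. cnj (b i) * a i))\<^sup>2))"
    unfolding of_real_mult of_real_diff of_real_sum complex_norm_square by simp
  finally have "(\<Sum>i\<in>UNIV. \<Sum>j\<in>UNIV. f i j) =
    2 * ((\<Sum>i\<in>UNIV. (cmod (a i))\<^sup>2) * (\<Sum>i\<in>UNIV. (cmod (b i))\<^sup>2) - (cmod (\<Sum>i\<in>UNIV. cnj (b i) * a i))\<^sup>2)"
    using of_real_eq_iff by blast
  from trans[OF 1 this] show ?thesis unfolding f_def by (subst (asm) mult_left_cancel) simp_all
qed

lemma norm_vec_square: "(norm (v :: complex ^ 'n::finite))\<^sup>2 = (\<Sum>j\<in>UNIV. (cmod (v $ j))\<^sup>2)"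
  by (simp add: norm_vec_def L2_set_def sum_nonneg)

lemma FS_deriv_square:
  "(FS_deriv F z)\<^sup>2 = (\<Sum>(i, j)\<in>{(i, j). i < j}.
      (cmod (deriv (\<lambda>w. F w $ i) z * F z $ j - F z $ i * deriv (\<lambda>w. F w $ j) z))\<^sup>2) / (norm (F z)) ^ 4"
  unfolding FS_deriv_def norm_vec_square[symmetric]
  by (subst real_sqrt_pow2) (auto intro!: divide_nonneg_nonneg sum_nonneg simp: power_mult[symmetric])

lemma FS_deriv_nonneg: "0 \<le> FS_deriv F z"
  unfolding FS_deriv_def by (intro real_sqrt_ge_zero divide_nonneg_nonneg sum_nonneg) auto

abbreviation (input) FS_area :: "(complex \<Rightarrow> complex ^ 'n::{finite,linorder}) \<Rightarrow> complex \<Rightarrow> real \<Rightarrow> real" where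
  "FS_area F c r \<equiv> (LINT z:cball c r|lborel. (FS_deriv F z)\<^sup>2)"

text \<open>By the Lagrange identity the Gram quotient is the squared Fubini-Study derivative. Thus
  the area density of the curve has the potential ln (norm F), from which harmonic functions may be
  subtracted freely.\<close>

lemma wirtinger_C2_ln_norm:
  fixes F :: "complex \<Rightarrow> complex ^ 'n::{finite,linorder}"
  assumes hol: "\<And>i. (\<lambda>z. F z $ i) holomorphic_on UNIV" and nz: "\<And>z. F z \<noteq> 0"
  shows "\<exists>p A. wirtinger_C2 UNIV (\<lambda>z. ln (norm (F z))) p A (\<lambda>z. (FS_deriv F z)\<^sup>2)"
proof -
  let ?n = "\<lambda>z. \<Sum>j\<in>UNIV. cnj (F z $ j) * deriv (\<lambda>w. F w $ j) z"
  obtain A where A: "wirtinger_C2 UNIV (\<lambda>z. ln (\<Sum>j\<in>UNIV. (cmod (F z $ j))\<^sup>2) / 2)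
     (\<lambda>z. ?n z / of_real (\<Sum>j\<in>UNIV. (cmod (F z $ j))\<^sup>2)) A
     (\<lambda>z. ((\<Sum>j\<in>UNIV. (cmod (deriv (\<lambda>w. F w $ j) z))\<^sup>2) * (\<Sum>j\<in>UNIV. (cmod (F z $ j))\<^sup>2) - (cmod (?n z))\<^sup>2) /
       (\<Sum>j\<in>UNIV. (cmod (F z $ j))\<^sup>2)\<^sup>2)"
    using wirtinger_C2_log_sum_squares[of UNIV UNIV "\<lambda>j w. F w $ j"] hol nz
    by (auto simp flip: norm_vec_square)
  moreover have "ln (\<Sum>j\<in>UNIV. (cmod (F z $ j))\<^sup>2) / 2 = ln (norm (F z))" for z
    by (simp add: ln_realpow nz flip: norm_vec_square)
  moreover have "((\<Sum>j\<in>UNIV. (cmod (deriv (\<lambda>w. F w $ j) z))\<^sup>2) * (\<Sum>j\<in>UNIV. (cmod (F z $ j))\<^sup>2) - (cmod (?n z))\<^sup>2) /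
       (\<Sum>j\<in>UNIV. (cmod (F z $ j))\<^sup>2)\<^sup>2 = (FS_deriv F z)\<^sup>2" for z
    unfolding FS_deriv_square Lagrange_identity_complex norm_vec_square[symmetric]
    by (simp add: power_mult[symmetric])
  ultimately show ?thesis by auto
qed

lemma FS_deriv_affine:
  fixes F :: "complex \<Rightarrow> complex ^ 'n::{finite,linorder}"
  assumes hol: "\<And>i. (\<lambda>z. F z $ i) holomorphic_on UNIV"
  shows "FS_deriv (\<lambda>w. F (c + k * w)) z = cmod k * FS_deriv F (c + k * z)"
proof -
  have d: "deriv (\<lambda>w. F (c + k * w) $ i) z = k * deriv (\<lambda>w. F w $ i) (c + k * z)" for i
  proof (rule DERIV_imp_deriv)
    have "((\<lambda>w. F w $ i) has_field_derivative deriv (\<lambda>w. F w $ i) (c + k * z)) (at (c + k * z))"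
      by (rule holomorphic_derivI[OF hol]) auto
    moreover have "((\<lambda>w. c + k * w) has_field_derivative k) (at z)"
      by (auto intro!: derivative_eq_intros)
    ultimately show "((\<lambda>w. F (c + k * w) $ i) has_field_derivative k * deriv (\<lambda>w. F w $ i) (c + k * z)) (at z)"
      using DERIV_chain2[of "\<lambda>w. F w $ i" _ "\<lambda>w. c + k * w" z k UNIV]
      by (simp only: mult.commute[of k "deriv (\<lambda>w. F w $ i) (c + k * z)"])
  qed
  have "cmod (k * x * y - u * (k * v)) = cmod k * cmod (x * y - u * v)" for x y u v
    by (simp flip: norm_mult add: algebra_simps)
  then have "(FS_deriv (\<lambda>w. F (c + k * w)) z)\<^sup>2 = (cmod k * FS_deriv F (c + k * z))\<^sup>2"
    unfolding power_mult_distrib FS_deriv_square d by (simp add: power_mult_distrib sum_distrib_left case_prod_beta)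
  then show ?thesis by (simp add: FS_deriv_nonneg)
qed

lemma FS_deriv_component:
  fixes F :: "complex \<Rightarrow> complex ^ 'n::{finite,linorder}"
  assumes "F z \<noteq> 0"
  shows "cmod (deriv (\<lambda>w. F w $ i) z * F z $ j - F z $ i * deriv (\<lambda>w. F w $ j) z) \<le> FS_deriv F z * (norm (F z))\<^sup>2"
proof -
  define T where "T i j = cmod (deriv (\<lambda>w. F w $ i) z * F z $ j - F z $ i * deriv (\<lambda>w. F w $ j) z)" for i j
  have *: "T i j \<le> FS_deriv F z * (norm (F z))\<^sup>2" if "i < j" for i j
  proof -
    have "(T i j)\<^sup>2 \<le> (\<Sum>(i, j)\<in>{(i, j). i < j}. (T i j)\<^sup>2)"
      using member_le_sum[of "(i, j)" "{(i, j). i < j}" "\<lambda>(i, j). (T i j)\<^sup>2"] that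
      by (auto simp: finite_subset[OF subset_UNIV])
    also have "\<dots> = (FS_deriv F z * (norm (F z))\<^sup>2)\<^sup>2"
      unfolding power_mult_distrib FS_deriv_square T_def using assms by (simp flip: power_mult)
    finally show ?thesis by (rule power2_le_imp_le) (simp add: FS_deriv_nonneg)
  qed
  have sym: "T i j = T j i"
    unfolding T_def by (metis (no_types, lifting) minus_diff_eq mult.commute norm_minus_cancel)
  have "T i j = 0" if "i = j" using that by (simp add: T_def)
  then have "T i j \<le> FS_deriv F z * (norm (F z))\<^sup>2"
    using *[of i j] *[of j i] sym FS_deriv_nonneg[of F z] by (cases i j rule: linorder_cases) auto
  then show ?thesis by (simp add: T_def)
qed

text \<open>The share of one coordinate in the squared norm is a function on projective space, so
  the Fubini-Study derivative controls its gradient. Hence a coordinate that dominates at one point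
  stays large on a whole disc.\<close>

lemma coordinate_Lipschitz:
  fixes F :: "complex \<Rightarrow> complex ^ 'n::{finite,linorder}"
  assumes hol: "\<And>i. (\<lambda>z. F z $ i) holomorphic_on UNIV" and nz: "\<And>z. F z \<noteq> 0"
    and S: "convex S" and L: "\<And>z. z \<in> S \<Longrightarrow> FS_deriv F z \<le> L" and x: "x \<in> S" and y: "y \<in> S"
  shows "\<bar>(cmod (F x $ j))\<^sup>2 / (norm (F x))\<^sup>2 - (cmod (F y $ j))\<^sup>2 / (norm (F y))\<^sup>2\<bar> \<le>
     2 * real CARD('n) * L * cmod (x - y)"
proof -
  define n where "n z = (\<Sum>l\<in>UNIV. cnj (F z $ l) * deriv (\<lambda>w. F w $ l) z)" for z
  define s where "s z = (norm (F z))\<^sup>2" for z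
  define a where "a z = F z $ j" for z
  define c where "c z = 2 * cnj (a z) * (deriv a z * of_real (s z) - a z * n z) / of_real ((s z)\<^sup>2)" for z
  have s0: "s z > 0" for z using nz by (simp add: s_def)
  have d0: "((\<lambda>z. F z $ l) has_derivative (\<lambda>h. deriv (\<lambda>z. F z $ l) z * h)) (at z)" for l z
    using holomorphic_derivI[OF hol open_UNIV, of z l] by (auto simp: has_field_derivative_def)
  have ds: "(s has_derivative (\<lambda>h. 2 * Re (n z * h))) (at z)" for z
    unfolding s_def norm_vec_square n_def dot_square_norm[symmetric]
    by (rule derivative_eq_intros d0 refl | assumption)+
       (auto simp: fun_eq_iff inner_complex_def sum_distrib_left sum_distrib_right Re_sum
          algebra_simps intro!: sum.cong)
  have da: "((\<lambda>z. (cmod (a z))\<^sup>2) has_derivative (\<lambda>h. 2 * Re (cnj (a z) * deriv a z * h))) (at z)" for z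
    unfolding a_def dot_square_norm[symmetric]
    by (rule derivative_eq_intros d0 refl)+ (auto simp: fun_eq_iff inner_complex_def algebra_simps)
  have d: "((\<lambda>z. (cmod (a z))\<^sup>2 / s z) has_derivative (\<lambda>h. Re (c z * h))) (at z)" for z
  proof -
    have "((\<lambda>z. (cmod (a z))\<^sup>2 / s z) has_derivative
      (\<lambda>h. (2 * Re (cnj (a z) * deriv a z * h) * s z - (cmod (a z))\<^sup>2 * (2 * Re (n z * h))) / (s z * s z))) (at z)"
      by (rule has_derivative_divide' da ds)+ (use s0[of z] in simp)
    also have "(\<lambda>h. (2 * Re (cnj (a z) * deriv a z * h) * s z - (cmod (a z))\<^sup>2 * (2 * Re (n z * h))) / (s z * s z))
        = (\<lambda>h. Re (c z * h))"
    proof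
      fix h
      have aux: "Re (of_real r * w) = r * Re w" for r w by simp
      have e: "complex_of_real ((cmod (a z))\<^sup>2) = cnj (a z) * a z"
        unfolding complex_norm_square by (rule mult.commute)
      have "c z * h = (of_real (2 * s z) * (cnj (a z) * deriv a z * h) - of_real (2 * (cmod (a z))\<^sup>2) * (n z * h)) /
          of_real (s z * s z)"
        unfolding c_def of_real_mult e using s0[of z] by (simp add: field_simps power2_eq_square)
      then show "(2 * Re (cnj (a z) * deriv a z * h) * s z - (cmod (a z))\<^sup>2 * (2 * Re (n z * h))) / (s z * s z)
         = Re (c z * h)"
        by (simp only: Re_divide_of_real minus_complex.sel aux) (simp only: algebra_simps)
    qed
    finally show ?thesis .
  qed
  have c: "cmod (c z) \<le> 2 * real CARD('n) * FS_deriv F z" for z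
  proof -
    let ?N = "real CARD('n)" and ?f = "FS_deriv F z"
    have le: "cmod (F z $ l) \<le> norm (F z)" for l by (rule Finite_Cartesian_Product.norm_nth_le)
    have sn: "of_real (s z) = (\<Sum>l\<in>UNIV. cnj (F z $ l) * F z $ l)"
      unfolding s_def norm_vec_square of_real_sum complex_norm_square by (simp add: mult.commute)
    \<comment> \<open>The numerator of \<open>c\<close> is a combination of two by two minors, each
      of which \<open>FS_deriv_component\<close> bounds.\<close>
    have "deriv a z * of_real (s z) - a z * n z =
      (\<Sum>l\<in>UNIV. cnj (F z $ l) * (deriv (\<lambda>w. F w $ j) z * F z $ l - F z $ j * deriv (\<lambda>w. F w $ l) z))"
      unfolding sn n_def a_def by (simp add: sum_distrib_left sum_subtractf[symmetric] algebra_simps)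
    also have "cmod \<dots> \<le> (\<Sum>l\<in>(UNIV::'n set). norm (F z) * (?f * (norm (F z))\<^sup>2))"
    proof (rule order.trans[OF norm_sum sum_mono])
      fix l
      show "cmod (cnj (F z $ l) * (deriv (\<lambda>w. F w $ j) z * F z $ l - F z $ j * deriv (\<lambda>w. F w $ l) z))
         \<le> norm (F z) * (?f * (norm (F z))\<^sup>2)"
        unfolding norm_mult complex_mod_cnj using FS_deriv_component[OF nz] le by (intro mult_mono) auto
    qed
    finally have 1: "cmod (deriv a z * of_real (s z) - a z * n z) \<le> ?N * (norm (F z) * (?f * (norm (F z))\<^sup>2))" by simp
    have "cmod (c z) = 2 * cmod (a z) * cmod (deriv a z * of_real (s z) - a z * n z) / (s z)\<^sup>2"
      unfolding c_def by (simp add: norm_mult norm_divide norm_power)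
    also have "\<dots> \<le> 2 * norm (F z) * (?N * (norm (F z) * (?f * (norm (F z))\<^sup>2))) / (s z)\<^sup>2"
      using 1 le[of j] by (intro divide_right_mono mult_mono) (auto simp: a_def)
    also have "\<dots> = 2 * ?N * ?f"
      using nz[of z] by (simp add: s_def field_simps power2_eq_square)
    finally show ?thesis .
  qed
  have "norm ((cmod (a x))\<^sup>2 / s x - (cmod (a y))\<^sup>2 / s y) \<le> (2 * real CARD('n) * L) * norm (x - y)"
  proof (rule differentiable_bound[OF S])
    show "((\<lambda>z. (cmod (a z))\<^sup>2 / s z) has_derivative (\<lambda>h. Re (c z * h))) (at z within S)" for z
      using d by (rule has_derivative_at_withinI)
    fix z assume z: "z \<in> S"
    show "onorm (\<lambda>h. Re (c z * h)) \<le> 2 * real CARD('n) * L"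
    proof (rule onorm_le)
      fix h
      have "norm (Re (c z * h)) \<le> cmod (c z) * norm h"
        using abs_Re_le_cmod[of "c z * h"] by (simp add: norm_mult)
      also have "\<dots> \<le> (2 * real CARD('n) * FS_deriv F z) * norm h" by (intro mult_right_mono c) auto
      also have "\<dots> \<le> (2 * real CARD('n) * L) * norm h" by (intro mult_right_mono mult_left_mono L z) auto
      finally show "norm (Re (c z * h)) \<le> 2 * real CARD('n) * L * norm h" .
    qed
  qed (use x y in auto)
  then show ?thesis by (simp add: a_def s_def)
qed

text \<open>With N coordinates, the largest one has share at least 1 / N of the squared norm at
  \<zeta>, and the condition on \<rho> keeps it above 1 / (2 N) on the disc. Division by it gives a
  map bounded by sqrt (2 N) in an affine chart; rescaled to the unit disc, it is subject to
  \<open>derivative_control\<close>.\<close>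

lemma FS_deriv_small:
  fixes F :: "complex \<Rightarrow> complex ^ 'n::{finite,linorder}"
  assumes hol: "\<And>i. (\<lambda>z. F z $ i) holomorphic_on UNIV" and nz: "\<And>z. F z \<noteq> 0"
    and V: "\<And>z. proj_point (F z) \<in> V"
    and T: "derivative_control V D I (sqrt (2 * real CARD('n))) \<theta> \<tau>"
    and L: "\<And>w. w \<in> ball \<zeta> \<rho> \<Longrightarrow> FS_deriv F w \<le> L" and \<rho>: "\<rho> > 0" "4 * (real CARD('n))\<^sup>2 * L * \<rho> \<le> 1"
    and nzQ: "\<And>i w. i \<in> I \<Longrightarrow> w \<in> ball \<zeta> \<rho> \<Longrightarrow> cpoly_eval (D i) (F w) \<noteq> 0"
    and small: "\<And>i. i \<in> I \<Longrightarrow> \<exists>d. homogeneous d (D i) \<and>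
        cmod (cpoly_eval (D i) (F \<zeta>)) \<le> \<theta> * (norm (F \<zeta>) / real CARD('n)) ^ d"
    and \<theta>: "\<theta> > 0"
  shows "FS_deriv F \<zeta> \<le> 2 * real CARD('n) * \<tau> / \<rho>"
proof -
  let ?N = "real CARD('n)"
  have N: "?N \<ge> 1" by (simp add: Suc_le_eq)
  obtain j0 where j0: "\<And>k. cmod (F \<zeta> $ k) \<le> cmod (F \<zeta> $ j0)"
  proof -
    have "Max (range (\<lambda>k. cmod (F \<zeta> $ k))) \<in> range (\<lambda>k. cmod (F \<zeta> $ k))" by (intro Max_in) auto
    then obtain j0 where "Max (range (\<lambda>k. cmod (F \<zeta> $ k))) = cmod (F \<zeta> $ j0)" by blast
    then show ?thesis using that[of j0] by (metis Max_ge finite finite_imageI rangeI)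
  qed
  have le1: "(norm (F \<zeta>))\<^sup>2 \<le> ?N * (cmod (F \<zeta> $ j0))\<^sup>2"
    unfolding norm_vec_square using sum_mono[of UNIV "\<lambda>k. (cmod (F \<zeta> $ k))\<^sup>2" "\<lambda>_. (cmod (F \<zeta> $ j0))\<^sup>2"] j0
    by (auto simp: power_mono)
  have le2: "norm (F \<zeta>) \<le> ?N * cmod (F \<zeta> $ j0)"
  proof -
    have "(norm (F \<zeta>))\<^sup>2 \<le> ?N * ?N * (cmod (F \<zeta> $ j0))\<^sup>2"
      using le1 N by (rule_tac order.trans) (auto intro!: mult_right_mono)
    then have "(norm (F \<zeta>))\<^sup>2 \<le> (?N * cmod (F \<zeta> $ j0))\<^sup>2" by (simp add: power2_eq_square mult_ac)
    then show ?thesis using N by (rule_tac power2_le_imp_le) auto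
  qed
  define \<kappa> where "\<kappa> w = (cmod (F w $ j0))\<^sup>2 / (norm (F w))\<^sup>2" for w
  have L0: "L \<ge> 0" using L[of \<zeta>] \<rho> FS_deriv_nonneg[of F \<zeta>] by auto
  have \<kappa>0: "\<kappa> \<zeta> \<ge> 1 / ?N"
    using le1 N nz[of \<zeta>] by (simp add: \<kappa>_def field_simps)
  have \<kappa>: "\<kappa> w \<ge> 1 / (2 * ?N)" if w: "w \<in> ball \<zeta> \<rho>" for w
  proof -
    have "\<bar>\<kappa> w - \<kappa> \<zeta>\<bar> \<le> 2 * ?N * L * cmod (w - \<zeta>)"
      unfolding \<kappa>_def by (rule coordinate_Lipschitz[OF hol nz convex_ball L]) (use w \<rho> in auto)
    also have "\<dots> \<le> 2 * ?N * L * \<rho>"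
      using w L0 by (intro mult_left_mono) (auto simp: dist_norm norm_minus_commute)
    also have "\<dots> \<le> 1 / (2 * ?N)" using \<rho>(2) N by (simp add: field_simps power2_eq_square)
    finally have "\<bar>\<kappa> w - \<kappa> \<zeta>\<bar> \<le> 1 / (2 * ?N)" .
    moreover have "1 / ?N = 1 / (2 * ?N) + 1 / (2 * ?N)" by simp
    ultimately show ?thesis using \<kappa>0 by linarith
  qed
  have nz0: "F w $ j0 \<noteq> 0" if "w \<in> ball \<zeta> \<rho>" for w
  proof
    assume "F w $ j0 = 0"
    then have "\<kappa> w = 0" by (simp add: \<kappa>_def)
    then show False using \<kappa>[OF that] N by simp
  qed
  have in_ball: "\<zeta> + of_real \<rho> * u \<in> ball \<zeta> \<rho>" if "u \<in> ball 0 1" for u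
    using that \<rho> by (simp add: dist_norm norm_mult)
  define g where "g u = (1 / F (\<zeta> + of_real \<rho> * u) $ j0) *s F (\<zeta> + of_real \<rho> * u)" for u
  have holg: "(\<lambda>u. g u $ k) holomorphic_on ball 0 1" for k
  proof -
    have "(\<lambda>w. F w $ l) \<circ> (\<lambda>u. \<zeta> + of_real \<rho> * u) holomorphic_on ball 0 1" for l
      by (intro holomorphic_on_compose holomorphic_intros holomorphic_on_subset[OF hol]) auto
    then have "(\<lambda>u. F (\<zeta> + of_real \<rho> * u) $ l) holomorphic_on ball 0 1" for l by (simp add: o_def)
    then show ?thesis unfolding g_def using nz0 in_ball by (auto intro!: holomorphic_intros)
  qed
  have bound: "cmod (deriv (\<lambda>u. g u $ k) 0) \<le> \<tau>" for k
  proof (rule T[unfolded derivative_control_def, rule_format, of g j0], intro conjI)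
    show "\<forall>k. (\<lambda>z. g z $ k) holomorphic_on ball 0 1" using holg by auto
    show "\<forall>z\<in>ball 0 1. g z $ j0 = 1 \<and> (\<forall>k. cmod (g z $ k) \<le> sqrt (2 * ?N)) \<and> proj_point (g z) \<in> V \<and>
         (\<forall>i\<in>I. cpoly_eval (D i) (g z) \<noteq> 0)"
    proof (intro ballI conjI allI)
      fix u :: complex assume u: "u \<in> ball 0 1"
      let ?w = "\<zeta> + of_real \<rho> * u"
      note w = in_ball[OF u]
      show "g u $ j0 = 1" using nz0[OF w] by (simp add: g_def)
      show "proj_point (g u) \<in> V" using nz0[OF w] V by (simp add: g_def proj_point_scale)
      show "cpoly_eval (D i) (g u) \<noteq> 0" if i: "i \<in> I" for i
        using small[OF i] nzQ[OF i w] nz0[OF w] by (auto simp: g_def cpoly_eval_scale)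
      fix k
      have "cmod (F ?w $ k) \<le> norm (F ?w)" by (rule Finite_Cartesian_Product.norm_nth_le)
      also have "\<dots> \<le> sqrt (2 * ?N) * cmod (F ?w $ j0)"
      proof (rule power2_le_imp_le)
        show "(norm (F ?w))\<^sup>2 \<le> (sqrt (2 * ?N) * cmod (F ?w $ j0))\<^sup>2"
          using \<kappa>[OF w] nz[of ?w] N by (simp add: \<kappa>_def field_simps power_mult_distrib)
      qed auto
      finally show "cmod (g u $ k) \<le> sqrt (2 * ?N)"
        using nz0[OF w] by (simp add: g_def norm_divide field_simps)
    qed
    show "\<forall>i\<in>I. cmod (cpoly_eval (D i) (g 0)) \<le> \<theta>"
    proof
      fix i assume i: "i \<in> I"
      then obtain d where d: "homogeneous d (D i)"
        and le: "cmod (cpoly_eval (D i) (F \<zeta>)) \<le> \<theta> * (norm (F \<zeta>) / ?N) ^ d" using small by blast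
      have p: "cmod (F \<zeta> $ j0) > 0" using nz0[of \<zeta>] \<rho> by simp
      have "norm (F \<zeta>) / ?N \<le> cmod (F \<zeta> $ j0)" using le2 N by (simp add: field_simps)
      then have "(norm (F \<zeta>) / ?N) ^ d \<le> cmod (F \<zeta> $ j0) ^ d" using N by (intro power_mono) auto
      then have "cmod (cpoly_eval (D i) (F \<zeta>)) \<le> \<theta> * cmod (F \<zeta> $ j0) ^ d"
        using le \<theta> by (rule_tac order.trans) (auto intro!: mult_left_mono)
      then show "cmod (cpoly_eval (D i) (g 0)) \<le> \<theta>"
        using p by (simp add: g_def cpoly_eval_scale[OF d] norm_mult norm_divide norm_power power_one_over field_simps)
    qed
  qed
  \<comment> \<open>This is the derivative of the quotient of coordinates k and \<open>j0\<close> at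
    \<zeta>; the rescaling multiplies it by \<rho>.\<close>
  define h where "h k = (deriv (\<lambda>w. F w $ k) \<zeta> * F \<zeta> $ j0 - F \<zeta> $ k * deriv (\<lambda>w. F w $ j0) \<zeta>) / (F \<zeta> $ j0)\<^sup>2" for k
  have a0: "F \<zeta> $ j0 \<noteq> 0" using nz0[of \<zeta>] \<rho> by simp
  have dF: "((\<lambda>u. F (\<zeta> + of_real \<rho> * u) $ l) has_field_derivative deriv (\<lambda>w. F w $ l) \<zeta> * of_real \<rho>) (at 0)" for l
  proof -
    have "((\<lambda>w. F w $ l) has_field_derivative deriv (\<lambda>w. F w $ l) \<zeta>) (at (\<zeta> + of_real \<rho> * 0))"
      using holomorphic_derivI[OF hol open_UNIV, of \<zeta> l] by simp
    moreover have "((\<lambda>u. \<zeta> + of_real \<rho> * u) has_field_derivative of_real \<rho>) (at 0)"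
      by (auto intro!: derivative_eq_intros)
    ultimately show ?thesis by (rule DERIV_chain2)
  qed
  have "deriv (\<lambda>u. g u $ k) 0 = of_real \<rho> * h k" for k
  proof (rule DERIV_imp_deriv)
    have "((\<lambda>u. F (\<zeta> + of_real \<rho> * u) $ k / F (\<zeta> + of_real \<rho> * u) $ j0) has_field_derivative
       (deriv (\<lambda>w. F w $ k) \<zeta> * of_real \<rho> * F (\<zeta> + of_real \<rho> * 0) $ j0 -
         F (\<zeta> + of_real \<rho> * 0) $ k * (deriv (\<lambda>w. F w $ j0) \<zeta> * of_real \<rho>)) /
         (F (\<zeta> + of_real \<rho> * 0) $ j0 * F (\<zeta> + of_real \<rho> * 0) $ j0)) (at 0)"
      by (rule DERIV_divide[OF dF dF]) (use a0 in simp)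
    then show "((\<lambda>u. g u $ k) has_field_derivative of_real \<rho> * h k) (at 0)"
      using a0 by (simp add: g_def[abs_def] h_def power2_eq_square field_simps)
  qed
  then have hb: "cmod (h k) \<le> \<tau> / \<rho>" for k
    using bound[of k] \<rho> by (simp add: norm_mult field_simps)
  have \<tau>0: "\<tau> \<ge> 0" using bound[of undefined] norm_ge_zero order.trans by blast
  have comp: "cmod (deriv (\<lambda>w. F w $ i) \<zeta> * F \<zeta> $ j - F \<zeta> $ i * deriv (\<lambda>w. F w $ j) \<zeta>) \<le> (norm (F \<zeta>))\<^sup>2 * (2 * \<tau> / \<rho>)" for i j
  proof -
    \<comment> \<open>Every minor is recovered from those that involve \<open>j0\<close>, that is,
      from the numbers \<open>h k\<close>.\<close>
    have "deriv (\<lambda>w. F w $ i) \<zeta> * F \<zeta> $ j - F \<zeta> $ i * deriv (\<lambda>w. F w $ j) \<zeta> = F \<zeta> $ j0 * (h i * F \<zeta> $ j - F \<zeta> $ i * h j)"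
      using a0 by (simp add: h_def field_simps power2_eq_square)
    also have "cmod \<dots> \<le> cmod (F \<zeta> $ j0) * (\<tau> / \<rho> * cmod (F \<zeta> $ j0) + cmod (F \<zeta> $ j0) * (\<tau> / \<rho>))"
    proof -
      have "cmod (h i) * cmod (F \<zeta> $ j) \<le> \<tau> / \<rho> * cmod (F \<zeta> $ j0)"
        "cmod (F \<zeta> $ i) * cmod (h j) \<le> cmod (F \<zeta> $ j0) * (\<tau> / \<rho>)"
        by (intro mult_mono hb j0; use \<tau>0 \<rho> in simp)+
      then have "cmod (h i * F \<zeta> $ j - F \<zeta> $ i * h j) \<le> \<tau> / \<rho> * cmod (F \<zeta> $ j0) + cmod (F \<zeta> $ j0) * (\<tau> / \<rho>)"
        using norm_triangle_ineq4[of "h i * F \<zeta> $ j" "F \<zeta> $ i * h j"] unfolding norm_mult by linarith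
      then show ?thesis unfolding norm_mult[of "F \<zeta> $ j0"] by (intro mult_left_mono) auto
    qed
    also have "\<dots> = (cmod (F \<zeta> $ j0))\<^sup>2 * (2 * \<tau> / \<rho>)" by (simp add: power2_eq_square algebra_simps)
    also have "\<dots> \<le> (norm (F \<zeta>))\<^sup>2 * (2 * \<tau> / \<rho>)"
      using \<tau>0 \<rho> by (intro mult_right_mono power_mono Finite_Cartesian_Product.norm_nth_le) auto
    finally show ?thesis .
  qed
  have "(FS_deriv F \<zeta>)\<^sup>2 \<le> (2 * ?N * \<tau> / \<rho>)\<^sup>2"
  proof -
    have "(\<Sum>(i, j)\<in>{(i, j). i < j}. (cmod (deriv (\<lambda>w. F w $ i) \<zeta> * F \<zeta> $ j - F \<zeta> $ i * deriv (\<lambda>w. F w $ j) \<zeta>))\<^sup>2)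
       \<le> (\<Sum>x\<in>{(i::'n, j::'n). i < j}. ((norm (F \<zeta>))\<^sup>2 * (2 * \<tau> / \<rho>))\<^sup>2)"
      unfolding case_prod_beta by (intro sum_mono power_mono comp norm_ge_zero)
    \<comment> \<open>Overcounting by all N^2 pairs produces the factor N after the square
      root.\<close>
    also have "\<dots> \<le> (\<Sum>x\<in>(UNIV :: ('n \<times> 'n) set). ((norm (F \<zeta>))\<^sup>2 * (2 * \<tau> / \<rho>))\<^sup>2)"
      by (intro sum_mono2) auto
    also have "\<dots> = (2 * ?N * \<tau> / \<rho>)\<^sup>2 * norm (F \<zeta>) ^ 4"
      by (simp add: card_prod UNIV_Times_UNIV[symmetric] power_mult_distrib power_divide power2_eq_square power4_eq_xxxx del: UNIV_Times_UNIV)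
    finally show ?thesis unfolding FS_deriv_square using nz[of \<zeta>] by (simp add: divide_le_eq)
  qed
  then show ?thesis by (rule power2_le_imp_le) (use \<tau>0 \<rho> in auto)
qed

section \<open>Division by zeros of a holomorphic function\<close>

text \<open>Because - ln |g| is harmonic where g has no zeros, \<open>circle_mean_upper\<close>
  applies to it with M = 0.\<close>

lemma harmonic_circle_mean_lower:
  assumes S: "open S" "cball z s \<subseteq> S" and s: "s > 0"
    and hol: "g holomorphic_on S" and nz: "\<And>w. w \<in> S \<Longrightarrow> g w \<noteq> 0"
  shows "2 * pi * ln (cmod (g z)) \<le> integral {0..2*pi} (\<lambda>\<theta>. ln (cmod (g (z + of_real s * cis \<theta>))))"
proof -
  obtain p A where W: "wirtinger_C2 S (\<lambda>z. ln (cmod (g z))) p A (\<lambda>_. 0)"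
    using wirtinger_C2_ln_cmod[OF S(1) hol nz] by blast
  have "wirtinger_C2 S (\<lambda>z. (-1) * ln (cmod (g z)) + 0 * ln (cmod (g z)) + 0)
     (\<lambda>z. of_real (-1) * p z + of_real 0 * p z) (\<lambda>z. of_real (-1) * A z + of_real 0 * A z) (\<lambda>_. (-1) * 0 + 0 * 0)"
    by (rule wirtinger_C2_scale_add[OF W W])
  from circle_mean_upper[OF this s S(2), of 0] show ?thesis by simp
qed

text \<open>For \<open>a\<close> inside the circle the function \<open>w - a\<close> is replaced by its reflection, of equal modulus on the circle.\<close>

lemma circle_mean_ln_dist:
  assumes s: "s > 0" and a: "cmod (z - a) \<noteq> s"
  shows "2 * pi * ln s \<le> integral {0..2*pi} (\<lambda>\<theta>. ln (cmod (z + of_real s * cis \<theta> - a)))"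
proof (cases "cmod (z - a) > s")
  case True
  have "2 * pi * ln s \<le> 2 * pi * ln (cmod (z - a))" using s True by (intro mult_left_mono ln_mono) auto
  also have "\<dots> \<le> integral {0..2*pi} (\<lambda>\<theta>. ln (cmod (z + of_real s * cis \<theta> - a)))"
  proof (rule harmonic_circle_mean_lower[of "ball z (cmod (z - a))"])
    show "w - a \<noteq> 0" if "w \<in> ball z (cmod (z - a))" for w using that by (auto simp: dist_norm)
  qed (use True s in \<open>auto intro!: holomorphic_intros\<close>)
  finally show ?thesis .
next
  case False
  then have lt: "cmod (a - z) < s" using a by (simp add: norm_minus_commute)
  define b where "b = a - z"
  define g where "g w = of_real s - cnj b * (w - z) / of_real s" for w
  \<comment> \<open>This is the open disc around z up to the reflection of a, or the whole plane if
    b = 0. It contains the closed disc of radius s because |b| < s.\<close>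
  define S where "S = {w. cmod (cnj b * (w - z)) < s\<^sup>2}"
  have oS: "open S" unfolding S_def by (intro open_Collect_less continuous_intros)
  have "cball z s \<subseteq> S"
  proof
    fix w assume w: "w \<in> cball z s"
    have "cmod (cnj b * (w - z)) \<le> cmod b * s"
      unfolding norm_mult complex_mod_cnj using w by (intro mult_left_mono) (auto simp: dist_norm norm_minus_commute)
    also have "\<dots> < s\<^sup>2" using lt s by (simp add: b_def power2_eq_square)
    finally show "w \<in> S" by (simp add: S_def)
  qed
  moreover have "g w \<noteq> 0" if w: "w \<in> S" for w
  proof
    assume "g w = 0"
    then have "cnj b * (w - z) = of_real s * of_real s" using s by (simp add: g_def field_simps)
    then have "cmod (cnj b * (w - z)) = s * s" using s by (simp add: norm_mult)
    then show False using w by (simp add: S_def power2_eq_square)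
  qed
  ultimately have "2 * pi * ln (cmod (g z)) \<le> integral {0..2*pi} (\<lambda>\<theta>. ln (cmod (g (z + of_real s * cis \<theta>))))"
    by (intro harmonic_circle_mean_lower[OF oS _ s]) (auto simp: g_def intro!: holomorphic_intros)
  also have "(\<lambda>\<theta>. ln (cmod (g (z + of_real s * cis \<theta>)))) = (\<lambda>\<theta>. ln (cmod (z + of_real s * cis \<theta> - a)))"
  proof
    fix \<theta>
    have "g (z + of_real s * cis \<theta>) = cis \<theta> * cnj (of_real s * cis \<theta> - b)"
      using s by (simp add: g_def algebra_simps cis_cnj cis_mult)
    then have "cmod (g (z + of_real s * cis \<theta>)) = cmod (of_real s * cis \<theta> - b)"
      by (simp only: norm_mult complex_mod_cnj norm_cis mult_1_left)
    then show "ln (cmod (g (z + of_real s * cis \<theta>))) = ln (cmod (z + of_real s * cis \<theta> - a))"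
      by (simp add: b_def algebra_simps)
  qed
  finally show ?thesis using s by (simp add: g_def)
qed

text \<open>Finitely many radii are excluded; on the remaining circles the logarithms of the
  distances to the poles are continuous.\<close>

lemma exists_radius_avoiding:
  fixes a :: "nat \<Rightarrow> complex"
  assumes "s > 0" shows "\<exists>r. s / 2 < r \<and> r < s \<and> (\<forall>k<m. cmod (z - a k) \<noteq> r)"
proof -
  have "infinite ({s/2<..<s} - (\<lambda>k. cmod (z - a k)) ` {..<m})"
    using assms by (intro Diff_infinite_finite) auto
  then obtain r where "r \<in> {s/2<..<s} - (\<lambda>k. cmod (z - a k)) ` {..<m}" using infinite_imp_nonempty by blast
  then show ?thesis by (intro exI[of _ r]) auto
qed

text \<open>
  Removing few logarithmic poles from a nonnegative function costs little: by the circle mean inequality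
  the result is nearly bounded below by its means over small circles, where a pole contributes at least
  the logarithm of the radius.
\<close>

lemma lower_bound_without_poles:
  assumes W: "wirtinger_C2 (ball 0 4) w p A B" and B: "\<And>z. z \<in> ball 0 4 \<Longrightarrow> B z \<le> M"
    and \<mu>: "\<mu> \<ge> 0" and M: "M \<ge> 0"
    and nonneg: "\<And>z. z \<in> ball 0 4 \<Longrightarrow> (\<forall>k<m. z \<noteq> a k) \<Longrightarrow> \<mu> * (\<Sum>k<m. ln (cmod (z - a k) / 8)) \<le> w z"
    and z: "z \<in> ball 0 (5/2)" and s: "0 < s" "s \<le> 1"
  shows "- (M * s\<^sup>2 / 2 + \<mu> * real m * ln (16 / s)) \<le> w z"
proof -
  obtain r where r: "s / 2 < r" "r < s" and av: "\<forall>k<m. cmod (z - a k) \<noteq> r"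
    using exists_radius_avoiding[OF s(1), of m z a] by blast
  have r0: "r > 0" using r s by linarith
  let ?c = "\<lambda>\<theta>. z + of_real r * cis \<theta>"
  have sub: "cball z r \<subseteq> ball 0 4"
  proof
    fix u assume "u \<in> cball z r"
    then show "u \<in> ball 0 4" using z r s norm_triangle_sub[of u z] by (simp add: dist_norm norm_minus_commute)
  qed
  have c4: "?c \<theta> \<in> ball 0 4" for \<theta> using circle_in_cball[of r r z \<theta>] sub r0 by auto
  have nz: "?c \<theta> \<noteq> a k" if "k < m" for \<theta> k
  proof
    assume "?c \<theta> = a k"
    then have "z - a k = - of_real r * cis \<theta>" by (simp add: algebra_simps)
    then have "cmod (z - a k) = r" using r0 by (simp add: norm_mult)
    then show False using av that by auto
  qed
  have cont: "continuous_on {0..2*pi} (\<lambda>\<theta>. ln (cmod (?c \<theta> - a k)))" if "k < m" for k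
    using nz[OF that] by (intro continuous_intros) auto
  have int: "(\<lambda>\<theta>. ln (cmod (?c \<theta> - a k)) - ln 8) integrable_on {0..2*pi}" if "k < m" for k
    by (intro integrable_continuous_real continuous_intros cont that)
  \<comment> \<open>As the radius exceeds s / 2, a pole contributes at least 2 pi ln (s / 2), and
    the normalisation by 8 turns s / 2 into s / 16.\<close>
  have i1: "integral {0..2*pi} (\<lambda>\<theta>. ln (cmod (?c \<theta> - a k)) - ln 8) \<ge> 2 * pi * ln (s / 16)" if k: "k < m" for k
  proof -
    have "integral {0..2*pi} (\<lambda>\<theta>. ln (cmod (?c \<theta> - a k)) - ln 8) = integral {0..2*pi} (\<lambda>\<theta>. ln (cmod (?c \<theta> - a k))) - 2 * pi * ln 8"
      by (subst integral_diff) (auto intro!: integrable_continuous_real cont k)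
    moreover have "integral {0..2*pi} (\<lambda>\<theta>. ln (cmod (?c \<theta> - a k))) \<ge> 2 * pi * ln r"
      by (rule circle_mean_ln_dist) (use r0 av k in auto)
    moreover have "ln r \<ge> ln (s / 2)" using r s by (intro ln_mono) auto
    then have "2 * pi * ln r \<ge> 2 * pi * ln (s / 2)" by (intro mult_left_mono) auto
    moreover have "ln (s / 16) = ln (s / 2) - ln 8"
      using s ln_mult[of 2 "8 :: real"] by (simp add: ln_div)
    then have "2 * pi * ln (s / 16) = 2 * pi * ln (s / 2) - 2 * pi * ln 8" by (simp add: right_diff_distrib)
    ultimately show ?thesis by linarith
  qed
  have "\<mu> * (real m * (2 * pi * ln (s / 16))) = \<mu> * (\<Sum>k<m. 2 * pi * ln (s / 16))" by simp
  also have "\<dots> \<le> \<mu> * (\<Sum>k<m. integral {0..2*pi} (\<lambda>\<theta>. ln (cmod (?c \<theta> - a k)) - ln 8))"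
    using i1 \<mu> by (intro mult_left_mono sum_mono) auto
  also have "\<dots> = integral {0..2*pi} (\<lambda>\<theta>. \<mu> * (\<Sum>k<m. ln (cmod (?c \<theta> - a k)) - ln 8))"
    by (subst integral_mult_right, subst integral_sum) (auto intro!: int)
  also have "\<dots> \<le> integral {0..2*pi} (\<lambda>\<theta>. w (?c \<theta>))"
  proof (rule integral_le)
    show "(\<lambda>\<theta>. \<mu> * (\<Sum>k<m. ln (cmod (?c \<theta> - a k)) - ln 8)) integrable_on {0..2*pi}"
      by (intro integrable_continuous_real continuous_intros cont) auto
    show "(\<lambda>\<theta>. w (?c \<theta>)) integrable_on {0..2*pi}"
      by (intro integrable_continuous_real continuous_on_compose2[OF wirtinger_C2_D(6)[OF W]] continuous_intros)
         (use c4 in auto)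
    fix \<theta>
    have "(\<Sum>k<m. ln (cmod (?c \<theta> - a k)) - ln 8) = (\<Sum>k<m. ln (cmod (?c \<theta> - a k) / 8))"
      by (intro sum.cong refl) (use nz in \<open>simp add: ln_div\<close>)
    then show "\<mu> * (\<Sum>k<m. ln (cmod (?c \<theta> - a k)) - ln 8) \<le> w (?c \<theta>)"
      using nonneg[OF c4, of \<theta>] nz by auto
  qed
  also have "\<dots> \<le> 2 * pi * w z + pi * M * r\<^sup>2"
    by (rule circle_mean_upper[OF W r0 sub]) (use B sub in auto)
  also have "\<dots> \<le> 2 * pi * w z + pi * M * s\<^sup>2"
    using r r0 M by (intro add_left_mono mult_left_mono power_mono) auto
  finally have "2 * pi * (\<mu> * real m * ln (s / 16)) \<le> 2 * pi * (w z + M * s\<^sup>2 / 2)"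
    by (simp add: algebra_simps)
  then have "\<mu> * real m * ln (s / 16) \<le> w z + M * s\<^sup>2 / 2" by simp
  moreover have "ln (s / 16) = - ln (16 / s)" using s by (simp add: ln_div)
  ultimately show ?thesis by simp
qed

text \<open>Here w is (ln (norm G) - ln |g| / d) / R up to a constant, where g is Q(G) with its
  zeros divided out, so that ln |g| is harmonic. As |Q(G)| \<le> C norm(G)^d, w is nonnegative up to
  logarithmic poles, whose removal costs \<kappa>. The last conclusion is the definition read
  backwards: where w exceeds a positive constant, Q(G) is exponentially small in R.\<close>

lemma curve_minus_poles:
  fixes G :: "complex \<Rightarrow> complex ^ 'n::{finite,linorder}"
  assumes hol: "\<And>i. (\<lambda>z. G z $ i) holomorphic_on UNIV" and nz: "\<And>z. G z \<noteq> 0"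
    and M: "M \<ge> 0" and R: "R > 0" and FS: "\<And>z. z \<in> ball 0 4 \<Longrightarrow> (FS_deriv G z)\<^sup>2 \<le> M * R"
    and d: "d \<ge> 1" and C: "C > 0" "\<And>v. cmod (cpoly_eval Q v) \<le> C * norm v ^ d"
    and m: "real m \<le> \<nu> * R" and g: "g holomorphic_on ball 0 4"
    and fac: "\<And>z. z \<in> ball 0 4 \<Longrightarrow> g z \<noteq> 0 \<and> cpoly_eval Q (G z) = g z * (\<Prod>k<m. z - a k)"
    and a: "\<And>k. k < m \<Longrightarrow> a k \<in> ball 0 4"
    and s: "0 < s" "s \<le> 1" "M * s\<^sup>2 / 2 + \<nu> * ln (16 / s) \<le> \<kappa>"
  shows "\<exists>w p A. wirtinger_C2 (ball 0 4) w p A (\<lambda>z. (FS_deriv G z)\<^sup>2 / R) \<and>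
    (\<forall>z\<in>ball 0 (5/2). - \<kappa> \<le> w z) \<and>
    (\<forall>z\<in>ball 0 4. cmod (cpoly_eval Q (G z)) \<le> C * (norm (G z) * exp (- R * w z)) ^ d)"
proof -
  let ?S = "ball (0::complex) 4"
  obtain p1 A1 where W1: "wirtinger_C2 UNIV (\<lambda>z. ln (norm (G z))) p1 A1 (\<lambda>z. (FS_deriv G z)\<^sup>2)"
    using wirtinger_C2_ln_norm[OF hol nz] by blast
  obtain p2 A2 where W2: "wirtinger_C2 ?S (\<lambda>z. ln (cmod (g z))) p2 A2 (\<lambda>_. 0)"
    using wirtinger_C2_ln_cmod[OF open_ball g] fac by blast
  define \<mu> where "\<mu> = 1 / (R * real d)"
  have \<mu>: "\<mu> > 0" "R * real d * \<mu> = 1" using R d by (auto simp: \<mu>_def)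
  have R\<mu>: "1 / R = \<mu> * real d" using R d by (simp add: \<mu>_def)
  \<comment> \<open>The additive constant absorbs C and the m factors |z - a k|; 8 is the diameter
    of the ball containing z and all \<open>a k\<close>.\<close>
  define w where "w z = (1 / R) * ln (norm (G z)) + (- \<mu>) * ln (cmod (g z)) + \<mu> * (ln C - real m * ln 8)" for z
  note W = wirtinger_C2_scale_add[OF wirtinger_C2_subset[OF W1 open_ball subset_UNIV] W2,
     of "1 / R" "- \<mu>" "\<mu> * (ln C - real m * ln 8)", folded w_def]
  have B: "(1 / R) * (FS_deriv G z)\<^sup>2 + (- \<mu>) * 0 = (FS_deriv G z)\<^sup>2 / R" for z by simp
  note W = W[unfolded B]
  have low: "- \<kappa> \<le> w z" if z: "z \<in> ball 0 (5/2)" for z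
  proof -
    have "- (M * s\<^sup>2 / 2 + \<mu> * real m * ln (16 / s)) \<le> w z"
    proof (rule lower_bound_without_poles[OF W _ _ M _ z s(1,2)])
      show "(FS_deriv G z)\<^sup>2 / R \<le> M" if "z \<in> ?S" for z using FS[OF that] R by (simp add: divide_le_eq)
      show "\<mu> * (\<Sum>k<m. ln (cmod (z - a k) / 8)) \<le> w z" if z: "z \<in> ?S" and za: "\<forall>k<m. z \<noteq> a k" for z
      proof -
        have p: "cmod (z - a k) > 0" if "k < m" for k using za that by auto
        have "0 < (\<Prod>k<m. cmod (z - a k))" using p by (intro prod_pos) auto
        moreover have "0 < cmod (g z)" using fac[OF z] by simp
        moreover have "cmod (cpoly_eval Q (G z)) = cmod (g z) * (\<Prod>k<m. cmod (z - a k))"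
          using fac[OF z] by (simp add: norm_mult prod_norm)
        moreover have "ln (\<Prod>k<m. cmod (z - a k)) = (\<Sum>k<m. ln (cmod (z - a k)))"
          by (rule ln_prod) (use p in auto)
        ultimately have "ln (cmod (cpoly_eval Q (G z))) = ln (cmod (g z)) + (\<Sum>k<m. ln (cmod (z - a k)))"
          by (simp only: ln_mult_pos)
        moreover have "ln (cmod (cpoly_eval Q (G z))) \<le> ln (C * norm (G z) ^ d)"
        proof (rule ln_mono)
          show "0 < cmod (cpoly_eval Q (G z))" using fac[OF z] za by auto
        qed (use C in auto)
        moreover have "ln (C * norm (G z) ^ d) = ln C + real d * ln (norm (G z))"
          using C nz[of z] by (simp add: ln_mult ln_realpow)
        moreover have "(\<Sum>k<m. ln (cmod (z - a k) / 8)) = (\<Sum>k<m. ln (cmod (z - a k))) - real m * ln 8"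
          using p by (simp add: ln_div sum_subtractf)
        ultimately have "\<mu> * (\<Sum>k<m. ln (cmod (z - a k) / 8)) \<le>
           \<mu> * (ln C + real d * ln (norm (G z)) - ln (cmod (g z)) - real m * ln 8)"
          using \<mu> by (intro mult_left_mono) auto
        also have "\<dots> = w z" by (simp add: w_def R\<mu> algebra_simps)
        finally show ?thesis .
      qed
    qed (use \<mu> in auto)
    moreover have "\<mu> * real m \<le> \<nu>"
    proof -
      have "\<mu> * real m \<le> \<mu> * (\<nu> * R)" using m \<mu> by (intro mult_left_mono) auto
      also have "\<dots> = \<nu> / real d" using R by (simp add: \<mu>_def)
      also have "\<dots> \<le> \<nu>"
      proof -
        have "0 \<le> \<nu> * R" using m by (rule order.trans[rotated]) simp
        then have "\<nu> \<ge> 0" using R by (simp add: zero_le_mult_iff)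
        then show ?thesis using d by (simp add: divide_le_eq mult_le_cancel_left1)
      qed
      finally show ?thesis .
    qed
    then have "\<mu> * real m * ln (16 / s) \<le> \<nu> * ln (16 / s)" using s by (intro mult_right_mono) auto
    ultimately show ?thesis using s(3) by linarith
  qed
  have up: "cmod (cpoly_eval Q (G z)) \<le> C * (norm (G z) * exp (- R * w z)) ^ d" if z: "z \<in> ?S" for z
  proof -
    have g0: "cmod (g z) > 0" using fac[OF z] by simp
    have "real d * (- R * w z) = - (R * real d * \<mu>) * (real d * ln (norm (G z)) - ln (cmod (g z)) + ln C - real m * ln 8)"
      unfolding w_def R\<mu> by (simp add: algebra_simps)
    also have "\<dots> = ln (cmod (g z)) + real m * ln 8 - ln C - real d * ln (norm (G z))" by (simp add: \<mu>)
    finally have e: "exp (- R * w z) ^ d = cmod (g z) * 8 ^ m / C / norm (G z) ^ d"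
      using g0 C nz[of z] by (simp only: exp_of_nat_mult[symmetric]) (simp add: exp_add exp_diff exp_of_nat_mult)
    have "cmod (cpoly_eval Q (G z)) = cmod (g z) * (\<Prod>k<m. cmod (z - a k))"
      using fac[OF z] by (simp add: norm_mult prod_norm)
    also have "\<dots> \<le> cmod (g z) * (\<Prod>k<m. 8)"
    proof (intro mult_left_mono prod_mono conjI)
      fix k assume "k \<in> {..<m}"
      then show "cmod (z - a k) \<le> 8" using a[of k] z norm_triangle_ineq4[of z "a k"] by auto
    qed auto
    also have "\<dots> = C * (norm (G z) * exp (- R * w z)) ^ d"
      unfolding power_mult_distrib e using C nz[of z] by simp
    finally show ?thesis .
  qed
  show ?thesis using W low up by blast
qed

section \<open>Area of a curve meeting the hypersurfaces rarely\<close>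

lemma measure_cball_complex: "r \<ge> 0 \<Longrightarrow> measure lborel (cball (a::complex) r) = pi * r\<^sup>2"
  by (simp add: content_cball unit_ball_vol_2)

text \<open>The zeros in the disc of radius 4 are listed with multiplicity and divided out, the form
  in which the potential theory uses them; the link to \<open>zorder\<close> is made where this
  factorisation is produced.\<close>

definition few_zeros :: "real \<Rightarrow> (complex \<Rightarrow> complex) \<Rightarrow> bool" where
  "few_zeros c q \<longleftrightarrow> (\<exists>m a g. real m \<le> c \<and> g holomorphic_on ball 0 4 \<and>
     (\<forall>z\<in>ball 0 4. g z \<noteq> 0 \<and> q z = g z * (\<Prod>k<m. z - a k)) \<and> (\<forall>k<m. a k \<in> ball 0 4))"

text \<open>
  With \<open>B = (FS_deriv G)^2 / R\<close>, a point of the unit disc either lies where one of the \<open>Y i\<close> is small, so that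
  the logarithmic cutoff controls \<open>B\<close>, or close to a zero of some \<open>D i\<close>, which happens on a set of small
  area only, or the curve is locally so close to all hypersurfaces that \<open>B\<close> is small.
\<close>

lemma few_zeros_small_area:
  fixes V :: "(complex ^ 'n::{finite,linorder}) set set"
  assumes V: "projective_variety V" and I: "finite I"
    and D: "\<And>i. i \<in> I \<Longrightarrow> hypersurface (D i)"
    and fin: "finite ((\<Inter>i\<in>I. Supp (D i)) \<inter> V)" and M: "M > 0" and \<epsilon>: "\<epsilon> > 0"
  shows "\<exists>\<nu>>0. \<exists>R0. \<forall>R\<ge>R0. \<forall>G :: complex \<Rightarrow> complex ^ 'n::{finite,linorder}.
     (\<forall>i. (\<lambda>z. G z $ i) holomorphic_on UNIV) \<longrightarrow> (\<forall>z. G z \<noteq> 0 \<and> proj_point (G z) \<in> V) \<longrightarrow>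
     (\<forall>z\<in>ball 0 4. (FS_deriv G z)\<^sup>2 \<le> M * R) \<longrightarrow>
     (\<forall>i\<in>I. few_zeros (\<nu> * R) (\<lambda>z. cpoly_eval (D i) (G z))) \<longrightarrow>
     FS_area G 0 1 \<le> \<epsilon> * R"
proof -
  let ?N = "real CARD('n)" and ?K = "cball (0::complex) (3/2)"
  have N: "?N \<ge> 1" by (simp add: Suc_le_eq)
  have "\<forall>i. \<exists>d. i \<in> I \<longrightarrow> d \<ge> 1 \<and> homogeneous d (D i)" using D by (auto simp: hypersurface_def)
  then obtain d where d: "\<And>i. i \<in> I \<Longrightarrow> d i \<ge> 1" "\<And>i. i \<in> I \<Longrightarrow> homogeneous (d i) (D i)" by metis
  define C where "C i = 1 + (\<Sum>m\<in>Poly_Mapping.keys (D i). cmod (Poly_Mapping.lookup (D i) m))" for i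
  have C: "C i > 0" for i unfolding C_def by (intro add_pos_nonneg sum_nonneg) auto
  have Cb: "cmod (cpoly_eval (D i) v) \<le> C i * norm v ^ d i" if "i \<in> I" for i v
    unfolding C_def by (rule cpoly_eval_bound[OF d(2)[OF that]])
  define \<alpha> where "\<alpha> = measure lborel ?K"
  have \<alpha>: "\<alpha> > 0" by (simp add: \<alpha>_def measure_cball_complex)
  define b where "b = real (card I) + 1"
  have b: "b > 0" "real (card I) \<le> b" by (auto simp: b_def)
  define Q where "Q = (72 * (2 + pi) + 16 * (4 + 3 * M)\<^sup>2) * \<alpha>"
  have Q: "Q > 0" unfolding Q_def using \<alpha> pi_gt_zero by (intro mult_pos_pos add_pos_nonneg) auto
  \<comment> \<open>The bound \<epsilon> is split into thirds: \<open>e\<close> serves the points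
    where some function Y is small, the second entry of \<nu> the discs around zeros, and
    \<open>\<epsilon>2\<close> the remaining points.\<close>
  define e where "e = \<epsilon> / (3 * b * Q)"
  have e: "e > 0" using \<epsilon> b Q by (simp add: e_def)
  define \<epsilon>2 where "\<epsilon>2 = \<epsilon> / (3 * \<alpha>)"
  have \<epsilon>2: "\<epsilon>2 > 0" using \<epsilon> \<alpha> by (simp add: \<epsilon>2_def)
  \<comment> \<open>Up to this threshold the logarithmic weight is at least 1 / e, so that e times
    the weight dominates 1.\<close>
  define \<eta> where "\<eta> = sqrt (exp (- (1 / e)))"
  have \<eta>: "\<eta> > 0" by (simp add: \<eta>_def)
  have cut: "1 \<le> e * ln (1 + 1 / y\<^sup>2)" if y: "0 < y" "y \<le> \<eta>" for y
  proof -
    have "y\<^sup>2 \<le> \<eta>\<^sup>2" using y by (intro power_mono) auto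
    then have "y\<^sup>2 \<le> exp (- (1 / e))" by (simp add: \<eta>_def)
    then have "exp (1 / e) * y\<^sup>2 \<le> exp (1 / e) * exp (- (1 / e))" by (intro mult_left_mono) auto
    then have "exp (1 / e) \<le> 1 / y\<^sup>2" using y by (simp add: field_simps flip: exp_add)
    then have "ln (exp (1 / e)) \<le> ln (1 + 1 / y\<^sup>2)" by (intro ln_mono) auto
    then have "e * (1 / e) \<le> e * ln (1 + 1 / y\<^sup>2)" using e by (intro mult_left_mono) auto
    then show ?thesis using e by simp
  qed
  \<comment> \<open>With w \<ge> - \<kappa> and Y = w + 2 \<kappa>, the function Y is positive, and
    Y > \<eta> forces w > \<eta> / 2.\<close>
  define \<kappa> where "\<kappa> = \<eta> / 4"
  have \<kappa>: "\<kappa> > 0" using \<eta> by (simp add: \<kappa>_def)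
  \<comment> \<open>One half of \<kappa> is spent on M s^2 / 2, and the other half, through the
    first entry of \<nu>, on the poles.\<close>
  define s where "s = min 1 (sqrt (\<kappa> / M))"
  have s: "0 < s" "s \<le> 1" using \<kappa> M by (auto simp: s_def)
  have "s\<^sup>2 \<le> (sqrt (\<kappa> / M))\<^sup>2" using s by (intro power_mono) (auto simp: s_def)
  then have s2: "M * s\<^sup>2 / 2 \<le> \<kappa> / 2" using \<kappa> M by (simp add: field_simps)
  define l where "l = ln (16 / s) + 1"
  have l: "l > 0" "ln (16 / s) \<le> l" using s by (auto simp: l_def intro!: add_nonneg_pos)
  \<comment> \<open>For \<rho> = c / sqrt R this gives 4 N^2 sqrt (M R) \<rho> = 1, the limit case
    of the condition in \<open>FS_deriv_small\<close>.\<close>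
  define c where "c = 1 / (4 * ?N\<^sup>2 * sqrt M)"
  have c: "c > 0" using N M by (simp add: c_def)
  define \<nu> where "\<nu> = min (\<kappa> / (2 * l)) (\<epsilon> / (3 * b * M * pi * c\<^sup>2))"
  have \<nu>: "\<nu> > 0" using \<kappa> l \<epsilon> b M c by (simp add: \<nu>_def)
  have "\<nu> * l \<le> \<kappa> / (2 * l) * l" using l by (intro mult_right_mono) (auto simp: \<nu>_def)
  then have "\<nu> * l \<le> \<kappa> / 2" using l by simp
  moreover have "\<nu> * ln (16 / s) \<le> \<nu> * l" using \<nu> l by (intro mult_left_mono) auto
  ultimately have s3: "M * s\<^sup>2 / 2 + \<nu> * ln (16 / s) \<le> \<kappa>" using s2 by linarith
  \<comment> \<open>Chosen so that the bound 2 N \<tau> / \<rho> on the derivative becomes sqrt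
    (\<epsilon>2 R).\<close>
  define \<tau> where "\<tau> = c * sqrt \<epsilon>2 / (2 * ?N)"
  have \<tau>: "\<tau> > 0" using c \<epsilon>2 N by (simp add: \<tau>_def)
  obtain \<theta> where \<theta>: "\<theta> > 0" and T: "derivative_control V D I (sqrt (2 * ?N)) \<theta> \<tau>"
    using small_derivative[OF V I D fin \<tau>] by blast
  define H where "H = 1 + (\<Sum>i\<in>I. C i * ?N ^ d i)"
  have Hi: "C i * ?N ^ d i \<le> H" if "i \<in> I" for i
  proof -
    have "0 \<le> C j * ?N ^ d j" for j using C[of j] by simp
    then have "C i * ?N ^ d i \<le> (\<Sum>i\<in>I. C i * ?N ^ d i)" by (intro member_le_sum that I)
    then show ?thesis by (simp add: H_def)
  qed
  have H: "H > 0" unfolding H_def using C by (intro add_pos_nonneg sum_nonneg) (auto intro: less_imp_le)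
  \<comment> \<open>The three summands ensure R \<ge> 1, \<rho> \<le> 1 and exp (- R \<eta> / 2)
    \<le> \<theta> / H.\<close>
  define R0 where "R0 = 1 + c\<^sup>2 + 2 * H / (\<eta> * \<theta>)"
  have main: "FS_area G 0 1 \<le> \<epsilon> * R"
    if R0: "R \<ge> R0" and hol: "\<And>i. (\<lambda>z. G z $ i) holomorphic_on UNIV"
      and nz: "\<And>z. G z \<noteq> 0" and GV: "\<And>z. proj_point (G z) \<in> V"
      and FS: "\<And>z. z \<in> ball 0 4 \<Longrightarrow> (FS_deriv G z)\<^sup>2 \<le> M * R"
      and few: "\<And>i. i \<in> I \<Longrightarrow> few_zeros (\<nu> * R) (\<lambda>z. cpoly_eval (D i) (G z))"
    for R and G :: "complex \<Rightarrow> complex ^ 'n::{finite,linorder}"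
  proof -
    have "2 * H / (\<eta> * \<theta>) > 0" using H \<eta> \<theta> by simp
    then have R: "R \<ge> 1" "R \<ge> c\<^sup>2" "R \<ge> 2 * H / (\<eta> * \<theta>)"
      using R0 unfolding R0_def by (smt (verit) zero_le_power2)+
    define \<rho> where "\<rho> = c / sqrt R"
    have \<rho>: "\<rho> > 0" "\<rho>\<^sup>2 = c\<^sup>2 / R" using c R by (auto simp: \<rho>_def power_divide)
    have "c \<le> sqrt R" using R c by (simp add: real_le_rsqrt)
    then have \<rho>1: "\<rho> \<le> 1" using R by (simp add: \<rho>_def)
    define B where "B z = (FS_deriv G z)\<^sup>2 / R" for z
    have B: "0 \<le> B z" for z using R by (simp add: B_def)
    have BM: "B z \<le> M" if "z \<in> ball 0 4" for z using FS[OF that] R by (simp add: B_def divide_le_eq)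
    have "\<forall>i. \<exists>m a g. i \<in> I \<longrightarrow> real m \<le> \<nu> * R \<and> g holomorphic_on ball 0 4 \<and>
       (\<forall>z\<in>ball 0 4. g z \<noteq> 0 \<and> cpoly_eval (D i) (G z) = g z * (\<Prod>k<m. z - a k)) \<and> (\<forall>k<m. a k \<in> ball 0 4)"
      using few unfolding few_zeros_def by blast
    then obtain m a g where fz: "\<And>i. i \<in> I \<Longrightarrow> real (m i) \<le> \<nu> * R \<and> g i holomorphic_on ball 0 4 \<and>
       (\<forall>z\<in>ball 0 4. g i z \<noteq> 0 \<and> cpoly_eval (D i) (G z) = g i z * (\<Prod>k<m i. z - a i k)) \<and> (\<forall>k<m i. a i k \<in> ball 0 4)"
      by metis
    have "\<exists>w p A. wirtinger_C2 (ball 0 4) w p A B \<and> (\<forall>z\<in>ball 0 (5/2). - \<kappa> \<le> w z) \<and>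
      (\<forall>z\<in>ball 0 4. cmod (cpoly_eval (D i) (G z)) \<le> C i * (norm (G z) * exp (- R * w z)) ^ d i)" if i: "i \<in> I" for i
      unfolding B_def
      by (rule curve_minus_poles[OF hol nz less_imp_le[OF M] _ FS d(1)[OF i] C Cb[OF i], where m = "m i" and g = "g i" and a = "a i"])
         (use fz[OF i] R s s3 in auto)
    then obtain w p A where w: "\<And>i. i \<in> I \<Longrightarrow> wirtinger_C2 (ball 0 4) (w i) (p i) (A i) B"
      and wl: "\<And>i z. i \<in> I \<Longrightarrow> z \<in> ball 0 (5/2) \<Longrightarrow> - \<kappa> \<le> w i z"
      and wu: "\<And>i z. i \<in> I \<Longrightarrow> z \<in> ball 0 4 \<Longrightarrow> cmod (cpoly_eval (D i) (G z)) \<le> C i * (norm (G z) * exp (- R * w i z)) ^ d i"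
      by metis
    define Y where "Y i z = w i z + 2 * \<kappa>" for i z
    have Ypos: "Y i z > 0" if "i \<in> I" "z \<in> ball 0 (5/2)" for i z
      using wl[OF that] \<kappa> by (simp add: Y_def)
    define \<Phi> where "\<Phi> i z = bump z * (ln (1 + 1 / (Y i z)\<^sup>2) * B z)" for i z
    have \<Phi>: "set_integrable lborel ?K (\<Phi> i)" "(LINT z:?K|lborel. \<Phi> i z) \<le> Q" if i: "i \<in> I" for i
    proof -
      have "wirtinger_C2 (ball 0 (5/2)) (\<lambda>z. 1 * w i z + 0 * w i z + 2 * \<kappa>) (\<lambda>z. of_real 1 * p i z + of_real 0 * p i z)
         (\<lambda>z. of_real 1 * A i z + of_real 0 * A i z) (\<lambda>z. 1 * B z + 0 * B z)"
        by (intro wirtinger_C2_scale_add wirtinger_C2_subset[OF w[OF i]]) auto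
      then have "wirtinger_C2 (ball 0 (5/2)) (Y i) (p i) (A i) B"
        by (simp add: Y_def[abs_def])
      from mass_near_zeros[OF this, of M]
      show "set_integrable lborel ?K (\<Phi> i)" "(LINT z:?K|lborel. \<Phi> i z) \<le> Q"
        using B BM Ypos[OF i] by (auto simp: \<Phi>_def[abs_def] Q_def \<alpha>_def)
    qed
    have \<Phi>0: "0 \<le> \<Phi> i z" for i z
      unfolding \<Phi>_def using B bump_props(1) by (intro mult_nonneg_nonneg ln_ge_zero) auto
    \<comment> \<open>The number of excluded discs that contain z. A count is easier to integrate
      than the indicator of the union and dominates it.\<close>
    define bad where "bad z = (\<Sum>i\<in>I. \<Sum>k<m i. indicat_real (cball (a i k) \<rho>) z)" for z
    have point: "B z \<le> (\<Sum>i\<in>I. e * \<Phi> i z) + M * bad z + \<epsilon>2" if z: "z \<in> cball 0 1" for z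
    proof -
      have bad0: "0 \<le> bad z" unfolding bad_def by (intro sum_nonneg) auto
      have sum0: "0 \<le> (\<Sum>i\<in>I. e * \<Phi> i z)" using \<Phi>0 e by (intro sum_nonneg mult_nonneg_nonneg) auto
      have z4: "z \<in> ball 0 4" "z \<in> ball 0 (5/2)" using z by auto
      consider (low) i where "i \<in> I" "Y i z \<le> \<eta>" | (bad) i k where "i \<in> I" "k < m i" "z \<in> cball (a i k) \<rho>"
        | (good) "\<forall>i\<in>I. Y i z > \<eta>" "\<forall>i\<in>I. \<forall>k<m i. z \<notin> cball (a i k) \<rho>"
        by (meson not_le)
      then show ?thesis
      proof cases
        case low
        have "B z = 1 * (1 * B z)" by simp
        also have "\<dots> \<le> (e * ln (1 + 1 / (Y i z)\<^sup>2)) * (bump z * B z)"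
          using cut[OF Ypos[OF low(1) z4(2)] low(2)] bump_props(3)[OF z] B
          by (intro mult_mono mult_right_mono) (auto intro!: mult_nonneg_nonneg)
        also have "\<dots> = e * \<Phi> i z" by (simp add: \<Phi>_def)
        also have "\<dots> \<le> (\<Sum>i\<in>I. e * \<Phi> i z)"
          using member_le_sum[of i I "\<lambda>i. e * \<Phi> i z"] low I \<Phi>0 e by auto
        finally show ?thesis using bad0 M \<epsilon>2 by (simp add: add_increasing2)
      next
        case bad
        have "1 \<le> (\<Sum>k<m i. indicat_real (cball (a i k) \<rho>) z)"
          using member_le_sum[of k "{..<m i}" "\<lambda>k. indicat_real (cball (a i k) \<rho>) z"] bad by auto
        also have "\<dots> \<le> bad z"
          unfolding bad_def using member_le_sum[of i I "\<lambda>i. \<Sum>k<m i. indicat_real (cball (a i k) \<rho>) z"] bad I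
          by (auto intro!: sum_nonneg)
        finally have "M * 1 \<le> M * bad z" using M by (intro mult_left_mono) auto
        then show ?thesis using BM[OF z4(1)] sum0 \<epsilon>2 by linarith
      next
        case good
        have sub: "ball z \<rho> \<subseteq> ball 0 4"
        proof
          fix u assume "u \<in> ball z \<rho>"
          then show "u \<in> ball 0 4" using z \<rho>1 norm_triangle_sub[of u z] by (simp add: dist_norm norm_minus_commute)
        qed
        have "FS_deriv G z \<le> 2 * ?N * \<tau> / \<rho>"
        proof (rule FS_deriv_small[OF hol nz GV T])
          show "FS_deriv G u \<le> sqrt (M * R)" if "u \<in> ball z \<rho>" for u
            using FS[of u] sub that by (intro real_le_rsqrt) auto
          show "4 * ?N\<^sup>2 * sqrt (M * R) * \<rho> \<le> 1"
            using N M R by (simp add: \<rho>_def c_def real_sqrt_mult)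
          show "cpoly_eval (D i) (G u) \<noteq> 0" if i: "i \<in> I" and u: "u \<in> ball z \<rho>" for i u
          proof -
            have "u \<noteq> a i k" if k: "k < m i" for k
            proof
              assume "u = a i k"
              then have "z \<in> cball (a i k) \<rho>" using u by (simp add: dist_commute)
              then show False using good(2) i k by blast
            qed
            then show ?thesis using fz[OF i] sub u by auto
          qed
          show "\<exists>k. homogeneous k (D i) \<and> cmod (cpoly_eval (D i) (G z)) \<le> \<theta> * (norm (G z) / ?N) ^ k" if i: "i \<in> I" for i
          proof (intro exI conjI)
            show "homogeneous (d i) (D i)" by (rule d(2)[OF i])
            let ?x = "exp (- R * w i z)"
            have "w i z \<ge> \<eta> / 2" using good(1) i by (auto simp: Y_def \<kappa>_def)
            then have "R * (\<eta> / 2) \<le> R * w i z" using R by (intro mult_left_mono) auto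
            then have "?x \<le> exp (- (R * (\<eta> / 2)))" by simp
            also have "\<dots> = 1 / exp (R * (\<eta> / 2))" by (simp add: exp_minus field_simps)
            also have "\<dots> \<le> 1 / (R * (\<eta> / 2))"
            proof (rule divide_left_mono)
              show "R * (\<eta> / 2) \<le> exp (R * (\<eta> / 2))"
                using exp_ge_add_one_self[of "R * (\<eta> / 2)"] by linarith
            qed (use R \<eta> in auto)
            also have "\<dots> \<le> \<theta> / H"
              using R(1,3) H \<eta> \<theta> by (simp add: field_simps)
            finally have x: "?x \<le> \<theta> / H" .
            have "0 \<le> w i z" using \<open>w i z \<ge> \<eta> / 2\<close> \<eta> by linarith
            then have "?x \<le> 1" using R by simp
            then have "?x ^ d i \<le> ?x ^ 1" using d(1)[OF i] by (intro power_decreasing) auto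
            then have xd: "?x ^ d i \<le> \<theta> / H" using x by simp
            have "cmod (cpoly_eval (D i) (G z)) \<le> C i * (norm (G z) * ?x) ^ d i" by (rule wu[OF i z4(1)])
            also have "\<dots> = (C i * ?N ^ d i) * ?x ^ d i * (norm (G z) / ?N) ^ d i"
              using N by (simp add: power_mult_distrib power_divide)
            also have "\<dots> \<le> H * (\<theta> / H) * (norm (G z) / ?N) ^ d i"
              using Hi[OF i] xd H N by (intro mult_right_mono mult_mono) auto
            also have "\<dots> = \<theta> * (norm (G z) / ?N) ^ d i" using H by simp
            finally show "cmod (cpoly_eval (D i) (G z)) \<le> \<theta> * (norm (G z) / ?N) ^ d i" .
          qed
        qed (use \<rho> \<theta> in auto)
        also have "2 * ?N * \<tau> / \<rho> = sqrt (\<epsilon>2 * R)"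
          using N c R by (simp add: \<tau>_def \<rho>_def real_sqrt_mult)
        finally have "(FS_deriv G z)\<^sup>2 \<le> (sqrt (\<epsilon>2 * R))\<^sup>2" by (intro power_mono FS_deriv_nonneg)
        then have "B z \<le> \<epsilon>2" using \<epsilon>2 R by (simp add: B_def divide_le_eq)
        then show ?thesis using sum0 bad0 M by (simp add: add_increasing)
      qed
    qed
    obtain p0 A0 where "wirtinger_C2 UNIV (\<lambda>z. ln (norm (G z))) p0 A0 (\<lambda>z. (FS_deriv G z)\<^sup>2)"
      using wirtinger_C2_ln_norm[OF hol nz] by blast
    then have cFS: "continuous_on X (\<lambda>z. (FS_deriv G z)\<^sup>2)" for X
      using wirtinger_C2_D(3) continuous_on_subset by blast
    have iB: "set_integrable lborel (cball 0 1) B"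
      unfolding B_def using R by (intro set_integrable_continuous_compact continuous_intros cFS) auto
    have iK: "integrable lborel (\<lambda>z. indicat_real ?K z * \<epsilon>2)" "integrable lborel (indicat_real (cball z r))" for z :: complex and r
      using borel_integrable_compact[of ?K "\<lambda>_. \<epsilon>2"] borel_integrable_compact[of "cball z r" "\<lambda>_. 1 :: real"] by simp_all
    have i\<Phi>: "integrable lborel (\<lambda>z. \<Sum>i\<in>I. e * (indicat_real ?K z * \<Phi> i z))"
      using \<Phi>(1) by (intro Bochner_Integration.integrable_sum integrable_mult_right) (auto simp: set_integrable_def)
    have ibad: "integrable lborel (\<lambda>z. M * bad z)"
      unfolding bad_def by (intro Bochner_Integration.integrable_sum integrable_mult_right iK)
    have "(LINT z:cball 0 1|lborel. B z) \<le>
        (LINT z|lborel. (\<Sum>i\<in>I. e * (indicat_real ?K z * \<Phi> i z)) + M * bad z + indicat_real ?K z * \<epsilon>2)"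
      unfolding set_lebesgue_integral_def
    proof (rule integral_mono)
      show "integrable lborel (\<lambda>z. indicat_real (cball 0 1) z *\<^sub>R B z)" using iB by (simp add: set_integrable_def)
      show "integrable lborel (\<lambda>z. (\<Sum>i\<in>I. e * (indicat_real ?K z * \<Phi> i z)) + M * bad z + indicat_real ?K z * \<epsilon>2)"
        by (intro Bochner_Integration.integrable_add i\<Phi> ibad iK)
      fix z :: complex
      show "indicat_real (cball 0 1) z *\<^sub>R B z \<le> (\<Sum>i\<in>I. e * (indicat_real ?K z * \<Phi> i z)) + M * bad z + indicat_real ?K z * \<epsilon>2"
      proof (cases "z \<in> cball 0 1")
        case True
        then have "z \<in> ?K" by auto
        then show ?thesis using point[OF True] True by simp
      next
        case False
        have "0 \<le> bad z" unfolding bad_def by (intro sum_nonneg) auto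
        then show ?thesis using False \<Phi>0 e M \<epsilon>2 by (auto intro!: add_nonneg_nonneg sum_nonneg mult_nonneg_nonneg)
      qed
    qed
    also have "\<dots> = (LINT z|lborel. (\<Sum>i\<in>I. e * (indicat_real ?K z * \<Phi> i z))) + (LINT z|lborel. M * bad z) + (LINT z|lborel. indicat_real ?K z * \<epsilon>2)"
      by (simp only: Bochner_Integration.integral_add[OF i\<Phi> ibad]
          Bochner_Integration.integral_add[OF Bochner_Integration.integrable_add[OF i\<Phi> ibad] iK(1)])
    also have "(LINT z|lborel. (\<Sum>i\<in>I. e * (indicat_real ?K z * \<Phi> i z))) = (\<Sum>i\<in>I. e * (LINT z:?K|lborel. \<Phi> i z))"
      using \<Phi>(1) unfolding set_lebesgue_integral_def set_integrable_def
      by (subst Bochner_Integration.integral_sum) (auto intro!: integrable_mult_right)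
    also have "\<dots> \<le> (\<Sum>i\<in>I. e * Q)" using \<Phi>(2) e by (intro sum_mono mult_left_mono) auto
    also have "(\<Sum>i\<in>I. e * Q) \<le> b * (e * Q)" using e Q b by (simp add: mult_right_mono)
    also have "b * (e * Q) = \<epsilon> / 3" using b Q by (simp add: e_def)
    also have "(LINT z|lborel. M * bad z) = M * (\<Sum>i\<in>I. \<Sum>k<m i. measure lborel (cball (a i k) \<rho>))"
      unfolding bad_def
      by (subst integral_mult_right_zero, subst Bochner_Integration.integral_sum;
          (subst Bochner_Integration.integral_sum)?; (intro Bochner_Integration.integrable_sum iK)?) auto
    also have "\<dots> \<le> M * (\<Sum>i\<in>I. \<nu> * R * (pi * \<rho>\<^sup>2))"
    proof (intro mult_left_mono sum_mono)
      fix i assume i: "i \<in> I"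
      have "(\<Sum>k<m i. measure lborel (cball (a i k) \<rho>)) = real (m i) * (pi * \<rho>\<^sup>2)"
        using \<rho>(1) by (simp add: measure_cball_complex)
      also have "\<dots> \<le> \<nu> * R * (pi * \<rho>\<^sup>2)" using fz[OF i] by (intro mult_right_mono) auto
      finally show "(\<Sum>k<m i. measure lborel (cball (a i k) \<rho>)) \<le> \<nu> * R * (pi * \<rho>\<^sup>2)" .
    qed (use M in auto)
    \<comment> \<open>The factor R in the number of zeros cancels against \<rho>^2 = c^2 /
      R.\<close>
    also have "\<dots> = real (card I) * (M * \<nu> * pi * c\<^sup>2)" using R by (simp add: \<rho>(2))
    also have "\<dots> \<le> b * (M * (\<epsilon> / (3 * b * M * pi * c\<^sup>2)) * pi * c\<^sup>2)"
      using b M \<nu> by (intro mult_mono mult_right_mono mult_left_mono) (auto simp: \<nu>_def)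
    also have "\<dots> = \<epsilon> / 3" using b M c by simp
    also have "(LINT z|lborel. indicat_real ?K z * \<epsilon>2) = \<epsilon> / 3" using \<alpha> by (simp add: \<epsilon>2_def \<alpha>_def[symmetric])
    finally have "(LINT z:cball 0 1|lborel. B z) \<le> \<epsilon>" by simp
    moreover have "(LINT z:cball 0 1|lborel. B z) = FS_area G 0 1 / R"
      unfolding B_def by (rule set_integral_divide_zero)
    ultimately show ?thesis using R by (simp add: divide_le_eq)
  qed
  show ?thesis
    by (intro exI[of _ \<nu>] conjI \<nu> exI[of _ R0] allI impI) (rule main; blast)
qed

section \<open>Counting zeros\<close>

text \<open>\<open>zor_poly\<close> gives the quotient near a, and division by (z - a)^n gives it
  elsewhere; both agree on the overlap, so the quotient is entire. If a is no zero, then n =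
  0.\<close>

lemma entire_divide_power:
  assumes hol: "h holomorphic_on UNIV" and nz: "\<exists>w. h w \<noteq> 0"
  shows "\<exists>n g. g holomorphic_on UNIV \<and> g a \<noteq> 0 \<and> (\<forall>z. h z = g z * (z - a) ^ n)"
proof -
  define n where "n = nat (zorder h a)"
  have ex: "\<exists>w\<in>UNIV. h w \<noteq> 0" using nz by simp
  have "\<exists>r>0. cball a r \<subseteq> UNIV \<and> zor_poly h a holomorphic_on cball a r \<and>
     (\<forall>w\<in>cball a r. h w = zor_poly h a w * (w - a) ^ n \<and> zor_poly h a w \<noteq> 0)"
    unfolding n_def by (rule conjunct2[OF zorder_exist_zero[OF hol open_UNIV connected_UNIV UNIV_I ex]])
  then obtain r where r: "r > 0" "zor_poly h a holomorphic_on cball a r"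
    and eqs: "\<forall>w\<in>cball a r. h w = zor_poly h a w * (w - a) ^ n \<and> zor_poly h a w \<noteq> 0"
    by (elim exE conjE) (rule that)
  note eq = bspec[OF eqs]
  define g where "g w = (if w = a then zor_poly h a a else h w / (w - a) ^ n)" for w
  have "g holomorphic_on ball a r"
  proof (rule holomorphic_transform)
    show "zor_poly h a holomorphic_on ball a r" using r by (auto intro: holomorphic_on_subset)
    show "zor_poly h a w = g w" if "w \<in> ball a r" for w using eq[of w] that by (auto simp: g_def)
  qed
  moreover have "g holomorphic_on - {a}"
  proof (rule holomorphic_transform)
    show "(\<lambda>w. h w / (w - a) ^ n) holomorphic_on - {a}"
      by (intro holomorphic_intros holomorphic_on_subset[OF hol]) auto
  qed (auto simp: g_def)
  ultimately have "g holomorphic_on (ball a r \<union> - {a})"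
    by (intro holomorphic_on_Un) auto
  moreover have "ball a r \<union> - {a} = UNIV" using r by auto
  moreover have "g a \<noteq> 0" using eq[of a] r by (simp add: g_def)
  moreover have "h z = g z * (z - a) ^ n" for z
    using eq[of a] r by (cases "z = a") (auto simp: g_def)
  ultimately show ?thesis by metis
qed

lemma entire_factor_zeros:
  assumes hol: "q holomorphic_on UNIV" and nz: "\<exists>w. q w \<noteq> 0" and Z: "finite Z"
  shows "\<exists>h. h holomorphic_on UNIV \<and> (\<forall>z. q z = h z * (\<Prod>a\<in>Z. (z - a) ^ nat (zorder q a))) \<and> (\<forall>a\<in>Z. h a \<noteq> 0)"
  using Z
proof (induction Z rule: finite_induct)
  case empty
  then show ?case using hol by auto
next
  case (insert a Z)
  then obtain h where h: "h holomorphic_on UNIV" "\<And>z. q z = h z * (\<Prod>a\<in>Z. (z - a) ^ nat (zorder q a))"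
    "\<And>b. b \<in> Z \<Longrightarrow> h b \<noteq> 0" by blast
  have "\<exists>w. h w \<noteq> 0" using nz h(2) by auto
  from entire_divide_power[OF h(1) this, of a] obtain n g where g: "g holomorphic_on UNIV" "g a \<noteq> 0"
    "\<And>z. h z = g z * (z - a) ^ n" by blast
  \<comment> \<open>The factors divided out earlier do not vanish at a, so q has there the same
    order as h.\<close>
  have "zorder q a = int n"
  proof (rule zorder_eqI[OF open_UNIV])
    show "(\<lambda>z. g z * (\<Prod>b\<in>Z. (z - b) ^ nat (zorder q b))) holomorphic_on UNIV"
      by (intro holomorphic_intros g)
    show "g a * (\<Prod>b\<in>Z. (a - b) ^ nat (zorder q b)) \<noteq> 0"
      using g(2) insert.hyps by auto
  qed (auto simp: h(2) g(3))
  then have "q z = g z * (\<Prod>a\<in>insert a Z. (z - a) ^ nat (zorder q a))" for z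
    using h(2)[of z] g(3)[of z] insert.hyps by simp
  moreover have "g b \<noteq> 0" if "b \<in> Z" for b using h(3)[OF that] g(3)[of b] by auto
  ultimately show ?case using g by blast
qed

text \<open>Repeating every zero according to its multiplicity leads to the indexed product of
  linear factors in \<open>few_zeros\<close>.\<close>

lemma prod_powers_enumerate:
  fixes n :: "complex \<Rightarrow> nat"
  assumes "finite Z"
  shows "\<exists>a. (\<forall>z. (\<Prod>b\<in>Z. (z - b) ^ n b) = (\<Prod>k<(\<Sum>b\<in>Z. n b). z - a k)) \<and> (\<forall>k<(\<Sum>b\<in>Z. n b). a k \<in> Z)"
proof -
  have "\<exists>xs. length xs = (\<Sum>b\<in>Z. n b) \<and> set xs \<subseteq> Z \<and> (\<forall>z. (\<Prod>b\<in>Z. (z - b) ^ n b) = prod_list (map (\<lambda>b. z - b) xs))"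
    using assms
  proof (induction Z rule: finite_induct)
    case empty
    then show ?case by (intro exI[of _ "[]"]) auto
  next
    case (insert b Z)
    then obtain xs where "length xs = (\<Sum>b\<in>Z. n b)" "set xs \<subseteq> Z"
      "\<forall>z. (\<Prod>b\<in>Z. (z - b) ^ n b) = prod_list (map (\<lambda>b. z - b) xs)" by blast
    then show ?case using insert.hyps
      by (intro exI[of _ "replicate (n b) b @ xs"]) (auto simp: prod_list_replicate)
  qed
  then obtain xs where xs: "length xs = (\<Sum>b\<in>Z. n b)" "set xs \<subseteq> Z"
    "\<And>z. (\<Prod>b\<in>Z. (z - b) ^ n b) = prod_list (map (\<lambda>b. z - b) xs)" by blast
  show ?thesis
  proof (intro exI[of _ "\<lambda>k. xs ! k"] conjI allI impI)
    show "(\<Prod>b\<in>Z. (z - b) ^ n b) = (\<Prod>k<(\<Sum>b\<in>Z. n b). z - xs ! k)" for z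
      unfolding xs(3) prod.list_conv_set_nth by (simp add: xs(1) atLeast0LessThan)
    show "xs ! k \<in> Z" if "k < (\<Sum>b\<in>Z. n b)" for k
      using that xs(1,2) nth_mem by (metis subsetD)
  qed
qed

lemma finite_zeros_in_bounded:
  assumes "q holomorphic_on UNIV" "\<exists>w. q w \<noteq> 0" "bounded X"
  shows "finite {z \<in> X. q z = (0::complex)}"
proof (cases "q constant_on UNIV")
  case True
  then show ?thesis using assms(2) by (auto simp: constant_on_def)
next
  case False
  have "finite {z \<in> closure X. q z = 0}"
    by (rule holomorphic_compact_finite_zeros[OF assms(1) open_UNIV connected_UNIV _ _ False])
       (use assms(3) in auto)
  then show ?thesis by (rule rev_finite_subset) (use closure_subset in auto)
qed

lemma few_zeros_mono:
  assumes "few_zeros c q" "c \<le> c'" shows "few_zeros c' q"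
proof -
  obtain m a g where *: "real m \<le> c \<and> g holomorphic_on ball 0 4 \<and>
     (\<forall>z\<in>ball 0 4. g z \<noteq> 0 \<and> q z = g z * (\<Prod>k<m. z - a k)) \<and> (\<forall>k<m. a k \<in> ball 0 4)"
    using assms(1) unfolding few_zeros_def by (elim exE) (rule that)
  show ?thesis
    unfolding few_zeros_def
    by (intro exI[of _ m] exI[of _ a] exI[of _ g])
       (rule conjI[OF order.trans[OF conjunct1[OF *] assms(2)] conjunct2[OF *]])
qed

lemma zero_count_mono:
  fixes F :: "complex \<Rightarrow> complex ^ 'n::finite"
  assumes hol: "\<And>i. (\<lambda>z. F z $ i) holomorphic_on UNIV" and nz: "\<exists>w. cpoly_eval Q (F w) \<noteq> 0"
    and "s \<le> t"
  shows "zero_count F s \<Omega> Q \<le> zero_count F t \<Omega> Q"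
  unfolding zero_count_def
proof (rule sum_mono2)
  have "{z \<in> ball 0 t \<inter> \<Omega>. cpoly_eval Q (F z) = 0} \<subseteq> {z \<in> ball 0 t. cpoly_eval Q (F z) = 0}" by auto
  then show "finite {z \<in> ball 0 t \<inter> \<Omega>. cpoly_eval Q (F z) = 0}"
    by (rule finite_subset) (intro finite_zeros_in_bounded cpoly_eval_holomorphic hol nz bounded_ball)
qed (use assms in auto)

text \<open>Zeros in the disc of radius 4 k around c correspond to zeros of the rescaled function in
  the disc of radius 4. Each linear factor picks up a factor k, and k^m is moved into the zero-free
  part.\<close>

lemma few_zeros_rescaled:
  fixes F :: "complex \<Rightarrow> complex ^ 'n::finite"
  assumes hol: "\<And>i. (\<lambda>z. F z $ i) holomorphic_on UNIV" and nz: "\<exists>w. cpoly_eval Q (F w) \<noteq> 0"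
    and k: "k > 0" and sub: "ball c (4 * k) \<subseteq> ball 0 t \<inter> \<Omega>"
  shows "few_zeros (real (zero_count F t \<Omega> Q)) (\<lambda>\<zeta>. cpoly_eval Q (F (c + of_real k * \<zeta>)))"
proof -
  define q where "q z = cpoly_eval Q (F z)" for z
  have hq: "q holomorphic_on UNIV" unfolding q_def by (rule cpoly_eval_holomorphic[OF hol])
  have nq: "\<exists>w. q w \<noteq> 0" using nz by (simp add: q_def)
  define Z where "Z = {z \<in> ball c (4 * k). q z = 0}"
  have fZ: "finite Z" unfolding Z_def by (rule finite_zeros_in_bounded[OF hq nq bounded_ball])
  define n where "n b = nat (zorder q b)" for b
  define m where "m = (\<Sum>b\<in>Z. n b)"
  obtain h where h: "h holomorphic_on UNIV" "\<And>z. q z = h z * (\<Prod>b\<in>Z. (z - b) ^ n b)" "\<And>b. b \<in> Z \<Longrightarrow> h b \<noteq> 0"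
    using entire_factor_zeros[OF hq nq fZ] unfolding n_def by blast
  obtain a where a: "\<And>z. (\<Prod>b\<in>Z. (z - b) ^ n b) = (\<Prod>k<m. z - a k)" "\<And>k. k < m \<Longrightarrow> a k \<in> Z"
    using prod_powers_enumerate[OF fZ, of n] unfolding m_def by blast
  have "m \<le> zero_count F t \<Omega> Q"
    unfolding m_def zero_count_def n_def q_def[symmetric, abs_def]
  proof (rule sum_mono2)
    have "{z \<in> ball 0 t \<inter> \<Omega>. q z = 0} \<subseteq> {z \<in> ball 0 t. q z = 0}" by auto
    then show "finite {z \<in> ball 0 t \<inter> \<Omega>. q z = 0}"
      by (rule finite_subset) (intro finite_zeros_in_bounded hq nq bounded_ball)
  qed (use sub in \<open>auto simp: Z_def\<close>)
  let ?z = "\<lambda>\<zeta>. c + of_real k * \<zeta>"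
  define g where "g \<zeta> = h (?z \<zeta>) * of_real k ^ m" for \<zeta>
  have z: "?z \<zeta> \<in> ball c (4 * k)" if "\<zeta> \<in> ball 0 4" for \<zeta>
    using that k by (simp add: dist_norm norm_mult)
  show ?thesis
    unfolding few_zeros_def q_def[symmetric]
  proof (intro exI conjI ballI allI impI)
    show "real m \<le> real (zero_count F t \<Omega> Q)" using \<open>m \<le> _\<close> by simp
    have "h \<circ> ?z holomorphic_on ball 0 4"
      by (intro holomorphic_on_compose holomorphic_intros holomorphic_on_subset[OF h(1)]) auto
    then show "g holomorphic_on ball 0 4" unfolding g_def o_def by (intro holomorphic_intros)
    fix \<zeta> :: complex assume \<zeta>: "\<zeta> \<in> ball 0 4"
    have "h (?z \<zeta>) \<noteq> 0"
    proof
      assume 0: "h (?z \<zeta>) = 0"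
      have "q (?z \<zeta>) = 0" by (subst h(2)) (simp only: 0 mult_zero_left)
      then have "?z \<zeta> \<in> Z" using z[OF \<zeta>] unfolding Z_def by blast
      then show False using h(3) 0 by blast
    qed
    then show "g \<zeta> \<noteq> 0" using k by (simp add: g_def)
    have "(\<Prod>j<m. ?z \<zeta> - a j) = (\<Prod>j<m. of_real k * (\<zeta> - (a j - c) / of_real k))"
      using k by (intro prod.cong refl) (simp add: field_simps)
    then show "q (?z \<zeta>) = g \<zeta> * (\<Prod>j<m. \<zeta> - (a j - c) / of_real k)"
      unfolding h(2)[of "?z \<zeta>"] a(1) by (simp add: g_def prod.distrib)
  next
    fix j assume "j < m"
    then have "a j \<in> ball c (4 * k)" using a(2) by (auto simp: Z_def)
    then show "(a j - c) / of_real k \<in> ball 0 4"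
      using k by (simp add: norm_divide divide_less_eq dist_norm norm_minus_commute)
  qed
qed

lemma nev_count_real:
  "\<exists>w. cpoly_eval Q (F w) \<noteq> 0 \<Longrightarrow>
     nev_count F r \<Omega> Q = ereal (LINT t:{0<..<r}|lborel. real (zero_count F t \<Omega> Q) / t)"
  by (auto simp: nev_count_def)

lemma nev_count_nonneg: "0 \<le> nev_count F r \<Omega> Q"
  unfolding nev_count_def set_lebesgue_integral_def
  by (auto intro!: Bochner_Integration.integral_nonneg simp: indicator_def)

text \<open>On the interval from 2 \<rho> to 4 \<rho>, of length 2 \<rho>, the integrand of the
  counting function is at least the number of zeros up to 2 \<rho>, divided by 4 \<rho>.\<close>

lemma zero_count_le_nev_count:
  fixes F :: "complex \<Rightarrow> complex ^ 'n::finite"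
  assumes hol: "\<And>i. (\<lambda>z. F z $ i) holomorphic_on UNIV" and nz: "\<exists>w. cpoly_eval Q (F w) \<noteq> 0"
    and 0: "0 \<notin> \<Omega>" and \<rho>: "\<rho> > 0"
  shows "ereal (real (zero_count F (2 * \<rho>) \<Omega> Q) / 2) \<le> nev_count F (4 * \<rho>) \<Omega> Q"
proof -
  let ?n = "\<lambda>t. real (zero_count F t \<Omega> Q)"
  have mono: "mono ?n" using zero_count_mono[OF hol nz] by (auto simp: mono_def)
  define Z where "Z = {z \<in> ball 0 1. cpoly_eval Q (F z) = 0} - {0}"
  have "finite Z"
    unfolding Z_def by (intro finite_Diff finite_zeros_in_bounded cpoly_eval_holomorphic hol nz bounded_ball)
  then have "\<exists>d>0. \<forall>z\<in>Z. d \<le> cmod z"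
    by (intro exI[of _ "Min (insert 1 (cmod ` Z))"]) (auto simp: Z_def)
  then obtain d where d: "d > 0" "\<And>z. z \<in> Z \<Longrightarrow> d \<le> cmod z" by blast
  \<comment> \<open>Zeros are isolated and 0 lies outside \<Omega>, so none is counted up to
    \<open>t0\<close> and the integrand is bounded. Integrability matters, since a nonintegrable
    function would have the default integral 0.\<close>
  define t0 where "t0 = min d 1"
  have t0: "t0 > 0" using d by (simp add: t0_def)
  have n0: "?n t = 0" if "t \<le> t0" for t
  proof -
    have "{z \<in> ball 0 t \<inter> \<Omega>. cpoly_eval Q (F z) = 0} = {}"
    proof (rule ccontr)
      assume "\<not> ?thesis"
      then obtain z where z: "cmod z < t" "z \<in> \<Omega>" "cpoly_eval Q (F z) = 0" by auto
      then have "z \<in> Z" using that 0 by (auto simp: Z_def t0_def)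
      then show False using d(2)[of z] z that by (simp add: t0_def)
    qed
    then show ?thesis by (simp only: zero_count_def sum.empty of_nat_0)
  qed
  have int: "integrable lborel (\<lambda>t. indicat_real {0<..<4 * \<rho>} t *\<^sub>R (?n t / t))"
  proof (rule Bochner_Integration.integrable_bound)
    show "integrable lborel (\<lambda>t. indicat_real {0..4 * \<rho>} t *\<^sub>R (?n (4 * \<rho>) / t0))"
      by (rule borel_integrable_compact) auto
    have "?n \<in> borel_measurable borel" by (rule borel_measurable_mono[OF mono])
    then show "(\<lambda>t. indicat_real {0<..<4 * \<rho>} t *\<^sub>R (?n t / t)) \<in> borel_measurable lborel" by measurable
    show "AE t in lborel. norm (indicat_real {0<..<4 * \<rho>} t *\<^sub>R (?n t / t)) \<le> norm (indicat_real {0..4 * \<rho>} t *\<^sub>R (?n (4 * \<rho>) / t0))"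
    proof (intro AE_I2)
      fix t :: real
      show "norm (indicat_real {0<..<4 * \<rho>} t *\<^sub>R (?n t / t)) \<le> norm (indicat_real {0..4 * \<rho>} t *\<^sub>R (?n (4 * \<rho>) / t0))"
      proof (cases "t \<in> {0<..<4 * \<rho>} \<and> t > t0")
        case True
        then have "?n t / t \<le> ?n (4 * \<rho>) / t0"
          using t0 monoD[OF mono, of t "4 * \<rho>"] by (intro frac_le) auto
        then show ?thesis using True t0 by simp
      next
        case False
        then show ?thesis using n0[of t] t0 by (auto simp: indicator_def)
      qed
    qed
  qed
  have "?n (2 * \<rho>) / 2 = (LINT t|lborel. indicat_real {2 * \<rho><..<4 * \<rho>} t *\<^sub>R (?n (2 * \<rho>) / (4 * \<rho>)))"
    using \<rho> by simp
  also have "\<dots> \<le> (LINT t|lborel. indicat_real {0<..<4 * \<rho>} t *\<^sub>R (?n t / t))"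
  proof (rule integral_mono'[OF int])
    fix t :: real
    show "0 \<le> indicat_real {0<..<4 * \<rho>} t *\<^sub>R (?n t / t)" by (auto simp: indicator_def)
    show "indicat_real {2 * \<rho><..<4 * \<rho>} t *\<^sub>R (?n (2 * \<rho>) / (4 * \<rho>)) \<le> indicat_real {0<..<4 * \<rho>} t *\<^sub>R (?n t / t)"
    proof (cases "t \<in> {2 * \<rho><..<4 * \<rho>}")
      case True
      then have "?n (2 * \<rho>) / (4 * \<rho>) \<le> ?n t / t"
        using \<rho> monoD[OF mono, of "2 * \<rho>" t] by (intro frac_le) auto
      then show ?thesis using True \<rho> by simp
    qed (auto simp: indicator_def)
  qed
  finally show ?thesis unfolding nev_count_real[OF nz] set_lebesgue_integral_def by simp
qed

text \<open>Where T vanishes, the quotient in \<open>ereal\<close> is infinite unless N is 0, so the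
  product form holds there as well; an infinite N is excluded in the same way.\<close>

lemma Limsup_quotient_le_0_imp_eventually:
  assumes L: "Limsup at_top (\<lambda>r :: real. N r / ereal (T r)) \<le> 0"
    and N: "\<And>r. 0 \<le> N r" and T: "\<And>r. 0 \<le> T r" and c: "c > 0"
  shows "eventually (\<lambda>r. N r \<le> ereal (c * T r)) at_top"
proof -
  have "Limsup at_top (\<lambda>r. N r / ereal (T r)) < ereal c"
    using c by (intro order.strict_trans1[OF L]) simp
  then have "eventually (\<lambda>r. N r / ereal (T r) < ereal c) at_top" by (rule Limsup_lessD)
  then show ?thesis
  proof (rule eventually_mono)
    fix r assume lt: "N r / ereal (T r) < ereal c"
    show "N r \<le> ereal (c * T r)"
    proof (cases "N r")
      case (real x)
      then have x: "x \<ge> 0" using N[of r] by simp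
      show ?thesis
      proof (cases "T r = 0")
        case True
        then have "x = 0" using lt real x by (cases "x = 0") (auto simp: divide_ereal_def)
        then show ?thesis using True real by simp
      next
        case False
        then have "x / T r < c" using lt real by simp
        then show ?thesis using real False T[of r] by (simp add: divide_less_eq)
      qed
    next
      case PInf
      then show ?thesis using lt T[of r] by (cases "T r = 0") (auto simp: divide_ereal_def)
    next
      case MInf
      then show ?thesis using N[of r] by simp
    qed
  qed
qed

section \<open>Growth of the characteristic function\<close>

lemma continuous_FS_deriv_square:
  fixes F :: "complex \<Rightarrow> complex ^ 'n::{finite,linorder}"
  assumes "\<And>i. (\<lambda>z. F z $ i) holomorphic_on UNIV" "\<And>z. F z \<noteq> 0"
  shows "continuous_on X (\<lambda>z. (FS_deriv F z)\<^sup>2)"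
proof -
  obtain p A where "wirtinger_C2 UNIV (\<lambda>z. ln (norm (F z))) p A (\<lambda>z. (FS_deriv F z)\<^sup>2)"
    using wirtinger_C2_ln_norm[OF assms] by blast
  from wirtinger_C2_D(3)[OF this] show ?thesis by (rule continuous_on_subset) simp
qed

lemma set_integral_cball_affine:
  fixes f :: "complex \<Rightarrow> real"
  assumes f: "continuous_on UNIV f" and k: "k > 0"
  shows "(LINT z:cball c k|lborel. f z) = k\<^sup>2 * (LINT \<zeta>:cball 0 1|lborel. f (c + of_real k * \<zeta>))"
proof -
  have [measurable]: "f \<in> borel_measurable borel" by (rule borel_measurable_continuous_onI[OF f])
  have [measurable]: "cball c k \<in> sets borel" by (rule borel_closed) simp
  have ind: "indicat_real (cball c k) (c + k *\<^sub>R x) = indicat_real (cball 0 1) x" for x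
    using k by (simp add: indicator_def dist_norm)
  have "(LINT z:cball c k|lborel. f z) =
     (LINT z|density (distr lborel borel (\<lambda>x. c + k *\<^sub>R x)) (\<lambda>_. ennreal (\<bar>k\<bar> ^ DIM(complex))). indicat_real (cball c k) z *\<^sub>R f z)"
    unfolding set_lebesgue_integral_def using k by (subst lborel_affine[of k c]) auto
  also have "\<dots> = (LINT z|distr lborel borel (\<lambda>x. c + k *\<^sub>R x). \<bar>k\<bar> ^ DIM(complex) *\<^sub>R (indicat_real (cball c k) z *\<^sub>R f z))"
    by (rule integral_density) auto
  also have "\<dots> = (LINT x|lborel. \<bar>k\<bar> ^ DIM(complex) *\<^sub>R (indicat_real (cball c k) (c + k *\<^sub>R x) *\<^sub>R f (c + k *\<^sub>R x)))"
    by (rule integral_distr) auto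
  also have "\<dots> = k\<^sup>2 * (LINT \<zeta>:cball 0 1|lborel. f (c + of_real k * \<zeta>))"
    unfolding ind set_lebesgue_integral_def by (simp add: scaleR_conv_of_real)
  finally show ?thesis .
qed

text \<open>The increments over dyadic steps form a geometric series. The constant e = E / (2 powr
  \<beta> - 1) solves e + E = e * 2 powr \<beta>, so the bound reproduces itself when t
  doubles.\<close>

lemma power_growth:
  fixes A :: "real \<Rightarrow> real"
  assumes mono: "\<And>s t. s \<le> t \<Longrightarrow> A s \<le> A t" and \<beta>: "\<beta> > 0" and E: "E > 0" and t0: "t0 > 0"
    and step: "\<And>t. t \<ge> t0 \<Longrightarrow> A (2 * t) \<le> A t + E * t powr \<beta>" and t: "t \<ge> t0"
  shows "A t \<le> A (2 * t0) + E / (2 powr \<beta> - 1) * t powr \<beta>"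
proof -
  define e where "e = E / (2 powr \<beta> - 1)"
  have p: "2 powr \<beta> > 1" using \<beta> by simp
  then have "e * (2 powr \<beta> - 1) = E" using \<beta> by (simp add: e_def)
  moreover have "e > 0" using E p by (simp add: e_def)
  ultimately have e: "e > 0" "e + E = e * 2 powr \<beta>" by (simp_all add: right_diff_distrib)
  have "t0 \<le> t \<Longrightarrow> t \<le> 2 ^ n * t0 \<Longrightarrow> A t \<le> A (2 * t0) + e * t powr \<beta>" for n t
  proof (induction n arbitrary: t)
    case 0
    then have "A t \<le> A (2 * t0)" using t0 by (intro mono) auto
    then show ?case using e by (simp add: add_increasing2)
  next
    case (Suc n)
    show ?case
    proof (cases "t \<le> 2 * t0")
      case True
      then have "A t \<le> A (2 * t0)" by (rule mono)
      then show ?thesis using e by (simp add: add_increasing2)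
    next
      case False
      have IH: "A (t / 2) \<le> A (2 * t0) + e * (t / 2) powr \<beta>" using Suc.prems False by (intro Suc.IH) auto
      have "A t \<le> A (t / 2) + E * (t / 2) powr \<beta>" using step[of "t / 2"] False by simp
      also have "\<dots> \<le> A (2 * t0) + (e + E) * (t / 2) powr \<beta>" using IH by (simp add: algebra_simps)
      also have "(e + E) * (t / 2) powr \<beta> = e * t powr \<beta>"
        unfolding e(2) using False t0 by (simp add: powr_divide)
      finally show ?thesis .
    qed
  qed
  moreover obtain n where "t / t0 < 2 ^ n" using real_arch_pow[of 2 "t / t0"] by auto
  then have "t \<le> 2 ^ n * t0" using t0 by (simp add: field_simps)
  ultimately show ?thesis using t by (simp add: e_def)
qed

lemma integrable_powr:
  assumes "a > -1" "r \<ge> (0::real)"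
  shows "integrable lborel (\<lambda>t. indicat_real {0..r} t * t powr a)"
    "(LINT t|lborel. indicat_real {0..r} t * t powr a) = r powr (a + 1) / (a + 1)"
proof -
  have "((\<lambda>t. indicat_real {0..r} t * t powr a) has_integral (r powr (a + 1) / (a + 1))) UNIV"
  proof -
    have "(\<lambda>t. indicat_real {0..r} t * t powr a) = (\<lambda>t. if t \<in> {0..r} then t powr a else 0)"
      by (auto simp: indicator_def)
    then show ?thesis
      using has_integral_powr_from_0[OF assms] by (simp only: has_integral_restrict_UNIV)
  qed
  then have nn: "integral\<^sup>N lborel (\<lambda>t. indicat_real {0..r} t * t powr a) = r powr (a + 1) / (a + 1)"
    by (intro nn_integral_has_integral_lborel) auto
  have "has_bochner_integral lborel (\<lambda>t. indicat_real {0..r} t * t powr a) (r powr (a + 1) / (a + 1))"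
    by (rule has_bochner_integral_nn_integral[OF _ _ _ nn]) (use assms in auto)
  then show "integrable lborel (\<lambda>t. indicat_real {0..r} t * t powr a)"
    "(LINT t|lborel. indicat_real {0..r} t * t powr a) = r powr (a + 1) / (a + 1)"
    by (auto simp: has_bochner_integral_iff)
qed

lemma nev_char_nonneg: "0 \<le> nev_char F r"
  unfolding nev_char_def set_lebesgue_integral_def
  by (intro Bochner_Integration.integral_nonneg)
     (auto simp: indicator_def intro!: mult_nonneg_nonneg Bochner_Integration.integral_nonneg)

text \<open>Doubling gives an area of at most 2 e t powr \<beta> for large t, with e = E / (2 powr
  \<beta> - 1), after an additive constant is absorbed. Integrating area over t gives 2 e r powr
  \<beta> / \<beta>, and absorbing the contribution of small t doubles this. The final constant is
  proportional to E.\<close>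

lemma nev_char_growth:
  fixes F :: "complex \<Rightarrow> complex ^ 'n::{finite,linorder}"
  assumes hol: "\<And>i. (\<lambda>z. F z $ i) holomorphic_on UNIV" and nz: "\<And>z. F z \<noteq> 0"
    and \<beta>: "\<beta> > 0" and E: "E > 0"
    and step: "eventually (\<lambda>t. FS_area F 0 (2 * t) \<le>
       FS_area F 0 t + E * t powr \<beta>) at_top"
  shows "eventually (\<lambda>r. nev_char F r \<le> 4 * E / ((2 powr \<beta> - 1) * \<beta>) * r powr \<beta>) at_top"
proof -
  define A where "A t = FS_area F 0 t" for t
  note cont = continuous_FS_deriv_square[OF hol nz]
  have int: "set_integrable lborel (cball 0 t) (\<lambda>z. (FS_deriv F z)\<^sup>2)" for t
    by (intro set_integrable_continuous_compact cont compact_cball)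
  have A0: "0 \<le> A t" for t
    unfolding A_def set_lebesgue_integral_def by (intro Bochner_Integration.integral_nonneg) auto
  have mono: "A s \<le> A t" if "s \<le> t" for s t
    unfolding A_def set_lebesgue_integral_def
  proof (rule integral_mono)
    show "indicat_real (cball 0 s) z *\<^sub>R (FS_deriv F z)\<^sup>2 \<le> indicat_real (cball 0 t) z *\<^sub>R (FS_deriv F z)\<^sup>2" for z :: complex
      using that by (auto simp: indicator_def)
  qed (use int in \<open>auto simp: set_integrable_def\<close>)
  obtain t' where t': "\<And>t. t \<ge> t' \<Longrightarrow> A (2 * t) \<le> A t + E * t powr \<beta>"
    using step unfolding A_def eventually_at_top_linorder by blast
  define t0 where "t0 = max t' 1"
  have t0: "t0 > 0" "t0 \<ge> t'" by (auto simp: t0_def)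
  define e where "e = E / (2 powr \<beta> - 1)"
  have p: "2 powr \<beta> > 1" using \<beta> by simp
  then have e: "e > 0" using E by (simp add: e_def)
  define a0 where "a0 = A (2 * t0)"
  define t1 where "t1 = max t0 ((a0 / e) powr (1 / \<beta>))"
  have t1: "t1 > 0" "t1 \<ge> t0" using t0 by (auto simp: t1_def)
  have large: "A t \<le> 2 * e * t powr \<beta>" if t: "t \<ge> t1" for t
  proof -
    have "A t \<le> a0 + e * t powr \<beta>"
      unfolding a0_def e_def
      by (rule power_growth[OF mono \<beta> E t0(1)]) (use t' t0 t t1 in auto)
    moreover have "a0 \<le> e * t powr \<beta>"
    proof -
      have "((a0 / e) powr (1 / \<beta>)) powr \<beta> \<le> t powr \<beta>"
        using t \<beta> by (intro powr_mono2) (auto simp: t1_def)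
      then have "a0 / e \<le> t powr \<beta>" using \<beta> e A0 by (simp add: powr_powr a0_def)
      then show ?thesis using e by (simp add: field_simps)
    qed
    ultimately show ?thesis by simp
  qed
  obtain c where c: "\<And>z. z \<in> cball 0 t1 \<Longrightarrow> (FS_deriv F z)\<^sup>2 \<le> c"
  proof -
    have "compact ((\<lambda>z. (FS_deriv F z)\<^sup>2) ` cball 0 t1)" by (intro compact_continuous_image cont compact_cball)
    then have "bdd_above ((\<lambda>z. (FS_deriv F z)\<^sup>2) ` cball 0 t1)" by (simp add: compact_imp_bounded bounded_imp_bdd_above)
    then show ?thesis using that unfolding bdd_above_def by (metis imageI)
  qed
  have c0: "c \<ge> 0" using c[of 0] t1 by (auto intro: order.trans[OF zero_le_power2])
  \<comment> \<open>Near 0 the area is O(t^2), so A t / t is bounded there.\<close>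
  have small: "A t \<le> c * pi * t1 * t" if t: "0 < t" "t \<le> t1" for t
  proof -
    have ic: "set_integrable lborel (cball (0::complex) t) (\<lambda>_. c)"
      by (intro set_integrable_continuous_compact) auto
    have "A t \<le> (LINT z:cball (0::complex) t|lborel. c)"
      unfolding A_def by (rule set_integral_mono[OF int ic]) (use c t in auto)
    also have "\<dots> = c * pi * (t * t)"
      using t by (simp add: set_integral_const_cball measure_cball_complex power2_eq_square)
    also have "\<dots> \<le> c * pi * (t1 * t)" using t c0 by (intro mult_left_mono mult_right_mono) auto
    finally show ?thesis by (simp add: mult_ac)
  qed
  have bound: "nev_char F r \<le> c * pi * t1 * t1 + 2 * e * (r powr \<beta> / \<beta>)" if r: "r \<ge> 0" for r
  proof -
    have i: "integrable lborel (\<lambda>t. indicat_real {0..t1} t *\<^sub>R (c * pi * t1))"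
      by (rule borel_integrable_compact) auto
    note j = integrable_powr[of "\<beta> - 1" r]
    have j': "integrable lborel (\<lambda>t. 2 * e * (indicat_real {0..r} t * t powr (\<beta> - 1)))"
      using j(1) \<beta> r by (intro integrable_mult_right) auto
    have "nev_char F r \<le> (LINT t|lborel. indicat_real {0..t1} t *\<^sub>R (c * pi * t1) + 2 * e * (indicat_real {0..r} t * t powr (\<beta> - 1)))"
      unfolding nev_char_def set_lebesgue_integral_def[of _ "{0<..<r}"] A_def[symmetric]
    proof (rule integral_mono'[OF Bochner_Integration.integrable_add[OF i j']])
      fix t :: real
      show nn: "0 \<le> indicat_real {0..t1} t *\<^sub>R (c * pi * t1) + 2 * e * (indicat_real {0..r} t * t powr (\<beta> - 1))"
        using c0 t1 e by (intro add_nonneg_nonneg) auto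
      show "indicat_real {0<..<r} t *\<^sub>R (1 / t * (1 / pi * A t)) \<le>
         indicat_real {0..t1} t *\<^sub>R (c * pi * t1) + 2 * e * (indicat_real {0..r} t * t powr (\<beta> - 1))"
      proof (cases "t \<in> {0<..<r}")
        case False
        then show ?thesis using nn by simp
      next
        case True
        then have tp: "t > 0" by simp
        have "1 / pi * A t \<le> 1 * A t" using A0[of t] pi_ge_two by (intro mult_right_mono) (auto simp: divide_le_eq)
        then have le: "1 / t * (1 / pi * A t) \<le> A t / t" 
          using divide_right_mono[of "1 / pi * A t" "1 * A t" t] tp by (simp add: mult.commute)
        show ?thesis
        proof (cases "t \<le> t1")
          case le1: True
          have "A t / t \<le> c * pi * t1" using small[OF tp le1] tp by (simp add: divide_le_eq)
          then have "1 / t * (1 / pi * A t) \<le> c * pi * t1" using le by linarith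
          then show ?thesis using True le1 e by (simp add: add_increasing2)
        next
          case gt: False
          have "A t / t \<le> 2 * e * t powr \<beta> / t" using large[of t] gt tp by (intro divide_right_mono) auto
          also have "\<dots> = 2 * e * t powr (\<beta> - 1)" using tp by (simp add: powr_diff)
          finally have "1 / t * (1 / pi * A t) \<le> 2 * e * t powr (\<beta> - 1)" using le by linarith
          then show ?thesis using True gt by simp
        qed
      qed
    qed
    also have "\<dots> = (LINT t|lborel. indicat_real {0..t1} t *\<^sub>R (c * pi * t1)) + (LINT t|lborel. 2 * e * (indicat_real {0..r} t * t powr (\<beta> - 1)))"
      by (rule Bochner_Integration.integral_add[OF i j'])
    also have "\<dots> = c * pi * t1 * t1 + 2 * e * (r powr \<beta> / \<beta>)"
      using j(2) \<beta> r t1 by simp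
    finally show ?thesis .
  qed
  define r0 where "r0 = max 1 (((c * pi * t1 * t1) * \<beta> / (2 * e)) powr (1 / \<beta>))"
  have "nev_char F r \<le> 4 * E / ((2 powr \<beta> - 1) * \<beta>) * r powr \<beta>" if r: "r \<ge> r0" for r
  proof -
    define x where "x = (c * pi * t1 * t1) * \<beta> / (2 * e)"
    have x: "x \<ge> 0" using c0 t1 \<beta> e by (simp add: x_def)
    have "(x powr (1 / \<beta>)) powr \<beta> \<le> r powr \<beta>" using r \<beta> by (intro powr_mono2) (auto simp: r0_def x_def)
    then have "x \<le> r powr \<beta>" using \<beta> x by (simp add: powr_powr)
    then have "2 * e / \<beta> * x \<le> 2 * e / \<beta> * r powr \<beta>" using e \<beta> by (intro mult_left_mono) auto
    moreover have "2 * e / \<beta> * x = c * pi * t1 * t1" using e \<beta> by (simp add: x_def)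
    moreover have "nev_char F r \<le> c * pi * t1 * t1 + 2 * e * (r powr \<beta> / \<beta>)" using r by (intro bound) (auto simp: r0_def)
    moreover have "2 * e * (r powr \<beta> / \<beta>) = 2 * e / \<beta> * r powr \<beta>" by simp
    ultimately have "nev_char F r \<le> 2 * e / \<beta> * r powr \<beta> + 2 * e / \<beta> * r powr \<beta>" by linarith
    also have "\<dots> = 4 * E / ((2 powr \<beta> - 1) * \<beta>) * r powr \<beta>" by (simp add: e_def field_simps)
    finally show ?thesis .
  qed
  then show ?thesis unfolding eventually_at_top_linorder by blast
qed

section \<open>Sectors, and the rescaled curve near a ray\<close>

lemma sector_neighbourhood:
  assumes z: "z \<noteq> 0" and \<epsilon>: "\<epsilon> > 0"
  shows "\<exists>d>0. ball z d \<subseteq> sector (Arg2pi z) \<epsilon>"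
proof -
  \<comment> \<open>The quotient w / z is close to 1, away from the branch cut of
    \<open>Arg\<close>, so it measures the angle to z without jumps.\<close>
  have "isCont (\<lambda>w. Arg (w / z)) z"
  proof (rule isCont_o2[where f = "\<lambda>w. w / z" and g = Arg])
    show "isCont (\<lambda>w. w / z) z" using z by (intro continuous_intros) auto
    show "isCont Arg (z / z)" using z by (intro continuous_at_Arg) simp
  qed
  moreover have "Arg (z / z) = 0" using z by simp
  ultimately obtain d where d: "d > 0" "\<And>w. dist w z < d \<Longrightarrow> \<bar>Arg (w / z)\<bar> < \<epsilon>"
    using \<epsilon> unfolding continuous_at_eps_delta by (metis dist_0_norm dist_commute real_norm_def)
  have "w \<in> sector (Arg2pi z) \<epsilon>" if w: "w \<in> ball z (min d (cmod z))" for w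
  proof -
    have w0: "w \<noteq> 0" using w by (auto simp: dist_norm)
    have "w = z * (w / z)" using z by simp
    also have "z = rcis (cmod z) (Arg2pi z)" by (simp add: rcis_def cis_conv_exp Arg2pi_eq[symmetric])
    also have "w / rcis (cmod z) (Arg2pi z) = w / z" by (simp add: rcis_def cis_conv_exp Arg2pi_eq[symmetric])
    also have "w / z = rcis (cmod (w / z)) (Arg (w / z))" by (simp add: rcis_cmod_Arg)
    finally have "w = rcis (cmod z * cmod (w / z)) (Arg2pi z + Arg (w / z))" by (simp only: rcis_mult)
    moreover have "cmod z * cmod (w / z) > 0" using w0 z by simp
    moreover have "\<bar>Arg (w / z)\<bar> < \<epsilon>" using d(2) w by (simp add: dist_commute)
    ultimately show ?thesis unfolding sector_def by (intro CollectI exI[of _ "cmod z * cmod (w / z)"] exI[of _ "Arg2pi z + Arg (w / z)"]) auto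
  qed
  then show ?thesis using d z by (intro exI[of _ "min d (cmod z)"]) auto
qed

lemma sector_scale: "t > 0 \<Longrightarrow> w \<in> sector \<theta> \<epsilon> \<Longrightarrow> of_real t * w \<in> sector \<theta> \<epsilon>"
proof -
  assume t: "t > 0" and "w \<in> sector \<theta> \<epsilon>"
  then obtain \<rho> \<phi> where "w = rcis \<rho> \<phi>" "\<rho> > 0" "\<theta> - \<epsilon> < \<phi>" "\<phi> < \<theta> + \<epsilon>" by (auto simp: sector_def)
  then have "of_real t * w = rcis (t * \<rho>) \<phi>" "t * \<rho> > 0" using t by (auto simp: rcis_def)
  then show ?thesis using \<open>\<theta> - \<epsilon> < \<phi>\<close> \<open>\<phi> < \<theta> + \<epsilon>\<close> unfolding sector_def by blast
qed

lemma zero_notin_sector: "0 \<notin> sector \<theta> \<epsilon>"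
  by (auto simp: sector_def)

text \<open>Rescaling the disc of radius t \<delta> to the unit disc with R = t powr \<beta> bounds
  both the squared density and the number of zeros by multiples of R. The radius \<delta> depends on
  the sector where the direction fails but not on \<epsilon>, as the compactness argument
  requires.\<close>

lemma small_area_near_ray:
  fixes V :: "(complex ^ 'n::{finite,linorder}) set set" and F :: "complex \<Rightarrow> complex ^ 'n::{finite,linorder}"
  assumes V: "projective_variety V" and hol: "\<And>i. (\<lambda>z. F z $ i) holomorphic_on UNIV"
    and nz: "\<And>z. F z \<noteq> 0" and FV: "\<And>z. proj_point (F z) \<in> V"
    and M: "M > 0" and FS: "\<And>t z. t \<ge> r1 \<Longrightarrow> t / 2 \<le> cmod z \<Longrightarrow> cmod z \<le> 3 * t \<Longrightarrow> (FS_deriv F z)\<^sup>2 \<le> M * t powr (\<beta> - 2)"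
    and \<beta>: "\<beta> > 0" and C: "C > 0" and T: "\<And>r. r \<ge> r1 \<Longrightarrow> nev_char F r \<le> C * r powr \<beta>"
    and z0: "1 \<le> cmod z0" "cmod z0 \<le> 2" and no: "\<not> Tbar_direction V F (Arg2pi z0)"
  shows "\<exists>\<delta>>0. \<forall>\<epsilon>>0. eventually (\<lambda>t. FS_area F (of_real t * z0) (t * \<delta>) \<le> \<epsilon> * t powr \<beta>) at_top"
proof -
  let ?\<theta> = "Arg2pi z0"
  obtain e q and D :: "nat \<Rightarrow> 'n cpoly" where e: "0 < e" and q: "q \<ge> 1"
    and hyp: "\<And>i. i \<in> {1..q} \<Longrightarrow> hypersurface (D i)"
    and fin: "finite ((\<Inter>i\<in>{1..q}. Supp (D i)) \<inter> V)"
    and neg: "\<not> (MAX i\<in>{1..q}. Limsup at_top (\<lambda>r. nev_count F r (sector ?\<theta> e) (D i) / ereal (nev_char F r))) > 0"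
    using no unfolding Tbar_direction_def by blast
  let ?\<Omega> = "sector ?\<theta> e"
  have L: "Limsup at_top (\<lambda>r. nev_count F r ?\<Omega> (D i) / ereal (nev_char F r)) \<le> 0" if "i \<in> {1..q}" for i
  proof -
    have "Limsup at_top (\<lambda>r. nev_count F r ?\<Omega> (D i) / ereal (nev_char F r)) \<le>
      (MAX i\<in>{1..q}. Limsup at_top (\<lambda>r. nev_count F r ?\<Omega> (D i) / ereal (nev_char F r)))"
      using that by (intro Max_ge) auto
    then show ?thesis using neg by (simp add: not_less)
  qed
  have N: "eventually (\<lambda>r. nev_count F r ?\<Omega> (D i) \<le> ereal (c * nev_char F r)) at_top" if "i \<in> {1..q}" "c > 0" for i c
    by (rule Limsup_quotient_le_0_imp_eventually[OF L[OF that(1)] nev_count_nonneg nev_char_nonneg that(2)])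
  \<comment> \<open>A polynomial vanishing along the whole curve would have infinite counting
    function, against its bound by a multiple of \<open>nev_char\<close>.\<close>
  have Qnz: "\<exists>w. cpoly_eval (D i) (F w) \<noteq> 0" if "i \<in> {1..q}" for i
  proof (rule ccontr)
    assume "\<not> ?thesis"
    then have "nev_count F r ?\<Omega> (D i) = \<infinity>" for r by (simp add: nev_count_def)
    then have "eventually (\<lambda>r :: real. False) at_top" using N[OF that, of 1] by simp
    then show False by simp
  qed
  have z00: "z0 \<noteq> 0" using z0 by auto
  obtain d where d: "d > 0" "ball z0 d \<subseteq> ?\<Omega>" using sector_neighbourhood[OF z00 e] by blast
  \<comment> \<open>The disc enlarged four times stays in the sector, and its points have modulus
    between t / 2 and 3 t.\<close>
  define \<delta> where "\<delta> = min (d / 4) (1 / 8)"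
  have \<delta>: "\<delta> > 0" "4 * \<delta> \<le> d" "4 * \<delta> \<le> 1 / 2" using d by (auto simp: \<delta>_def)
  have disc: "w \<in> ?\<Omega> \<and> t / 2 \<le> cmod w \<and> cmod w < 3 * t"
    if t: "t > 0" and w: "w \<in> ball (of_real t * z0) (4 * (t * \<delta>))" for t w
  proof -
    define u where "u = w / of_real t"
    have wu: "w = of_real t * u" using t by (simp add: u_def)
    have "of_real t * z0 - w = of_real t * (z0 - u)" by (simp add: wu algebra_simps)
    then have "cmod (of_real t * z0 - w) = t * cmod (z0 - u)" using t by (simp add: norm_mult)
    then have "t * cmod (z0 - u) < t * (4 * \<delta>)" using w by (simp add: dist_norm mult_ac)
    then have lt: "cmod (z0 - u) < 4 * \<delta>" using t by simp
    then have "u \<in> ball z0 d" using \<delta> by (simp add: dist_norm)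
    then have "w \<in> ?\<Omega>" unfolding wu using d t by (intro sector_scale) auto
    moreover have "1 / 2 \<le> cmod u" "cmod u < 3"
      using lt \<delta> z0 norm_triangle_ineq2[of z0 u] norm_triangle_sub[of u z0] by (auto simp: norm_minus_commute)
    then have "t * (1 / 2) \<le> t * cmod u" "t * cmod u < t * 3" using t by (auto intro!: mult_left_mono)
    ultimately show ?thesis using t by (simp add: wu norm_mult)
  qed
  show ?thesis
  proof (intro exI[of _ \<delta>] conjI allI impI)
    show "\<delta> > 0" by (rule \<delta>)
    fix \<epsilon> :: real assume \<epsilon>: "\<epsilon> > 0"
    obtain \<nu> R0 where \<nu>: "\<nu> > 0" and core: "\<forall>R\<ge>R0. \<forall>G :: complex \<Rightarrow> complex ^ 'n::{finite,linorder}.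
     (\<forall>i. (\<lambda>z. G z $ i) holomorphic_on UNIV) \<longrightarrow> (\<forall>z. G z \<noteq> 0 \<and> proj_point (G z) \<in> V) \<longrightarrow>
     (\<forall>z\<in>ball 0 4. (FS_deriv G z)\<^sup>2 \<le> M * R) \<longrightarrow>
     (\<forall>i\<in>{1..q}. few_zeros (\<nu> * R) (\<lambda>z. cpoly_eval (D i) (G z))) \<longrightarrow>
     FS_area G 0 1 \<le> \<epsilon> * R"
      using few_zeros_small_area[OF V _ hyp fin M \<epsilon>] by blast
    \<comment> \<open>The number of zeros up to 3 t is at most twice the counting function at 6 t,
      hence at most 2 c C (6 t) powr \<beta>, which is \<nu> R.\<close>
    define c where "c = \<nu> / (2 * C * 6 powr \<beta>)"
    have c: "c > 0" using \<nu> C by (simp add: c_def)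
    have "eventually (\<lambda>r. \<forall>i\<in>{1..q}. nev_count F r ?\<Omega> (D i) \<le> ereal (c * nev_char F r)) at_top"
      using N c by (intro eventually_ball_finite) auto
    then obtain r2 where r2: "\<And>r i. r \<ge> r2 \<Longrightarrow> i \<in> {1..q} \<Longrightarrow> nev_count F r ?\<Omega> (D i) \<le> ereal (c * nev_char F r)"
      unfolding eventually_at_top_linorder by blast
    define t0 where "t0 = max (max 1 (max r1 r2)) (max 0 R0 powr (1 / \<beta>))"
    have "FS_area F (of_real t * z0) (t * \<delta>) \<le> \<epsilon> * t powr \<beta>" if t: "t \<ge> t0" for t
    proof -
      have t1: "t \<ge> 1" "t \<ge> r1" "6 * t \<ge> r1" "6 * t \<ge> r2" using t by (auto simp: t0_def)
      define k where "k = t * \<delta>"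
      have k: "k > 0" "k \<le> t" using t1 \<delta> by (auto simp: k_def mult_le_cancel_left1)
      define R where "R = t powr \<beta>"
      have "(max 0 R0 powr (1 / \<beta>)) powr \<beta> \<le> t powr \<beta>" using t \<beta> by (intro powr_mono2) (auto simp: t0_def)
      then have R: "R \<ge> R0" using \<beta> by (simp add: powr_powr R_def)
      let ?c = "of_real t * z0"
      define G where "G \<zeta> = F (?c + of_real k * \<zeta>)" for \<zeta>
      have FSG: "FS_deriv G \<zeta> = k * FS_deriv F (?c + of_real k * \<zeta>)" for \<zeta>
        unfolding G_def using FS_deriv_affine[OF hol, of ?c "of_real k" \<zeta>] k by simp
      have "FS_area G 0 1 \<le> \<epsilon> * R"
      proof (rule core[rule_format, OF R])
        fix i
        have "(\<lambda>w. F w $ i) \<circ> (\<lambda>\<zeta>. ?c + of_real k * \<zeta>) holomorphic_on UNIV"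
          by (intro holomorphic_on_compose holomorphic_intros holomorphic_on_subset[OF hol]) auto
        then show "(\<lambda>z. G z $ i) holomorphic_on UNIV" by (simp add: G_def o_def)
      next
        show "G z \<noteq> 0 \<and> proj_point (G z) \<in> V" for z using nz FV by (simp add: G_def)
      next
        fix \<zeta> :: complex assume "\<zeta> \<in> ball 0 4"
        then have "?c + of_real k * \<zeta> \<in> ball ?c (4 * (t * \<delta>))" using k by (simp add: dist_norm norm_mult k_def[symmetric])
        from disc[OF _ this] have "(FS_deriv F (?c + of_real k * \<zeta>))\<^sup>2 \<le> M * t powr (\<beta> - 2)"
          using t1 by (intro FS) auto
        then have "k\<^sup>2 * (FS_deriv F (?c + of_real k * \<zeta>))\<^sup>2 \<le> t\<^sup>2 * (M * t powr (\<beta> - 2))"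
          using k by (intro mult_mono power_mono) auto
        also have "t\<^sup>2 * (M * t powr (\<beta> - 2)) = M * R"
          using t1 by (simp add: R_def powr_diff)
        finally show "(FS_deriv G \<zeta>)\<^sup>2 \<le> M * R" by (simp add: FSG power_mult_distrib)
      next
        fix i assume i: "i \<in> {1..q}"
        have "ereal (real (zero_count F (2 * (3 / 2 * t)) ?\<Omega> (D i)) / 2) \<le> nev_count F (4 * (3 / 2 * t)) ?\<Omega> (D i)"
          using t1 by (intro zero_count_le_nev_count hol Qnz i zero_notin_sector) auto
        also have "\<dots> \<le> ereal (c * nev_char F (6 * t))" using r2[OF t1(4) i] by simp
        finally have "real (zero_count F (3 * t) ?\<Omega> (D i)) \<le> 2 * (c * nev_char F (6 * t))" by simp
        also have "\<dots> \<le> 2 * (c * (C * (6 * t) powr \<beta>))" using T[OF t1(3)] c by simp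
        also have "\<dots> = \<nu> * R" using C t1 by (simp add: c_def R_def powr_mult)
        finally have "real (zero_count F (3 * t) ?\<Omega> (D i)) \<le> \<nu> * R" .
        moreover have "few_zeros (real (zero_count F (3 * t) ?\<Omega> (D i))) (\<lambda>\<zeta>. cpoly_eval (D i) (F (?c + of_real k * \<zeta>)))"
        proof (rule few_zeros_rescaled[OF hol Qnz[OF i] k(1)])
          show "ball ?c (4 * k) \<subseteq> ball 0 (3 * t) \<inter> ?\<Omega>"
            using disc[of t] t1 by (auto simp: k_def)
        qed
        ultimately show "few_zeros (\<nu> * R) (\<lambda>z. cpoly_eval (D i) (G z))"
          unfolding G_def by (rule few_zeros_mono[rotated])
      qed
      moreover have "FS_area F ?c k = FS_area G 0 1"
        unfolding FSG power_mult_distrib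
        by (subst set_integral_cball_affine[OF continuous_FS_deriv_square[OF hol nz] k(1)]) simp
      ultimately show ?thesis by (simp add: k_def R_def)
    qed
    then show "eventually (\<lambda>t. FS_area F (of_real t * z0) (t * \<delta>) \<le> \<epsilon> * t powr \<beta>) at_top"
      unfolding eventually_at_top_linorder by blast
  qed
qed

section \<open>Covering of annuli and the contradiction\<close>

theorem theorem9:
  fixes V :: "(complex ^ 'n::{finite,linorder}) set set"
    and f :: "complex \<Rightarrow> (complex ^ 'n::{finite,linorder}) set"
    and F :: "complex \<Rightarrow> complex ^ 'n::{finite,linorder}"
    and \<sigma> :: real
  assumes "projective_variety V"
    and "holomorphic_curve V f"
    and "homogeneous_rep f F"
    and "\<sigma> > -1"
    and "FS_deriv F \<in> O[at_infinity](\<lambda>z. norm z powr \<sigma>)"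
    and "Limsup at_top (\<lambda>r. ereal (nev_char F r / r powr (2 * \<sigma> + 2))) > 0"
  shows "\<exists>\<theta>. 0 \<le> \<theta> \<and> \<theta> \<le> 2 * pi \<and> Tbar_direction V F \<theta>"
proof (rule ccontr)
  assume "\<not> ?thesis"
  \<comment> \<open>Rays are now indexed by points on them, in preparation for the compactness of an
    annulus.\<close>
  then have no: "\<not> Tbar_direction V F (Arg2pi z)" for z using Arg2pi[of z] by force
  have hol: "(\<lambda>z. F z $ i) holomorphic_on UNIV" and nz: "F z \<noteq> 0" for i z
    using assms(3) by (auto simp: homogeneous_rep_def)
  have FV: "proj_point (F z) \<in> V" for z
    using assms(2,3) by (auto simp: holomorphic_curve_def homogeneous_rep_def)
  define \<beta> where "\<beta> = 2 * \<sigma> + 2"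
  have \<beta>: "\<beta> > 0" using assms(4) by (simp add: \<beta>_def)
  let ?g = "\<lambda>z. (FS_deriv F z)\<^sup>2"
  note cont = continuous_FS_deriv_square[OF hol nz]
  have int: "set_integrable lborel (cball a r) ?g" for a r
    by (intro set_integrable_continuous_compact cont compact_cball)
  obtain c0 where c0: "c0 > 0" and "eventually (\<lambda>z. norm (FS_deriv F z) \<le> c0 * norm (norm z powr \<sigma>)) at_infinity"
    using assms(5) by (elim landau_o.bigE)
  then obtain b where b: "\<And>z. cmod z \<ge> b \<Longrightarrow> FS_deriv F z \<le> c0 * cmod z powr \<sigma>"
    using FS_deriv_nonneg[of F] by (auto simp: eventually_at_infinity)
  \<comment> \<open>The factor 3 powr |2 \<sigma>| compares |z| with t for either sign of \<sigma>,
    as t / 3 \<le> |z| \<le> 3 t.\<close>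
  define M where "M = c0\<^sup>2 * 3 powr \<bar>2 * \<sigma>\<bar>"
  have M: "M > 0" using c0 by (simp add: M_def)
  define r1 where "r1 = max 1 (2 * b)"
  have FS: "?g z \<le> M * t powr (\<beta> - 2)" if t: "t \<ge> r1" "t / 2 \<le> cmod z" "cmod z \<le> 3 * t" for t z
  proof -
    have tp: "t > 0" and zb: "cmod z \<ge> b" using t by (auto simp: r1_def)
    have zp: "cmod z > 0" using t tp by linarith
    have "?g z \<le> (c0 * cmod z powr \<sigma>)\<^sup>2" using b[OF zb] by (intro power_mono FS_deriv_nonneg)
    also have "\<dots> = c0\<^sup>2 * cmod z powr (2 * \<sigma>)"
      unfolding power_mult_distrib power2_eq_square[of "cmod z powr \<sigma>"] by (simp only: powr_add[symmetric] mult_2)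
    also have "cmod z powr (2 * \<sigma>) \<le> 3 powr \<bar>2 * \<sigma>\<bar> * t powr (2 * \<sigma>)"
    proof (cases "\<sigma> \<ge> 0")
      case True
      then have "cmod z powr (2 * \<sigma>) \<le> (3 * t) powr (2 * \<sigma>)" using t zp by (intro powr_mono2) auto
      then show ?thesis using True tp by (simp add: powr_mult)
    next
      case False
      have "cmod z powr (2 * \<sigma>) \<le> (t / 3) powr (2 * \<sigma>)" using t tp False by (intro powr_mono2') auto
      also have "\<dots> = 3 powr (- (2 * \<sigma>)) * t powr (2 * \<sigma>)" using tp by (simp add: powr_divide powr_minus field_simps)
      finally show ?thesis using False by simp
    qed
    finally show ?thesis using c0 by (simp add: M_def \<beta>_def mult_ac mult_left_mono)
  qed
  \<comment> \<open>Its dilate by t contains all that the disc of radius 2 t adds to the disc of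
    radius t, so one finite cover bounds the increments of the area for all t.\<close>
  define annulus where "annulus = cball (0::complex) 2 - ball 0 1"
  have an: "compact annulus" unfolding annulus_def by (intro compact_diff) auto
  have split: "(LINT z:cball 0 (2 * t)|lborel. ?g z) \<le> (LINT z:cball 0 t|lborel. ?g z) + (\<Sum>j\<in>J. LINT z:cball (of_real t * j) (t * \<delta> j)|lborel. ?g z)"
    if t: "t > 0" and J: "finite J" "annulus \<subseteq> (\<Union>j\<in>J. cball j (\<delta> j))" for t J and \<delta> :: "complex \<Rightarrow> real"
  proof -
    let ?I = "\<lambda>X z. indicat_real X z *\<^sub>R ?g z"
    have i: "integrable lborel (?I (cball a r))" for a r using int by (simp add: set_integrable_def)
    have "(LINT z|lborel. ?I (cball 0 (2 * t)) z) \<le> (LINT z|lborel. ?I (cball 0 t) z + (\<Sum>j\<in>J. ?I (cball (of_real t * j) (t * \<delta> j)) z))"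
    proof (rule integral_mono[OF i Bochner_Integration.integrable_add[OF i Bochner_Integration.integrable_sum[OF i]]])
      fix z :: complex
      have nn: "0 \<le> ?I X z" for X by simp
      show "?I (cball 0 (2 * t)) z \<le> ?I (cball 0 t) z + (\<Sum>j\<in>J. ?I (cball (of_real t * j) (t * \<delta> j)) z)"
      proof (cases "z \<in> cball 0 (2 * t) - cball 0 t")
        case True
        then have "z / of_real t \<in> annulus" using t by (auto simp: annulus_def norm_divide field_simps)
        then obtain j where j: "j \<in> J" "z / of_real t \<in> cball j (\<delta> j)" using J by blast
        have "of_real t * j - z = of_real t * (j - z / of_real t)" using t by (simp add: algebra_simps)
        then have "cmod (of_real t * j - z) = t * cmod (j - z / of_real t)" using t by (simp only: norm_mult) simp
        then have "z \<in> cball (of_real t * j) (t * \<delta> j)" using j t by (simp add: dist_norm)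
        then have "?I (cball 0 (2 * t)) z \<le> ?I (cball (of_real t * j) (t * \<delta> j)) z" using True by simp
        also have "\<dots> \<le> (\<Sum>j\<in>J. ?I (cball (of_real t * j) (t * \<delta> j)) z)"
          using member_le_sum[OF j(1), of "\<lambda>j. ?I (cball (of_real t * j) (t * \<delta> j)) z"] nn J by auto
        finally show ?thesis using nn[of "cball 0 t"] by linarith
      next
        case False
        then have "?I (cball 0 (2 * t)) z \<le> ?I (cball 0 t) z" using t by (auto simp: indicator_def)
        moreover have "0 \<le> (\<Sum>j\<in>J. ?I (cball (of_real t * j) (t * \<delta> j)) z)" by (intro sum_nonneg nn)
        ultimately show ?thesis by linarith
      qed
    qed
    also have "\<dots> = (LINT z|lborel. ?I (cball 0 t) z) + (\<Sum>j\<in>J. LINT z|lborel. ?I (cball (of_real t * j) (t * \<delta> j)) z)"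
      by (subst Bochner_Integration.integral_add[OF i Bochner_Integration.integrable_sum[OF i]],
          subst Bochner_Integration.integral_sum[OF i]) simp
    finally show ?thesis unfolding set_lebesgue_integral_def .
  qed
  \<comment> \<open>Failure of the directions makes the counting functions small relative to
    \<open>nev_char\<close>; this bound, obtained from the density alone, makes them small relative
    to r powr \<beta>.\<close>
  have "\<exists>C>0. eventually (\<lambda>r. nev_char F r \<le> C * r powr \<beta>) at_top"
  proof -
    define E where "E = M * 4 * pi"
    have E: "E > 0" using M by (simp add: E_def)
    have "(LINT z:cball 0 (2 * t)|lborel. ?g z) \<le> (LINT z:cball 0 t|lborel. ?g z) + E * t powr \<beta>" if t: "t \<ge> r1" for t
    proof -
      have tp: "t > 0" using t by (auto simp: r1_def)
      have i: "integrable lborel (\<lambda>z. indicat_real (cball a r) z *\<^sub>R ?g z)" for a r using int by (simp add: set_integrable_def)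
      have ic: "integrable lborel (\<lambda>z. indicat_real (cball (0::complex) (2 * t)) z *\<^sub>R (M * t powr (\<beta> - 2)))"
        by (rule borel_integrable_compact) auto
      have "(LINT z|lborel. indicat_real (cball 0 (2 * t)) z *\<^sub>R ?g z) \<le>
        (LINT z|lborel. indicat_real (cball 0 t) z *\<^sub>R ?g z + indicat_real (cball 0 (2 * t)) z *\<^sub>R (M * t powr (\<beta> - 2)))"
      proof (rule integral_mono[OF i Bochner_Integration.integrable_add[OF i ic]])
        fix z :: complex
        show "indicat_real (cball 0 (2 * t)) z *\<^sub>R ?g z \<le> indicat_real (cball 0 t) z *\<^sub>R ?g z + indicat_real (cball 0 (2 * t)) z *\<^sub>R (M * t powr (\<beta> - 2))"
          using FS[OF t, of z] tp M by (auto simp: indicator_def)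
      qed
      also have "\<dots> = (LINT z|lborel. indicat_real (cball 0 t) z *\<^sub>R ?g z) + (LINT z:cball (0::complex) (2 * t)|lborel. M * t powr (\<beta> - 2))"
        unfolding set_lebesgue_integral_def by (rule Bochner_Integration.integral_add[OF i ic])
      also have "(LINT z:cball (0::complex) (2 * t)|lborel. M * t powr (\<beta> - 2)) = E * (t\<^sup>2 * t powr (\<beta> - 2))"
        using tp by (simp add: set_integral_const_cball measure_cball_complex E_def power_mult_distrib)
      also have "t\<^sup>2 * t powr (\<beta> - 2) = t powr \<beta>" using tp by (simp add: powr_diff)
      finally show ?thesis unfolding set_lebesgue_integral_def .
    qed
    then have "eventually (\<lambda>t. (LINT z:cball 0 (2 * t)|lborel. ?g z) \<le> (LINT z:cball 0 t|lborel. ?g z) + E * t powr \<beta>) at_top"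
      unfolding eventually_at_top_linorder by blast
    from nev_char_growth[OF hol nz \<beta> E this]
    have "eventually (\<lambda>r. nev_char F r \<le> 4 * E / ((2 powr \<beta> - 1) * \<beta>) * r powr \<beta>) at_top" .
    moreover have "4 * E / ((2 powr \<beta> - 1) * \<beta>) > 0" using E \<beta> by simp
    ultimately show ?thesis by blast
  qed
  then obtain C r2 where C: "C > 0" and T: "\<And>r. r \<ge> r2 \<Longrightarrow> nev_char F r \<le> C * r powr \<beta>"
    unfolding eventually_at_top_linorder by blast
  have near: "\<exists>\<delta>>0. \<forall>\<epsilon>>0. eventually (\<lambda>t. (LINT z:cball (of_real t * z0) (t * \<delta>)|lborel. ?g z) \<le> \<epsilon> * t powr \<beta>) at_top"
    if z0: "z0 \<in> annulus" for z0
  proof (rule small_area_near_ray[OF assms(1) hol nz FV M _ \<beta> C _ _ _ no, where ?r1.0 = "max r1 r2"])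
    show "?g z \<le> M * t powr (\<beta> - 2)" if "t \<ge> max r1 r2" "t / 2 \<le> cmod z" "cmod z \<le> 3 * t" for t z
      by (rule FS) (use that in auto)
  qed (use T z0 in \<open>auto simp: annulus_def\<close>)
  have "\<forall>z0\<in>annulus. \<exists>\<delta>>0. \<forall>\<epsilon>>0. eventually
       (\<lambda>t. (LINT z:cball (of_real t * z0) (t * \<delta>)|lborel. ?g z) \<le> \<epsilon> * t powr \<beta>) at_top"
    by (intro ballI near)
  from bchoice[OF this] obtain \<delta> where \<delta>': "\<forall>z0\<in>annulus. 0 < \<delta> z0 \<and> (\<forall>\<epsilon>>0. eventually
       (\<lambda>t. (LINT z:cball (of_real t * z0) (t * \<delta> z0)|lborel. ?g z) \<le> \<epsilon> * t powr \<beta>) at_top)"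
    by (elim exE) (rule that)
  have \<delta>: "\<delta> z0 > 0" if "z0 \<in> annulus" for z0
    using bspec[OF \<delta>' that] by (rule conjunct1)
  have ev: "eventually (\<lambda>t. (LINT z:cball (of_real t * z0) (t * \<delta> z0)|lborel. ?g z) \<le> \<epsilon> * t powr \<beta>) at_top"
    if "z0 \<in> annulus" "\<epsilon> > 0" for z0 \<epsilon>
    using bspec[OF \<delta>' that(1)] that(2) by (elim conjE allE impE)
  \<comment> \<open>The radii were fixed before any \<epsilon>, so one finite subcover works for
    every \<epsilon>.\<close>
  obtain J where J: "J \<subseteq> annulus" "finite J" "annulus \<subseteq> (\<Union>j\<in>J. ball j (\<delta> j))"
    by (rule compactE_image[OF an, of annulus "\<lambda>j. ball j (\<delta> j)"]) (use \<delta> in force)+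
  then have J': "annulus \<subseteq> (\<Union>j\<in>J. cball j (\<delta> j))" by (meson UN_mono ball_subset_cball order.refl order.trans)
  have small: "eventually (\<lambda>r. nev_char F r \<le> 4 * E / ((2 powr \<beta> - 1) * \<beta>) * r powr \<beta>) at_top" if E: "E > 0" for E
  proof (rule nev_char_growth[OF hol nz \<beta> E])
    define \<epsilon> where "\<epsilon> = E / (real (card J) + 1)"
    have \<epsilon>: "\<epsilon> > 0" "real (card J) * \<epsilon> \<le> E" using E by (auto simp: \<epsilon>_def field_simps)
    have "eventually (\<lambda>t. \<forall>j\<in>J. (LINT z:cball (of_real t * j) (t * \<delta> j)|lborel. ?g z) \<le> \<epsilon> * t powr \<beta>) at_top"
      using ev \<epsilon> J by (intro eventually_ball_finite) auto
    then show "eventually (\<lambda>t. (LINT z:cball 0 (2 * t)|lborel. ?g z) \<le> (LINT z:cball 0 t|lborel. ?g z) + E * t powr \<beta>) at_top"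
      using eventually_gt_at_top[of 0]
    proof eventually_elim
      case (elim t)
      have "(\<Sum>j\<in>J. LINT z:cball (of_real t * j) (t * \<delta> j)|lborel. ?g z) \<le> (\<Sum>j\<in>J. \<epsilon> * t powr \<beta>)"
        using elim by (intro sum_mono) auto
      also have "\<dots> = (real (card J) * \<epsilon>) * t powr \<beta>" by simp
      also have "\<dots> \<le> E * t powr \<beta>" using \<epsilon> by (intro mult_right_mono) auto
      finally show ?case using split[OF elim(2) J(2) J'] by linarith
    qed
  qed
  define L where "L = Limsup at_top (\<lambda>r. ereal (nev_char F r / r powr \<beta>))"
  have "L \<le> ereal e" if e: "e > 0" for e
  proof -
    define E where "E = e * ((2 powr \<beta> - 1) * \<beta>) / 4"
    have p: "(2 powr \<beta> - 1) * \<beta> > 0" using \<beta> by simp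
    have "4 * E / ((2 powr \<beta> - 1) * \<beta>) = e" using \<beta> by (simp add: E_def)
    moreover have "E > 0" using e p by (simp add: E_def)
    ultimately have "eventually (\<lambda>r. nev_char F r \<le> e * r powr \<beta>) at_top" using small[of E] by simp
    then have "eventually (\<lambda>r. ereal (nev_char F r / r powr \<beta>) \<le> ereal e) at_top"
      using eventually_gt_at_top[of 0] by eventually_elim (simp add: divide_le_eq)
    then show ?thesis unfolding L_def by (rule Limsup_bounded)
  qed
  then have "L \<le> 0"
    by (intro ereal_le_epsilon2[of L 0, rule_format]) (auto simp: zero_ereal_def)
  then show False using assms(6) by (simp add: L_def \<beta>_def)
qed

end
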